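(* For $\rho>0$ let $g_\rho$ denote the Berger metric on $S^3$. Consider the normalised width $N(\rho)=W(S^3,g_\rho)/\mathrm{vol}(S^3,g_\rho)^{2/3}$. Then the round metric ($\rho=1$) is a strict local minimum of $N$ in the one-parameter family $\{g_\rho\}_{\rho>0}$. Moreover, $N$ is not bounded from above on the family of Berger metrics, and not even on the subfamily of Berger metrics with positive Ricci curvature.
   Context: The Berger metric $g_\rho$, $\rho>0$, is the homogeneous metric on $S^3$ obtained from the round metric $g_1$ of constant sectional curvature one by rescaling along the fibres of the Hopf fibration so that the vector field generating the standard Hopf action has norm $\rho$, while the metric is unchanged on the orthogonal complement of this field. Width: regard $S^3\subset\mathbb{R}^4$ as the unit sphere and let $\overline{\Sigma}_t=\{x\in S^3:x^4=t\}$, $t\in[-1,1]$. A sweep-out is a family $\Sigma_t=F_t(\overline{\Sigma}_t)$ where $F_t$, $t\in[-1,1]$, is a smooth one-parameter family of diffeomorphisms of $S^3$ isotopic to the identity; $W(S^3,g)=\inf$ over all sweep-outs of $\max_t \mathrm{area}(\Sigma_t,g)$. *)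

theory Defs
  imports "HOL-Analysis.Analysis"
begin

definition S3 :: "(real^4) set" where
  "S3 = sphere 0 1"

text \<open>Generator of the standard Hopf action e^{i s}(z1,z2), z1 = x1 + i x2, z2 = x3 + i x4.\<close>
definition hopf_field :: "real^4 \<Rightarrow> real^4" where
  "hopf_field x = vector [- x$2, x$1, - x$4, x$3]"

text \<open>Berger metric g_rho at the point x, on tangent vectors v w: the component along the
  (unit) Hopf field is rescaled so that the Hopf field has norm rho; the orthogonal
  complement is unchanged.\<close>
definition berger :: "real \<Rightarrow> real^4 \<Rightarrow> real^4 \<Rightarrow> real^4 \<Rightarrow> real" where
  "berger \<rho> x v w = v \<bullet> w + (\<rho>^2 - 1) * (v \<bullet> hopf_field x) * (w \<bullet> hopf_field x)"

coinductive smooth_on :: "'a::euclidean_space set \<Rightarrow> ('a \<Rightarrow> real) \<Rightarrow> bool" for U where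
  "f differentiable_on U \<Longrightarrow> (\<And>i. i \<in> Basis \<Longrightarrow> smooth_on U (\<lambda>x. frechet_derivative f (at x) i))
     \<Longrightarrow> smooth_on U f"

definition smooth_map_on :: "'a::euclidean_space set \<Rightarrow> ('a \<Rightarrow> 'b::euclidean_space) \<Rightarrow> bool" where
  "smooth_map_on U f \<longleftrightarrow> open U \<and> (\<forall>b\<in>Basis. smooth_on U (\<lambda>x. f x \<bullet> b))"

definition smooth_on_set :: "'a::euclidean_space set \<Rightarrow> ('a \<Rightarrow> 'b::euclidean_space) \<Rightarrow> bool" where
  "smooth_on_set S f \<longleftrightarrow> (\<exists>U g. open U \<and> S \<subseteq> U \<and> smooth_map_on U g \<and> (\<forall>x\<in>S. g x = f x))"

definition S3_diffeo :: "(real^4 \<Rightarrow> real^4) \<Rightarrow> bool" where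
  "S3_diffeo f \<longleftrightarrow> bij_betw f S3 S3 \<and> smooth_on_set S3 f \<and> smooth_on_set S3 (inv_into S3 f)"

definition isotopic_to_id :: "(real^4 \<Rightarrow> real^4) \<Rightarrow> bool" where
  "isotopic_to_id f \<longleftrightarrow> (\<exists>H :: real \<Rightarrow> real^4 \<Rightarrow> real^4.
      smooth_on_set ({0..1} \<times> S3) (\<lambda>(s,x). H s x) \<and> (\<forall>s\<in>{0..1}. S3_diffeo (H s)) \<and>
      (\<forall>x\<in>S3. H 0 x = x \<and> H 1 x = f x))"

definition sweepout :: "(real \<Rightarrow> real^4 \<Rightarrow> real^4) \<Rightarrow> bool" where
  "sweepout F \<longleftrightarrow> smooth_on_set ({-1..1} \<times> S3) (\<lambda>(t,x). F t x) \<and>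
     (\<forall>t\<in>{-1..1}. S3_diffeo (F t) \<and> isotopic_to_id (F t))"

definition param_volume ::
  "(real^4 \<Rightarrow> real^4 \<Rightarrow> real^4 \<Rightarrow> real) \<Rightarrow> (real^'k \<Rightarrow> real^4) \<Rightarrow> (real^'k) set \<Rightarrow> real" where
  "param_volume g q D = integral D (\<lambda>u. sqrt (det (\<chi> i j.
      g (q u) (frechet_derivative q (at u) (axis i 1)) (frechet_derivative q (at u) (axis j 1)))))"

text \<open>Parametrisation of the slice {x in S^3. x4 = t} (a 2-sphere of radius sqrt(1-t^2),
  degenerate to a point for t = +-1) by spherical coordinates on [0,pi] x [0,2pi].\<close>
definition slice_param :: "real \<Rightarrow> real^2 \<Rightarrow> real^4" where
  "slice_param t u = vector [sqrt (1 - t^2) * sin (u$1) * cos (u$2),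
                             sqrt (1 - t^2) * sin (u$1) * sin (u$2),
                             sqrt (1 - t^2) * cos (u$1), t]"

definition slice_domain :: "(real^2) set" where
  "slice_domain = cbox 0 (vector [pi, 2 * pi])"


definition sweep_area :: "(real^4 \<Rightarrow> real^4 \<Rightarrow> real^4 \<Rightarrow> real) \<Rightarrow> (real \<Rightarrow> real^4 \<Rightarrow> real^4) \<Rightarrow> real \<Rightarrow> real" where
  "sweep_area g F t = param_volume g (F t \<circ> slice_param t) slice_domain"

definition width :: "(real^4 \<Rightarrow> real^4 \<Rightarrow> real^4 \<Rightarrow> real) \<Rightarrow> real" where
  "width g = Inf {Sup ((\<lambda>t. sweep_area g F t) ` {-1..1}) | F. sweepout F}"

definition hopf_param :: "real^3 \<Rightarrow> real^4" where
  "hopf_param u = vector [cos (u$1) * cos (u$2), cos (u$1) * sin (u$2),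
                          sin (u$1) * cos (u$3), sin (u$1) * sin (u$3)]"

definition volume_S3 :: "(real^4 \<Rightarrow> real^4 \<Rightarrow> real^4 \<Rightarrow> real) \<Rightarrow> real" where
  "volume_S3 g = param_volume g hopf_param (cbox 0 (vector [pi / 2, 2 * pi, 2 * pi]))"

definition normalised_width :: "real \<Rightarrow> real" where
  "normalised_width \<rho> = width (berger \<rho>) / volume_S3 (berger \<rho>) powr (2/3)"

text \<open>Inverse stereographic projections from the north pole e4 (s = 1) and south pole -e4
  (s = -1); together these two charts cover S^3.\<close>
definition stereo_inv :: "real \<Rightarrow> real^3 \<Rightarrow> real^4" where
  "stereo_inv s y = vector [2 * y$1 / (1 + norm y ^ 2), 2 * y$2 / (1 + norm y ^ 2),
                            2 * y$3 / (1 + norm y ^ 2), s * (norm y ^ 2 - 1) / (1 + norm y ^ 2)]"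

definition partial :: "(real^3 \<Rightarrow> real) \<Rightarrow> 3 \<Rightarrow> real^3 \<Rightarrow> real" where
  "partial h i y = frechet_derivative h (at y) (axis i 1)"

definition metric_coeff :: "(real^4 \<Rightarrow> real^4 \<Rightarrow> real^4 \<Rightarrow> real) \<Rightarrow> (real^3 \<Rightarrow> real^4) \<Rightarrow> real^3 \<Rightarrow> real^3^3" where
  "metric_coeff g \<phi> y = (\<chi> i j. g (\<phi> y) (frechet_derivative \<phi> (at y) (axis i 1))
                                     (frechet_derivative \<phi> (at y) (axis j 1)))"

definition christoffel :: "(real^4 \<Rightarrow> real^4 \<Rightarrow> real^4 \<Rightarrow> real) \<Rightarrow> (real^3 \<Rightarrow> real^4) \<Rightarrow> 3 \<Rightarrow> 3 \<Rightarrow> 3 \<Rightarrow> real^3 \<Rightarrow> real" where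
  "christoffel g \<phi> k i j y = 1/2 * (\<Sum>l\<in>UNIV. matrix_inv (metric_coeff g \<phi> y) $ k $ l *
      (partial (\<lambda>z. metric_coeff g \<phi> z $ j $ l) i y + partial (\<lambda>z. metric_coeff g \<phi> z $ i $ l) j y
       - partial (\<lambda>z. metric_coeff g \<phi> z $ i $ j) l y))"

definition ricci :: "(real^4 \<Rightarrow> real^4 \<Rightarrow> real^4 \<Rightarrow> real) \<Rightarrow> (real^3 \<Rightarrow> real^4) \<Rightarrow> 3 \<Rightarrow> 3 \<Rightarrow> real^3 \<Rightarrow> real" where
  "ricci g \<phi> i j y = (\<Sum>k\<in>UNIV. partial (christoffel g \<phi> k i j) k y - partial (christoffel g \<phi> k i k) j y)
     + (\<Sum>k\<in>UNIV. \<Sum>l\<in>UNIV. christoffel g \<phi> k k l y * christoffel g \<phi> l i j y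
                           - christoffel g \<phi> k j l y * christoffel g \<phi> l i k y)"

definition positive_ricci :: "(real^4 \<Rightarrow> real^4 \<Rightarrow> real^4 \<Rightarrow> real) \<Rightarrow> bool" where
  "positive_ricci g \<longleftrightarrow> (\<forall>s\<in>{1, -1}. \<forall>y. \<forall>v::real^3. v \<noteq> 0 \<longrightarrow>
      (\<Sum>i\<in>UNIV. \<Sum>j\<in>UNIV. ricci g (stereo_inv s) i j y * v$i * v$j) > 0)"

end

theory Submission
  imports Defs
begin

text \<open>In every sweep-out some slice meets every great circle of $S^3$: two disjoint great circles are
  linked, so a slice, which bounds a contractible region, cannot have one of them on each side;
  connectedness of the parameter interval then yields a slice that misses none.
  A surface that meets all fibres of a Hopf fibration must cross almost all of them in both
  directions, so its projection to the base, which is a sphere of area $\pi$, covers it twice.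
  Applying this to the Hopf fibrations generated by all unit quaternions and averaging gives
  $W(S^3,g_\rho) \ge 4\pi(1+2\rho)/3$ for every $\rho>0$, with equality for the equator when $\rho=1$.
  As the volume is proportional to $\rho$, everything follows from
  $(1+2\rho)/3 > \rho^{2/3}$ for $\rho\neq 1$, from letting $\rho\to 0$, and from the Ricci curvature, which is
  positive as soon as $\rho^2<2$.\<close>

text \<open>The area density of a surface in g_\<rho> depends only on its area-weighted normal n,
  written in the quaternionic frame ix, jx, kx: it is |A n| with A = diag(1, \<rho>, \<rho>). The
  topological part supplies a slice for which the integral of |n . v| is at least 2 pi |v| for every
  v in R^3. On the unit sphere the integral of |w . u| over u is 2 pi |w|; applied to w = A n and
  combined with Fubini, this bounds the area below by the integral of |A u| over the sphere. Since
  |A u| >= \<rho> + (1 - \<rho>) z^2 for the first coordinate z of u, and z^2 has mean 1/3, the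
  constant 4 pi (1 + 2 \<rho>) / 3 results. The obstacle is that a slice may touch fibres
  tangentially. Instead of transversality or degree, the proof works with the set where the relevant
  normal component is weakly positive, or weakly negative. Each of these sets still projects onto
  the base, tangential points contribute no area, and an area formula in the form of an inequality
  asks for surjectivity only.\<close>

lemma vector_4:
  "(vector [a,b,c,d] :: 'a::zero^4) $ 1 = a" "(vector [a,b,c,d] :: 'a^4) $ 2 = b"
  "(vector [a,b,c,d] :: 'a^4) $ 3 = c" "(vector [a,b,c,d] :: 'a^4) $ 4 = d"
  by (simp_all add: vector_def)

lemma has_derivative_vecI:
  fixes f :: "'a::euclidean_space \<Rightarrow> real^'n"
  assumes "\<And>i. ((\<lambda>x. f x $ i) has_derivative (\<lambda>h. f' h $ i)) (at x within S)"
  shows "(f has_derivative f') (at x within S)"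
  using assms by (subst has_derivative_componentwise_within)
    (auto simp: Basis_vec_def cart_eq_inner_axis[symmetric])

lemma has_derivative_vec_nth:
  fixes f :: "'a::real_normed_vector \<Rightarrow> real^'n"
  assumes "(f has_derivative f') F"
  shows "((\<lambda>x. f x $ i) has_derivative (\<lambda>h. f' h $ i)) F"
  using bounded_linear.has_derivative[OF bounded_linear_vec_nth assms] .

lemma continuous_on_vec_nthI:
  fixes f :: "'b::topological_space \<Rightarrow> real^'n"
  shows "(\<And>i. continuous_on A (\<lambda>x. f x $ i)) \<Longrightarrow> continuous_on A f"
  using continuous_on_vec_lambda[of A "\<lambda>i x. f x $ i"] by simp

lemma inner_4: "(x::real^4) \<bullet> y = x$1*y$1 + x$2*y$2 + x$3*y$3 + x$4*y$4"
  by (simp add: inner_vec_def sum_4)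

lemma inner_3: "(x::real^3) \<bullet> y = x$1*y$1 + x$2*y$2 + x$3*y$3"
  by (simp add: inner_vec_def sum_3)


lemma norm_sq_3: "norm (y::real^3) ^ 2 = (y$1)^2 + (y$2)^2 + (y$3)^2"
  unfolding power2_norm_eq_inner inner_3 by (simp add: power2_eq_square)

section \<open>Ricci curvature of the Berger metrics\<close>

lemma partial_eq: "(h has_derivative h') (at y) \<Longrightarrow> partial h i y = h' (axis i 1)"
  unfolding partial_def by (metis frechet_derivative_at)

text \<open>Half the length scale of stereographic projection: in either chart the round metric is 4
  (conf y)^2 times the Euclidean one.\<close>

definition conf :: "real^3 \<Rightarrow> real" where
  "conf y = 1 / (1 + (y$1)^2 + (y$2)^2 + (y$3)^2)"

text \<open>In the chart \<open>stereo_inv s\<close> the form dual to the Hopf field has the coefficients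
  \<open>2 * conf y * hopf_dir s i y\<close>; \<open>hopf_dir\<close> is normalised to have Euclidean length one, so that
  all curvature computations become polynomial identities modulo this relation.\<close>
definition hopf_dir :: "real \<Rightarrow> 3 \<Rightarrow> real^3 \<Rightarrow> real" where
  "hopf_dir s i y = (if i = 1 then 2 * (s * y$3 * y$1 - y$2) * conf y
     else if i = 2 then 2 * (s * y$3 * y$2 + y$1) * conf y
     else s * (1 - (y$1)^2 - (y$2)^2 + (y$3)^2) * conf y)"

definition kron :: "3 \<Rightarrow> 3 \<Rightarrow> real" where "kron i j = (if i = j then 1 else 0)"

text \<open>The Levi-Civita symbol. It enters because on the three-sphere the covariant derivative
  of the Hopf field is, up to sign, the cross product with the field itself.\<close>

definition lc :: "3 \<Rightarrow> 3 \<Rightarrow> 3 \<Rightarrow> real" where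
  "lc i j k = (if (i,j,k) \<in> {(1,2,3),(2,3,1),(3,1,2)} then 1
     else if (i,j,k) \<in> {(2,1,3),(3,2,1),(1,3,2)} then -1 else 0)"

lemma kron_simps[simp]: "kron 1 1 = 1" "kron 1 2 = 0" "kron 1 3 = 0" "kron 2 1 = 0" "kron 2 2 = 1"
  "kron 2 3 = 0" "kron 3 1 = 0" "kron 3 2 = 0" "kron 3 3 = 1"
  by (auto simp: kron_def)

lemma axis_kron: "(axis i 1 :: real^3) $ j = kron i j"
  by (simp add: kron_def axis_def)

lemma conf_pos: "conf y > 0"
  unfolding conf_def by (simp add: add_pos_nonneg)

lemma conf_eq: "conf y * (1 + (y$1)^2 + (y$2)^2 + (y$3)^2) = 1"
proof -
  have "1 + (y$1)^2 + (y$2)^2 + (y$3)^2 > 0" by (simp add: add_pos_nonneg)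
  then show ?thesis unfolding conf_def by simp
qed

text \<open>The Hopf field has round length one and the chart is conformal, so splitting the scale 2
  conf off its dual coefficients leaves a Euclidean unit vector. \<open>s^2 = 1\<close> stands for
  the two charts.\<close>

lemma hopf_dir_unit:
  assumes "s^2 = 1"
  shows "(hopf_dir s 1 y)^2 + (hopf_dir s 2 y)^2 + (hopf_dir s 3 y)^2 = 1"
  using conf_eq[of y] assms unfolding hopf_dir_def by simp algebra

lemma has_derivative_conf:
  "(conf has_derivative (\<lambda>h. \<Sum>i\<in>UNIV. h$i * (-2 * y$i * (conf y)^2))) (at y)"
proof -
  have "1 + (y$1)^2 + (y$2)^2 + (y$3)^2 \<noteq> 0" by (smt (verit) zero_le_power2)
  then show ?thesis
  unfolding conf_def[abs_def]
  by (auto intro!: derivative_eq_intros has_derivative_vec_nth simp: sum_3 fun_eq_iff power2_eq_square divide_inverse algebra_simps)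
qed

text \<open>The \<open>lc\<close> term is the covariant derivative of the dual form, antisymmetric
  because the Hopf field is Killing; the other two terms come from the conformal factor. The result
  is polynomial in \<open>conf\<close>, \<open>hopf_dir\<close> and y, so all further derivatives
  stay polynomial.\<close>

lemma has_derivative_hopf_dir:
  assumes "s^2 = 1"
  shows "(hopf_dir s j has_derivative (\<lambda>h. \<Sum>i\<in>UNIV. h$i * (2 * conf y *
    (s * (\<Sum>k\<in>UNIV. lc i j k * hopf_dir s k y) - hopf_dir s i y * y$j
      + kron i j * (\<Sum>k\<in>UNIV. hopf_dir s k y * y$k))))) (at y)"
proof -
  note c = conf_eq[of y]
  have "j = 1 \<or> j = 2 \<or> j = 3" using exhaust_3 by blast
  then show ?thesis
  proof (elim disjE)
    assume j: "j = 1"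
    show ?thesis unfolding j hopf_dir_def[abs_def]
      apply (auto intro!: derivative_eq_intros has_derivative_vec_nth has_derivative_conf simp: sum_3 fun_eq_iff lc_def)
      using c assms by algebra
  next
    assume j: "j = 2"
    show ?thesis unfolding j hopf_dir_def[abs_def]
      apply (auto intro!: derivative_eq_intros has_derivative_vec_nth has_derivative_conf simp: sum_3 fun_eq_iff lc_def)
      using c assms by algebra
  next
    assume j: "j = 3"
    show ?thesis unfolding j hopf_dir_def[abs_def]
      apply (auto intro!: derivative_eq_intros has_derivative_vec_nth has_derivative_conf simp: sum_3 fun_eq_iff lc_def)
      using c assms by algebra
  qed
qed


section \<open>The Berger metric in the stereographic charts\<close>

lemma stereo_inv_nth:
  "stereo_inv s y $ 1 = 2 * y$1 * conf y" "stereo_inv s y $ 2 = 2 * y$2 * conf y"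
  "stereo_inv s y $ 3 = 2 * y$3 * conf y"
  "stereo_inv s y $ 4 = s * ((y$1)^2 + (y$2)^2 + (y$3)^2 - 1) * conf y"
  by (simp_all add: stereo_inv_def vector_4 conf_def norm_sq_3 add_ac)

text \<open>\<open>d\<close> is the derivative of \<open>conf\<close> in direction h. The last entry
  comes from writing the fourth coordinate as s (1 - 2 conf y).\<close>

definition stereo_deriv :: "real \<Rightarrow> real^3 \<Rightarrow> real^3 \<Rightarrow> real^4" where
  "stereo_deriv s y h = (let d = -2 * (y \<bullet> h) * (conf y)^2 in
     vector [2 * h$1 * conf y + 2 * y$1 * d, 2 * h$2 * conf y + 2 * y$2 * d,
             2 * h$3 * conf y + 2 * y$3 * d, -2 * s * d])"

lemma has_derivative_stereo_inv: "(stereo_inv s has_derivative stereo_deriv s y) (at y)"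
proof (rule has_derivative_vecI)
  fix i :: 4
  note c = conf_eq[of y]
  have "i = 1 \<or> i = 2 \<or> i = 3 \<or> i = 4" using exhaust_4 by blast
  then show "((\<lambda>y. stereo_inv s y $ i) has_derivative (\<lambda>h. stereo_deriv s y h $ i)) (at y)"
    apply (elim disjE)
       apply (auto simp: stereo_inv_nth stereo_deriv_def vector_4 Let_def inner_3 sum_3
         intro!: derivative_eq_intros has_derivative_vec_nth has_derivative_conf)
    apply (simp_all add: fun_eq_iff)
       apply (simp_all add: algebra_simps)[3]
    apply (erule thin_rl)
    apply (intro allI)
    apply (insert c)
    by algebra
qed

lemma stereo_deriv_inner:
  assumes "s^2 = 1"
  shows "stereo_deriv s y (axis i 1) \<bullet> stereo_deriv s y (axis j 1) = 4 * (conf y)^2 * kron i j"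
proof -
  note c = conf_eq[of y]
  have *: "\<forall>i j::3. stereo_deriv s y (axis i 1) \<bullet> stereo_deriv s y (axis j 1) = 4 * (conf y)^2 * kron i j"
    unfolding forall_3 inner_4 stereo_deriv_def Let_def vector_4 inner_3 axis_kron
    apply (simp)
    using c assms by (intro conjI; algebra)
  show ?thesis using * by blast
qed

lemma stereo_deriv_hopf:
  assumes "s^2 = 1"
  shows "stereo_deriv s y (axis i 1) \<bullet> hopf_field (stereo_inv s y) = 2 * conf y * hopf_dir s i y"
proof -
  note c = conf_eq[of y]
  have *: "\<forall>i::3. stereo_deriv s y (axis i 1) \<bullet> hopf_field (stereo_inv s y) = 2 * conf y * hopf_dir s i y"
    unfolding forall_3 inner_4 stereo_deriv_def Let_def hopf_field_def vector_4 inner_3 axis_kron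
      stereo_inv_nth hopf_dir_def
    apply (simp)
    using c assms by (intro conjI; algebra)
  show ?thesis using * by blast
qed

lemma metric_coeff_berger:
  assumes "s^2 = 1"
  shows "metric_coeff (berger \<rho>) (stereo_inv s) y $ i $ j
    = 4 * (conf y)^2 * (kron i j + (\<rho>^2 - 1) * hopf_dir s i y * hopf_dir s j y)"
proof -
  have "frechet_derivative (stereo_inv s) (at y) = stereo_deriv s y"
    using frechet_derivative_at[OF has_derivative_stereo_inv] by simp
  then show ?thesis
    unfolding metric_coeff_def berger_def using stereo_deriv_inner[OF assms] stereo_deriv_hopf[OF assms]
    by (simp add: power2_eq_square algebra_simps)
qed

text \<open>The first three terms are the Christoffel symbols of the round metric, the rest is the tensor
  $c (\eta \otimes \nabla\xi + \nabla\xi \otimes \eta)$, with $\xi$ the Hopf field of the round sphere and $\eta$ its dual form; here $c = \rho^2-1$.\<close>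
definition chris :: "real \<Rightarrow> real \<Rightarrow> 3 \<Rightarrow> 3 \<Rightarrow> 3 \<Rightarrow> real^3 \<Rightarrow> real" where
  "chris c s k i j y = 2 * conf y * (kron i j * y$k - kron k i * y$j - kron k j * y$i
     + c * s * (hopf_dir s j y * (\<Sum>l\<in>UNIV. lc i k l * hopf_dir s l y)
               + hopf_dir s i y * (\<Sum>l\<in>UNIV. lc j k l * hopf_dir s l y)))"

section \<open>Christoffel symbols and Ricci tensor\<close>

lemma partial_metric_coeff:
  assumes "s^2 = 1"
  shows "partial (\<lambda>z. metric_coeff (berger \<rho>) (stereo_inv s) z $ i $ j) m y
   = (let e = (\<lambda>i. hopf_dir s i y); c = \<rho>^2 - 1;
          de = (\<lambda>j. 2 * conf y * (s * (\<Sum>k\<in>UNIV. lc m j k * e k) - e m * y$j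
             + kron m j * (\<Sum>k\<in>UNIV. e k * y$k)))
      in -16 * y$m * (conf y)^3 * (kron i j + c * e i * e j)
        + 4 * (conf y)^2 * c * (de i * e j + e i * de j))"
proof -
  have m: "m = 1 \<or> m = 2 \<or> m = 3" using exhaust_3 by blast
  show ?thesis
  unfolding metric_coeff_berger[OF assms]
  apply (rule trans)
   apply (rule partial_eq)
   apply (rule derivative_eq_intros has_derivative_conf has_derivative_hopf_dir[OF assms] refl)+
  using m by (elim disjE) (simp_all add: axis_kron sum_3 Let_def algebra_simps power2_eq_square power3_eq_cube)
qed

text \<open>With the index lowered, the inverse metric disappears, and the formula for the
  Levi-Civita connection becomes a polynomial identity for the candidate \<open>chris\<close>,
  checked index by index modulo \<open>hopf_dir_unit\<close>.\<close>

lemma christoffel_lower: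
  fixes \<rho> :: real
  assumes "s^2 = 1"
  defines "p \<equiv> (\<lambda>i j. partial (\<lambda>z. metric_coeff (berger \<rho>) (stereo_inv s) z $ i $ j))"
  shows "1/2 * (p j l i y + p i l j y - p i j l y)
   = (\<Sum>m\<in>UNIV. metric_coeff (berger \<rho>) (stereo_inv s) y $ l $ m * chris (\<rho>^2 - 1) s m i j y)"
proof -
  note u = hopf_dir_unit[OF assms(1), of y]
  have *: "\<forall>l i j. 1/2 * (p j l i y + p i l j y - p i j l y)
   = (\<Sum>m\<in>UNIV. metric_coeff (berger \<rho>) (stereo_inv s) y $ l $ m * chris (\<rho>^2 - 1) s m i j y)"
    unfolding p_def partial_metric_coeff[OF assms(1)]
    unfolding metric_coeff_berger[OF assms(1)] chris_def Let_def
    apply (simp only: forall_3 sum_3)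
    apply (simp add: lc_def)
    apply (intro conjI)
    apply (insert u)
    by (algebra | simp add: algebra_simps power2_eq_square power3_eq_cube)+
  show ?thesis using * by blast
qed


lemma matrix_inv_mult_vector:
  fixes A B :: "real^'n^'n"
  assumes "B ** A = mat 1"
  shows "matrix_inv A *v (A *v x) = x"
proof -
  have "A ** B = mat 1" using assms matrix_left_right_inverse by blast
  then have "invertible A" using assms unfolding invertible_def by blast
  then have "matrix_inv A ** A = mat 1"
    unfolding invertible_def matrix_inv_def by (rule someI2_ex) simp
  then show ?thesis by (simp add: matrix_vector_mul_assoc)
qed

lemma christoffel_berger:
  assumes s: "s^2 = 1" and "\<rho> > 0"
  shows "christoffel (berger \<rho>) (stereo_inv s) = chris (\<rho>^2 - 1) s"
proof (intro ext)
  fix k i j y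
  let ?G = "metric_coeff (berger \<rho>) (stereo_inv s) y"
  \<comment> \<open>The metric is a scalar times the identity plus c e e^T, with |e| = 1 and c =
    \<rho>^2 - 1. Sherman-Morrison gives the inverse, with coefficient c / (1 + c) = c /
    \<rho>^2.\<close>
  define B :: "real^3^3" where "B = (\<chi> k l. 1 / (4 * (conf y)^2) *
     (kron k l - (\<rho>^2 - 1) / \<rho>^2 * hopf_dir s k y * hopf_dir s l y))"
  note u = hopf_dir_unit[OF s, of y]
  have cp: "conf y \<noteq> 0" using conf_pos[of y] by simp
  have "B ** ?G = mat 1"
  proof -
    have "(\<Sum>l\<in>UNIV. (kron k l - (\<rho>^2 - 1) / \<rho>^2 * hopf_dir s k y * hopf_dir s l y) *
        (kron l m + (\<rho>^2 - 1) * hopf_dir s l y * hopf_dir s m y)) = kron k m" for k m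
    proof -
      define c where "c = \<rho>^2 - 1"
      define d where "d = (\<rho>^2 - 1) / \<rho>^2"
      have dc: "c - d - d * c = 0" unfolding c_def d_def using assms(2) by (simp add: field_simps)
      have "\<forall>k m. (\<Sum>l\<in>UNIV. (kron k l - d * hopf_dir s k y * hopf_dir s l y) *
        (kron l m + c * hopf_dir s l y * hopf_dir s m y)) = kron k m"
        apply (simp only: forall_3 sum_3 kron_simps)
        apply (insert u dc)
        by (intro conjI; algebra)
      then show ?thesis unfolding c_def d_def by blast
    qed
    then have "(\<Sum>l\<in>UNIV. 1 / (4 * (conf y)^2) * (kron k l - (\<rho>^2 - 1) / \<rho>^2 * hopf_dir s k y * hopf_dir s l y) *
        (4 * (conf y)^2 * (kron l m + (\<rho>^2 - 1) * hopf_dir s l y * hopf_dir s m y))) = kron k m" for k m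
    proof -
      have a: "1 / (4 * (conf y)^2) * X * (4 * (conf y)^2 * Y) = X * Y" for X Y using cp by simp
      show ?thesis unfolding a by fact
    qed
    then show ?thesis
      unfolding B_def matrix_matrix_mult_def mat_def vec_eq_iff
      by (simp add: metric_coeff_berger[OF s] kron_def)
  qed
  note inv = matrix_inv_mult_vector[OF this, of "\<chi> m. chris (\<rho>^2 - 1) s m i j y"]
  have "christoffel (berger \<rho>) (stereo_inv s) k i j y
    = (matrix_inv ?G *v (?G *v (\<chi> m. chris (\<rho>^2 - 1) s m i j y))) $ k"
    unfolding christoffel_def matrix_vector_mult_def
    by (simp only: vec_lambda_beta christoffel_lower[OF s, where \<rho>=\<rho>, symmetric] sum_distrib_left)
      (simp add: mult_ac)
  then show "christoffel (berger \<rho>) (stereo_inv s) k i j y = chris (\<rho>^2 - 1) s k i j y"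
    unfolding inv by simp
qed

lemma partial_chris:
  assumes "s^2 = 1"
  shows "partial (chris c s k i j) m y
   = (let e = (\<lambda>i. hopf_dir s i y);
          de = (\<lambda>j. 2 * conf y * (s * (\<Sum>k\<in>UNIV. lc m j k * e k) - e m * y$j
             + kron m j * (\<Sum>k\<in>UNIV. e k * y$k)))
      in - 2 * y$m * conf y * chris c s k i j y
        + 2 * conf y * (kron i j * kron m k - kron k i * kron m j - kron k j * kron m i
          + c * s * (de j * (\<Sum>l\<in>UNIV. lc i k l * e l) + e j * (\<Sum>l\<in>UNIV. lc i k l * de l)
               + de i * (\<Sum>l\<in>UNIV. lc j k l * e l) + e i * (\<Sum>l\<in>UNIV. lc j k l * de l))))"
proof -
  have m: "m = 1 \<or> m = 2 \<or> m = 3" using exhaust_3 by blast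
  show ?thesis
  unfolding chris_def
  apply (rule trans)
   apply (rule partial_eq)
   apply (rule derivative_eq_intros has_derivative_conf has_derivative_hopf_dir[OF assms]
     has_derivative_vec_nth has_derivative_ident refl)+
  using m by (elim disjE) (simp_all add: axis_kron sum_3 Let_def algebra_simps power2_eq_square)
qed


text \<open>With respect to g_\<rho> the Ricci eigenvalues are 4 - 2 \<rho>^2 on the horizontal
  plane and 2 \<rho>^2 in the Hopf direction. The Hopf field has norm \<rho>, so its own value is 2
  \<rho>^4, and the rank-one term carries the difference 2 \<rho>^4 - (4 - 2 \<rho>^2).\<close>

lemma ricci_berger:
  assumes s: "s^2 = 1" and "\<rho> > 0"
  shows "ricci (berger \<rho>) (stereo_inv s) i j y
   = 4 * (conf y)^2 * ((4 - 2 * \<rho>^2) * kron i j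
       + (2 * \<rho>^4 - 4 + 2 * \<rho>^2) * hopf_dir s i y * hopf_dir s j y)"
proof -
  define c where "c = \<rho>^2 - 1"
  \<comment> \<open>With these values named, the claims are polynomial identities modulo unit
    length, the equation of \<open>conf\<close> and s^2 = 1.\<close>
  define E where "E = conf y"
  define e1 where "e1 = hopf_dir s 1 y"
  define e2 where "e2 = hopf_dir s 2 y"
  define e3 where "e3 = hopf_dir s 3 y"
  define y1 where "y1 = y$1"
  define y2 where "y2 = y$2"
  define y3 where "y3 = y$3"
  have u: "e1^2 + e2^2 + e3^2 = 1"
    unfolding e1_def e2_def e3_def by (rule hopf_dir_unit[OF s])
  have E: "E * (1 + y1^2 + y2^2 + y3^2) = 1"
    unfolding E_def y1_def y2_def y3_def by (rule conf_eq)
  note fold = e1_def[symmetric] e2_def[symmetric] e3_def[symmetric] y1_def[symmetric] y2_def[symmetric]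
     y3_def[symmetric] E_def[symmetric]
  have "\<forall>i j. (\<Sum>k\<in>UNIV. partial (chris c s k i j) k y - partial (chris c s k i k) j y)
     + (\<Sum>k\<in>UNIV. \<Sum>l\<in>UNIV. chris c s k k l y * chris c s l i j y
                           - chris c s k j l y * chris c s l i k y)
    = 4 * (conf y)^2 * ((2 - 2 * c) * kron i j
       + (2 * c^2 + 6 * c) * hopf_dir s i y * hopf_dir s j y)"
    unfolding partial_chris[OF s]
    unfolding chris_def Let_def
    apply (simp only: forall_3 sum_3 kron_simps fold)
    apply (simp add: lc_def)
    apply (intro conjI)
    apply (insert u E s)
    apply algebra+
    done
  then show ?thesis
    unfolding ricci_def christoffel_berger[OF assms] c_def
    by (simp add: algebra_simps power2_eq_square power4_eq_xxxx)
qed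


text \<open>With t the Hopf component of v, the form is a positive multiple of (4 - 2 \<rho>^2)
  (|v|^2 - t^2) + 2 \<rho>^4 t^2; the bound on \<rho> makes the horizontal eigenvalue
  positive.\<close>

lemma positive_ricci_berger:
  assumes "0 < \<rho>" "\<rho>^2 < 2"
  shows "positive_ricci (berger \<rho>)"
  unfolding positive_ricci_def
proof (intro ballI allI impI)
  fix s :: real and y v :: "real^3"
  assume "s \<in> {1,-1}" and v: "v \<noteq> 0"
  then have s: "s^2 = 1" by auto
  define e where "e = (\<lambda>i. hopf_dir s i y)"
  define t where "t = (\<Sum>i\<in>UNIV. e i * v$i)"
  have u: "(e 1)^2 + (e 2)^2 + (e 3)^2 = 1" unfolding e_def by (rule hopf_dir_unit[OF s])
  have "(\<Sum>i\<in>UNIV. \<Sum>j\<in>UNIV. ricci (berger \<rho>) (stereo_inv s) i j y * v$i * v$j)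
     = 4 * (conf y)^2 * ((4 - 2 * \<rho>^2) * ((v \<bullet> v) - t^2) + 2 * \<rho>^4 * t^2)"
    unfolding ricci_berger[OF s assms(1)] t_def sum_3 e_def inner_3 by (simp add: algebra_simps power2_eq_square)
  moreover have cs: "t^2 \<le> v \<bullet> v"
  proof -
    \<comment> \<open>Lagrange's identity for the unit vector e.\<close>
    have "v \<bullet> v - t^2 = (e 1 * v$2 - e 2 * v$1)^2 + (e 2 * v$3 - e 3 * v$2)^2 + (e 3 * v$1 - e 1 * v$3)^2"
      using u unfolding t_def sum_3 inner_3 by algebra
    then show ?thesis by (smt (verit) zero_le_power2)
  qed
  moreover have "(4 - 2 * \<rho>^2) * ((v \<bullet> v) - t^2) + 2 * \<rho>^4 * t^2 > 0"
  proof (cases "t = 0")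
    case True
    then show ?thesis using v assms by simp
  next
    case False
    then have "2 * \<rho>^4 * t^2 > 0" using assms by simp
    moreover have "(4 - 2 * \<rho>^2) * ((v \<bullet> v) - t^2) \<ge> 0" using assms cs by simp
    ultimately show ?thesis by linarith
  qed
  ultimately show "0 < (\<Sum>i\<in>UNIV. \<Sum>j\<in>UNIV. ricci (berger \<rho>) (stereo_inv s) i j y * v$i * v$j)"
    using conf_pos[of y] by simp
qed

section \<open>Linking of great circles\<close>

definition great_circle :: "real^4 \<Rightarrow> real^4 \<Rightarrow> (real^4) set" where
  "great_circle a b = range (\<lambda>s. cos s *\<^sub>R a + sin s *\<^sub>R b)"

definition orthonormal_pair :: "real^4 \<Rightarrow> real^4 \<Rightarrow> bool" where
  "orthonormal_pair a b \<longleftrightarrow> norm a = 1 \<and> norm b = 1 \<and> a \<bullet> b = 0"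

lemma mem_great_circle:
  assumes "p^2 + q^2 = 1"
  shows "p *\<^sub>R a + q *\<^sub>R b \<in> great_circle a b"
proof -
  obtain s where "p = cos s" "q = sin s" using sincos_total_2pi[OF assms] by metis
  then show ?thesis unfolding great_circle_def by auto
qed

lemma norm_orthonormal:
  assumes "orthonormal_pair a b"
  shows "norm (p *\<^sub>R a + q *\<^sub>R b) ^ 2 = p^2 + q^2"
proof -
  have "a \<bullet> a = 1" "b \<bullet> b = 1" "a \<bullet> b = 0" "b \<bullet> a = 0"
    using assms by (auto simp: orthonormal_pair_def norm_eq_1 inner_commute)
  then show ?thesis
    unfolding power2_norm_eq_inner
    by (simp add: inner_left_distrib inner_right_distrib power2_eq_square)
qed

lemma great_circle_subset_S3:
  assumes "orthonormal_pair a b"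
  shows "great_circle a b \<subseteq> S3"
  unfolding great_circle_def S3_def
proof clarsimp
  fix s
  have "norm (cos s *\<^sub>R a + sin s *\<^sub>R b) ^ 2 = 1" using norm_orthonormal[OF assms] by simp
  then show "norm (cos s *\<^sub>R a + sin s *\<^sub>R b) = 1"
    by (metis norm_ge_zero power2_eq_1_iff neg_0_le_iff_le not_one_le_zero)
qed

text \<open>Each point slides along the chord towards the south pole \<open>- e\<close> and is
  projected back to the sphere. The chord misses the origin because x is not the north pole, and the
  height does not increase on the way.\<close>

lemma contractible_cap:
  assumes "t \<le> 1"
  shows "contractible {x\<in>S3. x$4 < t}"
proof -
  define e :: "real^4" where "e = axis 4 1"
  let ?U = "{x\<in>S3. x$4 < t}"
  define h where "h = (\<lambda>(s,x). ((1 - s) *\<^sub>R x - s *\<^sub>R e))"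
  have e: "e \<bullet> e = 1" "\<And>x. x \<bullet> e = x$4" "\<And>x. e \<bullet> x = x$4" "e$4 = 1"
    unfolding e_def by (simp_all add: inner_axis inner_axis' )
  have key: "h (s,x) \<noteq> 0 \<and> h (s,x) /\<^sub>R norm (h (s,x)) \<in> ?U"
    if s: "s \<in> {0..1}" and x: "x \<in> ?U" for s x
  proof -
    let ?y = "h (s,x)"
    have xx: "x \<bullet> x = 1" "norm x = 1" using x by (auto simp: S3_def norm_eq_1)
    have x4: "x$4 < 1" using x assms by auto
    have y4: "?y $ 4 = (1-s) * x$4 - s" unfolding h_def by (simp add: e)
    have yx: "?y \<bullet> x = (1-s) - s * x$4" unfolding h_def by (simp add: inner_diff_left xx e)
    have nz: "?y \<noteq> 0"
    proof
      assume 0: "?y = 0"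
      have "(1-s) * x$4 - s = 0" "(1-s) - s * x$4 = 0" using 0 y4 yx by simp_all
      then have "(1 - x$4) * 1 = 0" by algebra
      then show False using x4 by simp
    qed
    \<comment> \<open>This says that the projected point is not higher than x. For x$4 >= 0 the norm
      of the chord point is bounded below by its inner product with x, for x$4 < 0 it is bounded
      above by 1.\<close>
    have le: "?y$4 \<le> x$4 * norm ?y"
    proof (cases "x$4 \<ge> 0")
      case True
      have "?y \<bullet> x \<le> norm ?y" using norm_cauchy_schwarz[of ?y x] xx by simp
      then have "x$4 * ((1-s) - s * x$4) \<le> x$4 * norm ?y" unfolding yx using True by (rule mult_left_mono)
      moreover have "x$4 * x$4 \<le> 1" using True x4 by (simp add: mult_le_one)
      then have "s * (x$4 * x$4) \<le> s" using s by (simp add: mult_left_le)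
      then have "(1-s) * x$4 - s \<le> x$4 * ((1-s) - s * x$4)" by (simp add: algebra_simps)
      ultimately show ?thesis unfolding y4 by linarith
    next
      case False
      have "norm ?y \<le> norm ((1-s) *\<^sub>R x) + norm (s *\<^sub>R e)" unfolding h_def prod.case by (rule norm_triangle_ineq4)
      also have "\<dots> = 1" using s xx e by (simp add: norm_eq_1[of e, symmetric] norm_eq_sqrt_inner[of e])
      finally have "x$4 * norm ?y \<ge> x$4" using False by (simp add: mult_le_cancel_left)
      moreover have "s * (x$4 + 1) \<ge> 0"
        using s component_le_norm_cart[of x 4] xx by auto
      ultimately show ?thesis unfolding y4 by (simp add: algebra_simps)
    qed
    have "(?y /\<^sub>R norm ?y) $ 4 \<le> x$4" using le nz by (simp add: divide_inverse_commute[symmetric] pos_divide_le_eq)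
    then show ?thesis using nz x by (auto simp: S3_def)
  qed
  let ?H = "\<lambda>z. h z /\<^sub>R norm (h z)"
  have ch: "continuous_on ({0..1} \<times> ?U) h" unfolding h_def case_prod_beta by (intro continuous_intros)
  have "continuous_on ({0..1} \<times> ?U) ?H"
    by (intro continuous_intros ch) (use key in auto)
  moreover have "?H \<in> {0..1} \<times> ?U \<rightarrow> ?U"
  proof
    fix z :: "real \<times> (real^4)" assume z: "z \<in> {0..1} \<times> ?U"
    then show "?H z \<in> ?U" using key[of "fst z" "snd z"] unfolding mem_Times_iff prod.collapse by blast
  qed
  ultimately have cH: "continuous_map (prod_topology (top_of_set {0..1}) (top_of_set ?U)) (top_of_set ?U) ?H"
    by (simp add: subtopology_Times[symmetric] continuous_map_in_subtopology euclidean_product_topology[symmetric] image_subset_iff)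
  have "homotopic_with_canon (\<lambda>x. True) ?U ?U (\<lambda>x. ?H (0,x)) (\<lambda>x. ?H (1,x))"
    unfolding homotopic_with_def using cH by (intro exI[of _ ?H]) auto
  then have "homotopic_with_canon (\<lambda>x. True) ?U ?U id (\<lambda>x. - e)"
    by (rule homotopic_with_eq) (auto simp: h_def S3_def e(1) norm_eq_sqrt_inner[of e])
  then show ?thesis unfolding contractible_def by blast
qed


text \<open>Disjoint great circles span complementary planes. The projection \<open>L\<close> onto
  the first plane along the second vanishes on the sphere only on the second circle, so on
  \<open>U\<close> it can be normalised to a map into the unit circle, and this map is the identity
  on the first circle. Contractibility of \<open>U\<close> would then make the circle
  contractible.\<close>

lemma great_circles_linked:
  assumes ab: "orthonormal_pair a b" and cd: "orthonormal_pair c d"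
    and disj: "great_circle a b \<inter> great_circle c d = {}"
    and U: "U \<subseteq> S3" "contractible U" "great_circle a b \<subseteq> U" "U \<inter> great_circle c d = {}"
  shows False
proof -
  define T :: "real^4 \<Rightarrow> real^4" where
    "T x = x$1 *\<^sub>R a + x$2 *\<^sub>R b + x$3 *\<^sub>R c + x$4 *\<^sub>R d" for x
  have lT: "linear T" unfolding T_def by (rule linearI) (simp_all add: algebra_simps)
  \<comment> \<open>A nonzero kernel vector, scaled so that its part in the plane of a and b has
    length one, would give a common point of the two circles.\<close>
  have "inj T"
  proof (rule linear_injective_0[OF lT, THEN iffD2], intro allI impI)
    fix x assume "T x = 0"
    then have eq: "x$1 *\<^sub>R a + x$2 *\<^sub>R b = (- x$3) *\<^sub>R c + (- x$4) *\<^sub>R d"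
    proof -
      have "(x$1 *\<^sub>R a + x$2 *\<^sub>R b) + (x$3 *\<^sub>R c + x$4 *\<^sub>R d) = 0"
        using \<open>T x = 0\<close> unfolding T_def by (simp add: add.assoc)
      then have "x$1 *\<^sub>R a + x$2 *\<^sub>R b = - (x$3 *\<^sub>R c + x$4 *\<^sub>R d)" by (simp only: eq_neg_iff_add_eq_0)
      then show ?thesis by simp
    qed
    define r where "r = norm (x$1 *\<^sub>R a + x$2 *\<^sub>R b)"
    have r1: "r^2 = (x$1)^2 + (x$2)^2" unfolding r_def by (rule norm_orthonormal[OF ab])
    have r2: "r^2 = (x$3)^2 + (x$4)^2" unfolding r_def eq using norm_orthonormal[OF cd, of "-x$3" "-x$4"] by simp
    have "r = 0"
    proof (rule ccontr)
      assume "r \<noteq> 0"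
      then have "(x$1/r)^2 + (x$2/r)^2 = 1" "(-x$3/r)^2 + (-x$4/r)^2 = 1"
        using r1 r2 by (auto simp: power_divide add_divide_distrib[symmetric])
      then have "(x$1/r) *\<^sub>R a + (x$2/r) *\<^sub>R b \<in> great_circle a b"
        "(-x$3/r) *\<^sub>R c + (-x$4/r) *\<^sub>R d \<in> great_circle c d" by (simp_all only: mem_great_circle)
      moreover have "(x$1/r) *\<^sub>R a + (x$2/r) *\<^sub>R b = (-x$3/r) *\<^sub>R c + (-x$4/r) *\<^sub>R d"
        using arg_cong[OF eq, of "\<lambda>v. (1/r) *\<^sub>R v"] by (simp add: scaleR_add_right scaleR_diff_right)
      ultimately show False using disj by auto
    qed
    then have "x$1 = 0" "x$2 = 0" "x$3 = 0" "x$4 = 0" using r1 r2 by (simp_all add: sum_power2_eq_zero_iff)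
    then show "x = 0" by (simp add: vec_eq_iff forall_4)
  qed
  then obtain T' where lT': "linear T'" and T'T: "T' \<circ> T = id" and "T \<circ> T' = id"
    using linear_injective_isomorphism[OF lT] by (metis (no_types, lifting) comp_def id_apply ext)
  then have TT': "T (T' x) = x" for x by (metis comp_apply id_apply)
  have T'T: "T' (T x) = x" for x using T'T by (metis comp_apply id_apply)
  define L where "L x = Complex (T' x $ 1) (T' x $ 2)" for x
  have cL: "continuous_on A L" for A
    unfolding L_def Complex_eq
    by (intro continuous_intros linear_continuous_on linear_linear[THEN iffD2] lT')
  have Lnz: "L x \<noteq> 0" if "x \<in> U" for x
  proof
    assume "L x = 0"
    then have "T' x $ 1 = 0" "T' x $ 2 = 0" unfolding L_def by (simp_all add: complex_eq_iff)
    then have x: "x = T' x $ 3 *\<^sub>R c + T' x $ 4 *\<^sub>R d" using TT'[of x] unfolding T_def by simp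
    have "norm x ^ 2 = 1" using that U(1) by (auto simp: S3_def)
    then have "(T' x $ 3)^2 + (T' x $ 4)^2 = 1" using norm_orthonormal[OF cd] x by metis
    then have "x \<in> great_circle c d" using mem_great_circle x by metis
    then show False using that U(4) by blast
  qed
  define f where "f z = Re z *\<^sub>R a + Im z *\<^sub>R b" for z
  have fU: "f z \<in> U" if "z \<in> sphere 0 1" for z
  proof -
    have "Re z ^ 2 + Im z ^ 2 = 1" using that cmod_power2[of z] by simp
    then show ?thesis unfolding f_def using mem_great_circle U(3) by blast
  qed
  have Lf: "L (f z) = z" for z
  proof -
    have "f z = T (vector [Re z, Im z, 0, 0])" unfolding f_def T_def by (simp add: vector_4)
    then show ?thesis unfolding L_def by (simp add: T'T vector_4)
  qed
  have cf: "continuous_on (sphere 0 1) f" unfolding f_def by (intro continuous_intros)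
  have fim: "f \<in> sphere 0 1 \<rightarrow> U" using fU by blast
  obtain u where "homotopic_with_canon (\<lambda>x. True) (sphere 0 1) U f (\<lambda>x. u)"
    using nullhomotopic_into_contractible[OF cf fim U(2)] by blast
  moreover have "continuous_on U (\<lambda>x. L x / norm (L x))"
    using Lnz by (intro continuous_intros cL) auto
  moreover have "(\<lambda>x. L x / norm (L x)) \<in> U \<rightarrow> sphere 0 1" using Lnz by (auto simp: norm_divide)
  ultimately have "homotopic_with_canon (\<lambda>x. True) (sphere 0 1) (sphere 0 1)
      ((\<lambda>x. L x / norm (L x)) \<circ> f) ((\<lambda>x. L x / norm (L x)) \<circ> (\<lambda>x. u))"
    by (rule homotopic_with_compose_continuous_left)
  then have "homotopic_with_canon (\<lambda>x. True) (sphere 0 1) (sphere 0 1) id (\<lambda>z::complex. L u / norm (L u))"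
    by (rule homotopic_with_eq) (auto simp: Lf)
  then have "contractible (sphere (0::complex) 1)" unfolding contractible_def by blast
  then show False using contractible_sphere[of "0::complex" 1] by simp
qed

section \<open>A slice that meets every great circle\<close>

text \<open>\<open>?A\<close> collects the t for which some great circle lies in the image of x$4 <
  t, \<open>?B\<close> those for which one lies in the image of x$4 > t. Both are relatively open,
  by linking they are disjoint, and they contain 1 and -1 respectively, so they cannot exhaust the
  interval.\<close>

lemma slice_meets_great_circles:
  fixes F :: "real \<Rightarrow> real^4 \<Rightarrow> real^4"
  assumes cont: "continuous_on ({-1..1} \<times> S3) (\<lambda>(t,x). F t x)"
    and bij: "\<And>t. t \<in> {-1..1} \<Longrightarrow> bij_betw (F t) S3 S3"
  obtains t where "-1 < t" "t < 1"
    "\<And>a b. orthonormal_pair a b \<Longrightarrow> \<exists>x\<in>S3. x$4 = t \<and> F t x \<in> great_circle a b"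
proof -
  have compS3: "compact S3" unfolding S3_def by simp
  have contF: "continuous_on S3 (F t)" if "t \<in> {-1..1}" for t
  proof -
    have "continuous_on S3 ((\<lambda>(t,x). F t x) \<circ> (\<lambda>x. (t,x)))"
      using that by (intro continuous_on_compose continuous_intros continuous_on_subset[OF cont]) auto
    then show ?thesis by (simp add: o_def)
  qed
  have compgc: "closed (great_circle a b)" for a b
  proof -
    have "great_circle a b = (\<lambda>s. cos s *\<^sub>R a + sin s *\<^sub>R b) ` {0..2*pi}"
      unfolding great_circle_def
    proof (intro equalityI subsetI)
      fix x assume "x \<in> range (\<lambda>s. cos s *\<^sub>R a + sin s *\<^sub>R b)"
      then obtain s where x: "x = cos s *\<^sub>R a + sin s *\<^sub>R b" by blast
      obtain s' where "0 \<le> s'" "s' \<le> 2*pi" "cos s = cos s'" "sin s = sin s'"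
        using sincos_total_2pi_le[of "cos s" "sin s"] by auto
      then show "x \<in> (\<lambda>s. cos s *\<^sub>R a + sin s *\<^sub>R b) ` {0..2*pi}" unfolding x by auto
    qed auto
    moreover have "compact ((\<lambda>s. cos s *\<^sub>R a + sin s *\<^sub>R b) ` {0..2*pi})"
      by (intro compact_continuous_image continuous_intros) auto
    ultimately show ?thesis by (simp add: compact_imp_closed)
  qed
  define misses where "misses P = {t\<in>{-1..1}. \<exists>a b. orthonormal_pair a b \<and>
      (\<forall>x\<in>S3. P t x \<longrightarrow> F t x \<notin> great_circle a b)}" for P :: "real \<Rightarrow> real^4 \<Rightarrow> bool"
  \<comment> \<open>The parameters at which a fixed circle is hit form the projection of a compact
    set, so those at which it is missed form an open set; \<open>misses\<close> is the union of
    these over all circles.\<close>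
  have open_misses: "openin (top_of_set {-1..1}) (misses P)" if "closed {(t,x). P t x}" for P
  proof -
    have "openin (top_of_set {-1..1}) ({-1..1} - fst ` {(t,x). (t,x) \<in> {-1..1} \<times> S3 \<and> P t x \<and> F t x \<in> great_circle a b})" (is "openin _ (_ - fst ` ?K)") for a b
    proof -
      have "closedin (top_of_set ({-1..1} \<times> S3)) (({-1..1} \<times> S3) \<inter> (\<lambda>(t,x). F t x) -` great_circle a b)"
        by (rule continuous_closedin_preimage[OF cont compgc])
      then have "compact (({-1..1} \<times> S3) \<inter> (\<lambda>(t,x). F t x) -` great_circle a b)"
        using closedin_compact[OF compact_Times[OF compact_Icc compS3]] by blast
      then have "compact ((({-1..1} \<times> S3) \<inter> (\<lambda>(t,x). F t x) -` great_circle a b) \<inter> {(t,x). P t x})"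
        using that by (rule compact_Int_closed)
      moreover have "(({-1..1} \<times> S3) \<inter> (\<lambda>(t,x). F t x) -` great_circle a b) \<inter> {(t,x). P t x} = ?K" by auto
      ultimately have "compact ?K" by simp
      then have "compact (fst ` ?K)" by (intro compact_continuous_image continuous_intros)
      then have "closed (fst ` ?K)" by (rule compact_imp_closed)
      then have "openin (top_of_set {-1..1}) ({-1..1} \<inter> (- fst ` ?K))" by (intro openin_open_Int) (simp add: open_Compl)
      then show ?thesis by (simp add: Diff_eq)
    qed
    moreover have "misses P = (\<Union>(a,b)\<in>{(a,b). orthonormal_pair a b}.
       {-1..1} - fst ` {(t,x). (t,x) \<in> {-1..1} \<times> S3 \<and> P t x \<and> F t x \<in> great_circle a b})"
      unfolding misses_def by (auto simp: image_iff; blast)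
    ultimately show ?thesis by auto
  qed
  let ?A = "misses (\<lambda>t x. x$4 \<ge> t)" and ?B = "misses (\<lambda>t x. x$4 \<le> t)"
  have oA: "openin (top_of_set {-1..1}) ?A"
    by (rule open_misses) (unfold split_def, intro closed_Collect_le continuous_intros)
  have oB: "openin (top_of_set {-1..1}) ?B"
    by (rule open_misses) (unfold split_def, intro closed_Collect_le continuous_intros)
  have disj: "?A \<inter> ?B = {}"
  proof (rule ccontr)
    assume "?A \<inter> ?B \<noteq> {}"
    then obtain t a b c d where t: "t \<in> {-1..1}" and ab: "orthonormal_pair a b" and cd: "orthonormal_pair c d"
      and A: "\<And>x. x \<in> S3 \<Longrightarrow> x$4 \<ge> t \<Longrightarrow> F t x \<notin> great_circle a b"
      and B: "\<And>x. x \<in> S3 \<Longrightarrow> x$4 \<le> t \<Longrightarrow> F t x \<notin> great_circle c d"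
      unfolding misses_def by blast
    let ?U = "F t ` {x\<in>S3. x$4 < t}"
    note bt = bij[OF t]
    have im: "F t ` S3 = S3" and inj: "inj_on (F t) S3" using bt by (auto simp: bij_betw_def)
    obtain g where "homeomorphism S3 S3 (F t) g"
      using homeomorphism_compact[OF compS3 contF[OF t] im inj] by blast
    then have "homeomorphism {x\<in>S3. x$4 < t} ?U (F t) g"
      by (rule homeomorphism_of_subsets) (use im in auto)
    then have "{x\<in>S3. x$4 < t} homeomorphic ?U" unfolding homeomorphic_def by blast
    then have ctr: "contractible ?U" using homeomorphic_contractible contractible_cap[of t] t by fastforce
    have sub: "great_circle a b \<subseteq> ?U"
    proof
      fix p assume p: "p \<in> great_circle a b"
      then have "p \<in> S3" using great_circle_subset_S3[OF ab] by blast
      then obtain x where "x \<in> S3" "p = F t x" using im by blast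
      then show "p \<in> ?U" using A[of x] p by force
    qed
    have U2: "?U \<inter> great_circle c d = {}" using B by force
    show False
      by (rule great_circles_linked[OF ab cd _ _ ctr sub U2]) (use sub U2 im in auto)
  qed
  \<comment> \<open>Two great circles in orthogonal planes are disjoint, so p is off one of them.
    This serves t = 1 and t = -1, where one closed side of the slice is a single point.\<close>
  have avoid: "\<exists>a b. orthonormal_pair a b \<and> p \<notin> great_circle a b" for p
  proof -
    have o: "orthonormal_pair (axis 1 1) (axis 2 1)" "orthonormal_pair (axis 3 1) (axis 4 1)"
      by (auto simp: orthonormal_pair_def inner_axis_axis)
    have "great_circle (axis 1 1) (axis 2 1) \<inter> great_circle (axis 3 1) (axis 4 1) = {}"
    proof -
      { fix s t assume "cos s *\<^sub>R axis 1 1 + sin s *\<^sub>R axis 2 1 = cos t *\<^sub>R axis 3 1 + sin t *\<^sub>R (axis 4 1::real^4)"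
        then have "cos s = 0" "sin s = 0" by (simp_all add: vec_eq_iff forall_4 axis_def)
        then have False using sin_cos_squared_add[of s] by simp }
      then show ?thesis unfolding great_circle_def by auto
    qed
    then show ?thesis using o by blast
  qed
  have A1: "1 \<in> ?A"
  proof -
    have "x = axis 4 1" if "x \<in> S3" "x$4 \<ge> 1" for x :: "real^4"
    proof -
      have "(x$1)^2 + (x$2)^2 + (x$3)^2 + (x$4)^2 = 1"
        using that(1) by (simp add: S3_def norm_eq_1 inner_4 power2_eq_square)
      moreover have "(x$4)^2 \<ge> 1" using that(2) by simp
      ultimately have "(x$1)^2 + (x$2)^2 + (x$3)^2 \<le> 0" by linarith
      then have "x$1 = 0 \<and> x$2 = 0 \<and> x$3 = 0" by (smt (verit) zero_le_power2 power2_eq_iff_nonneg zero_power2 power_eq_0_iff)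
      moreover have "x$4 = 1" using that component_le_norm_cart[of x 4] by (auto simp: S3_def)
      ultimately show ?thesis by (simp add: vec_eq_iff forall_4 axis_def)
    qed
    then show ?thesis unfolding misses_def using avoid[of "F 1 (axis 4 1)"] by auto
  qed
  have B1: "-1 \<in> ?B"
  proof -
    have "x = - axis 4 1" if "x \<in> S3" "x$4 \<le> -1" for x :: "real^4"
    proof -
      have "(x$1)^2 + (x$2)^2 + (x$3)^2 + (x$4)^2 = 1"
        using that(1) by (simp add: S3_def norm_eq_1 inner_4 power2_eq_square)
      moreover have "(x$4)^2 \<ge> 1" using that(2) by (simp add: abs_le_square_iff[of 1, simplified, symmetric])
      ultimately have "(x$1)^2 + (x$2)^2 + (x$3)^2 \<le> 0" by linarith
      then have "x$1 = 0 \<and> x$2 = 0 \<and> x$3 = 0" by (smt (verit) zero_le_power2 power2_eq_iff_nonneg zero_power2 power_eq_0_iff)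
      moreover have "x$4 = -1" using that component_le_norm_cart[of x 4] by (auto simp: S3_def)
      ultimately show ?thesis by (simp add: vec_eq_iff forall_4 axis_def)
    qed
    then show ?thesis unfolding misses_def using avoid[of "F (-1) (- axis 4 1)"] by auto
  qed
  have "\<not> {-1..1} \<subseteq> ?A \<union> ?B"
  proof
    assume "{-1..1} \<subseteq> ?A \<union> ?B"
    moreover have "connected {-1..1::real}" by simp
    ultimately show False using oA oB disj A1 B1 unfolding connected_openin by blast
  qed
  then obtain t where t: "t \<in> {-1..1}" "t \<notin> ?A" "t \<notin> ?B" by blast
  then have "t \<noteq> 1" "t \<noteq> -1" using A1 B1 by auto
  then have t': "-1 < t" "t < 1" using t by auto
  \<comment> \<open>The preimage of the circle is connected and has points on both closed sides, so
    its height takes the value t.\<close>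
  have meets: "\<exists>x\<in>S3. x$4 = t \<and> F t x \<in> great_circle a b" if ab: "orthonormal_pair a b" for a b
  proof -
    obtain x where x: "x \<in> S3" "x$4 \<ge> t" "F t x \<in> great_circle a b"
      using t ab unfolding misses_def by blast
    obtain x' where x': "x' \<in> S3" "x'$4 \<le> t" "F t x' \<in> great_circle a b"
      using t ab unfolding misses_def by blast
    have im: "F t ` S3 = S3" and inj: "inj_on (F t) S3" using bij[OF t(1)] by (auto simp: bij_betw_def)
    obtain g where g: "homeomorphism S3 S3 (F t) g"
      using homeomorphism_compact[OF compS3 contF[OF t(1)] im inj] by blast
    have gS: "great_circle a b \<subseteq> S3" by (rule great_circle_subset_S3[OF ab])
    have "connected (great_circle a b)" unfolding great_circle_def
      by (intro connected_continuous_image continuous_intros) auto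
    moreover have "continuous_on (great_circle a b) g"
      using g gS by (meson continuous_on_subset homeomorphism_def)
    ultimately have con: "connected (g ` great_circle a b)" by (rule connected_continuous_image[rotated])
    have con: "connected ((\<lambda>x. x$4) ` g ` great_circle a b)"
      by (rule connected_continuous_image[OF _ con]) (intro continuous_intros)
    have "x = g (F t x)" "x' = g (F t x')" using x x' g by (auto simp: homeomorphism_def)
    then have "x$4 \<in> (\<lambda>x. x$4) ` g ` great_circle a b" "x'$4 \<in> (\<lambda>x. x$4) ` g ` great_circle a b"
      using x x' by blast+
    then have "t \<in> (\<lambda>x. x$4) ` g ` great_circle a b"
      using connectedD_interval[OF con] x x' by blast
    then obtain p where "p \<in> great_circle a b" "t = g p $ 4" by blast
    moreover have "p \<in> S3" using calculation gS by blast
    then have "g p \<in> S3" "F t (g p) = p" using g unfolding homeomorphism_def by blast+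
    ultimately show ?thesis by metis
  qed
  show ?thesis using that[OF t' meets] .
qed

section \<open>Area on the unit sphere\<close>

definition triple :: "real^3 \<Rightarrow> real^3 \<Rightarrow> real^3 \<Rightarrow> real" where
  "triple x y z = x \<bullet> cross3 y z"

definition cyl :: "real^2 \<Rightarrow> real^3" where
  "cyl u = vector [sqrt (1 - (u$1)^2) * cos (u$2), sqrt (1 - (u$1)^2) * sin (u$2), u$1]"

text \<open>The longitude is the imaginary part of the principal logarithm, hence differentiable off
  the half-plane over the non-positive real axis.\<close>

definition cyl_inv :: "real^3 \<Rightarrow> real^2" where
  "cyl_inv v = vector [v$3, Im (Ln (Complex (v$1) (v$2)))]"

lemma triple_eq: "triple x y z = x$1 * (y$2*z$3 - y$3*z$2) + x$2 * (y$3*z$1 - y$1*z$3) + x$3 * (y$1*z$2 - y$2*z$1)"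
  by (simp add: triple_def cross3_def inner_3)

lemma norm_eq_1_3: "norm (v::real^3) = 1 \<longleftrightarrow> (v$1)^2 + (v$2)^2 + (v$3)^2 = 1"
  by (simp add: norm_eq_1 inner_3 power2_eq_square)

lemma cyl_unit:
  assumes "\<bar>u$1\<bar> \<le> 1"
  shows "norm (cyl u) = 1"
proof -
  have "(u$1)^2 \<le> 1" using assms by (simp add: abs_square_le_1)
  then have "(sqrt (1 - (u$1)^2))^2 = 1 - (u$1)^2" by simp
  then show ?thesis unfolding norm_eq_1_3 cyl_def vector_3
    using sin_cos_squared_add[of "u$2"] by algebra
qed

lemma Complex_eq_exp_Ln:
  assumes "(a,b) \<noteq> (0,0)"
  shows "a = sqrt (a^2 + b^2) * cos (Im (Ln (Complex a b)))" "b = sqrt (a^2 + b^2) * sin (Im (Ln (Complex a b)))"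
proof -
  let ?w = "Complex a b"
  have "?w \<noteq> 0" using assms by (simp add: complex_eq_iff)
  then have e: "exp (Ln ?w) = ?w" by simp
  then have "exp (Re (Ln ?w)) = norm ?w" by (metis norm_exp_eq_Re)
  then have "?w = of_real (norm ?w) * cis (Im (Ln ?w))" using e exp_eq_polar by metis
  then have "Re ?w = norm ?w * cos (Im (Ln ?w))" "Im ?w = norm ?w * sin (Im (Ln ?w))"
    by (simp_all add: complex_eq_iff)
  then show "a = sqrt (a^2 + b^2) * cos (Im (Ln (Complex a b)))" "b = sqrt (a^2 + b^2) * sin (Im (Ln (Complex a b)))"
    by (simp_all add: complex_norm)
qed

lemma cyl_cyl_inv:
  assumes "norm v = 1" "(v$1, v$2) \<noteq> (0,0)"
  shows "cyl (cyl_inv v) = v"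
proof -
  have "(v$1)^2 + (v$2)^2 = 1 - (v$3)^2" using assms(1) unfolding norm_eq_1_3 by simp
  then show ?thesis
    using Complex_eq_exp_Ln[OF assms(2)]
    unfolding cyl_def cyl_inv_def vec_eq_iff forall_3 by simp
qed

lemma cyl_inv_cyl:
  assumes "-1 < u$1" "u$1 < 1" "-pi < u$2" "u$2 < pi"
  shows "cyl_inv (cyl u) = u" "Complex (cyl u $ 1) (cyl u $ 2) \<notin> \<real>\<^sub>\<le>\<^sub>0"
proof -
  have r: "sqrt (1 - (u$1)^2) > 0" using assms by (simp add: abs_square_less_1)
  let ?r = "sqrt (1 - (u$1)^2)"
  \<comment> \<open>\<open>exp ?z\<close> is the horizontal part of \<open>cyl u\<close>, and ?z
    lies in the strip where \<open>Ln\<close> inverts \<open>exp\<close>.\<close>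
  let ?z = "Complex (ln ?r) (u$2)"
  have eq: "Complex (cyl u $ 1) (cyl u $ 2) = exp ?z"
    using r by (simp add: complex_eq_iff cyl_def Re_exp Im_exp)
  have L: "Ln (exp ?z) = ?z" using assms by (intro Ln_exp) auto
  then show "cyl_inv (cyl u) = u" unfolding cyl_inv_def eq vec_eq_iff forall_2 L
    by (simp add: cyl_def)
  show "Complex (cyl u $ 1) (cyl u $ 2) \<notin> \<real>\<^sub>\<le>\<^sub>0"
  proof
    assume "Complex (cyl u $ 1) (cyl u $ 2) \<in> \<real>\<^sub>\<le>\<^sub>0"
    then have c: "cos (u$2) \<le> 0" and s: "sin (u$2) = 0"
      using r by (auto simp: complex_nonpos_Reals_iff cyl_def mult_le_0_iff)
    then have "u$2 = 0" using assms sin_gt_zero[of "u$2"] sin_gt_zero[of "-u$2"]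
      by (metis less_irrefl linorder_neqE_linordered_idom neg_0_less_iff_less neg_less_iff_less minus_minus neg_0_equal_iff_equal sin_minus)
    then show False using c by simp
  qed
qed

lemma has_derivative_cyl_inv:
  fixes y :: "real^2 \<Rightarrow> real^3"
  assumes y: "(y has_derivative y') (at p)" and n: "Complex (y p $ 1) (y p $ 2) \<notin> \<real>\<^sub>\<le>\<^sub>0"
  shows "((\<lambda>p. cyl_inv (y p)) has_derivative (\<lambda>h. vector [y' h $ 3,
     (y p $ 1 * y' h $ 2 - y p $ 2 * y' h $ 1) / ((y p $ 1)^2 + (y p $ 2)^2)])) (at p)"
proof (rule has_derivative_vecI)
  fix i :: 2
  have r: "(y p $ 1)^2 + (y p $ 2)^2 \<noteq> 0" using n by (auto simp: sum_power2_eq_zero_iff complex_nonpos_Reals_iff)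
  have C: "((\<lambda>p. Complex (y p $ 1) (y p $ 2)) has_derivative (\<lambda>h. Complex (y' h $ 1) (y' h $ 2))) (at p)"
    unfolding Complex_eq by (auto intro!: derivative_eq_intros has_derivative_vec_nth[OF y])
  have "(Ln has_field_derivative inverse (Complex (y p $ 1) (y p $ 2))) (at (Complex (y p $ 1) (y p $ 2)))"
    using has_field_derivative_Ln[OF n] .
  then have "(Ln has_derivative (*) (inverse (Complex (y p $ 1) (y p $ 2)))) (at (Complex (y p $ 1) (y p $ 2)))"
    by (simp add: has_field_derivative_def)
  from has_derivative_compose[OF C this]
  have "((\<lambda>p. Im (Ln (Complex (y p $ 1) (y p $ 2)))) has_derivative
     (\<lambda>h. Im (inverse (Complex (y p $ 1) (y p $ 2)) * Complex (y' h $ 1) (y' h $ 2)))) (at p)"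
    by (rule bounded_linear.has_derivative[OF bounded_linear_Im])
  moreover have "Im (inverse (Complex (y p $ 1) (y p $ 2)) * Complex (y' h $ 1) (y' h $ 2))
     = (y p $ 1 * y' h $ 2 - y p $ 2 * y' h $ 1) / ((y p $ 1)^2 + (y p $ 2)^2)" for h
    by (simp add: divide_inverse algebra_simps)
  ultimately have "((\<lambda>p. Im (Ln (Complex (y p $ 1) (y p $ 2)))) has_derivative
     (\<lambda>h. (y p $ 1 * y' h $ 2 - y p $ 2 * y' h $ 1) / ((y p $ 1)^2 + (y p $ 2)^2))) (at p)" by simp
  moreover have "i = 1 \<or> i = 2" using exhaust_2 by blast
  ultimately show "((\<lambda>p. cyl_inv (y p) $ i) has_derivative (\<lambda>h. vector [y' h $ 3,
     (y p $ 1 * y' h $ 2 - y p $ 2 * y' h $ 1) / ((y p $ 1)^2 + (y p $ 2)^2)] $ i)) (at p)"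
    using has_derivative_vec_nth[OF y, of 3] by (auto simp: cyl_inv_def)
qed

text \<open>Archimedes: the cylindrical chart of the sphere preserves area.\<close>
lemma det_cyl_inv:
  fixes v a b :: "real^3"
  assumes "norm v = 1" "v \<bullet> a = 0" "v \<bullet> b = 0" "(v$1)^2 + (v$2)^2 \<noteq> 0"
  shows "a$3 * ((v$1 * b$2 - v$2 * b$1) / ((v$1)^2 + (v$2)^2))
     - b$3 * ((v$1 * a$2 - v$2 * a$1) / ((v$1)^2 + (v$2)^2)) = - triple v a b"
proof -
  have "a$3 * (v$1 * b$2 - v$2 * b$1) - b$3 * (v$1 * a$2 - v$2 * a$1)
     = - triple v a b * ((v$1)^2 + (v$2)^2)"
    using assms(1,2,3) unfolding triple_eq norm_eq_1_3 inner_3 by algebra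
  then show ?thesis using assms(4) by (auto simp: divide_simps)
qed

text \<open>In the cylindrical chart area is Lebesgue measure, and the Jacobian of
  \<open>cyl_inv\<close> after y is, up to sign, the triple product of y and its partial
  derivatives. Multiple coverings only enlarge the right side, so surjectivity suffices for the
  inequality.\<close>

lemma sphere_area_le:
  fixes y :: "real^2 \<Rightarrow> real^3" and G :: "real^3 \<Rightarrow> real"
  assumes der: "\<And>p. (y has_derivative y' p) (at p)"
    and unit: "\<And>p. norm (y p) = 1"
    and S: "compact S"
    and cont: "\<And>i. continuous_on S (\<lambda>p. y' p (axis i 1))"
    and G: "continuous_on (sphere 0 1) G" "\<And>v. G v \<ge> 0"
    and surj: "\<And>v. norm v = 1 \<Longrightarrow> v \<in> y ` S"
  shows "integral (cbox (vector [-1,-pi]) (vector [1,pi])) (\<lambda>u. G (cyl u))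
    \<le> integral S (\<lambda>p. \<bar>triple (y p) (y' p (axis 1 1)) (y' p (axis 2 1))\<bar> * G (y p))"
proof -
  let ?C = "cbox (vector [-1,-pi]) (vector [1,pi]) :: (real^2) set"
  let ?B = "box (vector [-1,-pi]) (vector [1,pi]) :: (real^2) set"
  let ?J = "\<lambda>p. \<bar>triple (y p) (y' p (axis 1 1)) (y' p (axis 2 1))\<bar> * G (y p)"
  define f where "f p = cyl_inv (y p)" for p
  \<comment> \<open>The meridian where the longitude jumps is removed together with the poles; what
    is left still covers the open rectangle.\<close>
  define S' where "S' = {p\<in>S. Complex (y p $ 1) (y p $ 2) \<notin> \<real>\<^sub>\<le>\<^sub>0}"
  define f' where "f' p h = (vector [y' p h $ 3,
     (y p $ 1 * y' p h $ 2 - y p $ 2 * y' p h $ 1) / ((y p $ 1)^2 + (y p $ 2)^2)] :: real^2)" for p h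
  have conty: "continuous_on A y" for A
    using der by (meson continuous_at_imp_continuous_on has_derivative_continuous)
  have contJ: "continuous_on S ?J"
    unfolding triple_eq
    by (intro continuous_intros cont conty continuous_on_compose2[OF G(1) conty]) (auto simp: unit)
  have intJ: "set_integrable lborel S ?J"
    using borel_integrable_compact[OF S contJ] unfolding set_integrable_def by simp
  have "openin (top_of_set S) (S \<inter> y -` (- {v. v$1 \<le> 0 \<and> v$2 = 0}))"
  proof (rule continuous_openin_preimage_gen[OF conty])
    have "closed {v::real^3. v$1 \<le> 0 \<and> v$2 = 0}"
      by (intro closed_Collect_conj closed_Collect_le closed_Collect_eq continuous_intros)
    then show "open (- {v::real^3. v$1 \<le> 0 \<and> v$2 = 0})" by (rule open_Compl)
  qed
  moreover have "S' = S \<inter> y -` (- {v. v$1 \<le> 0 \<and> v$2 = 0})"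
    unfolding S'_def by (auto simp: complex_nonpos_Reals_iff)
  ultimately obtain T where "open T" "S' = S \<inter> T" by (metis openin_open)
  then have S': "S' \<in> sets lborel" "S' \<subseteq> S" using S by (auto intro: borel_compact)
  have intJ': "?J integrable_on S'"
    using set_borel_integral_eq_integral(1)[OF set_integrable_subset[OF intJ S']] .
  have orth: "y p \<bullet> y' p h = 0" for p h
  proof -
    have "((\<lambda>p. y p \<bullet> y p) has_derivative (\<lambda>h. y p \<bullet> y' p h + y' p h \<bullet> y p)) (at p)"
      by (rule has_derivative_inner[OF der der])
    moreover have "(\<lambda>p. y p \<bullet> y p) = (\<lambda>p. 1)" using unit by (simp add: norm_eq_1)
    ultimately have "((\<lambda>p. 1) has_derivative (\<lambda>h. y p \<bullet> y' p h + y' p h \<bullet> y p)) (at p)" by simp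
    then have "(\<lambda>h. y p \<bullet> y' p h + y' p h \<bullet> y p) = (\<lambda>h. 0)"
      using has_derivative_unique has_derivative_const by blast
    then have "y p \<bullet> y' p h + y' p h \<bullet> y p = 0" by (rule fun_cong)
    then show ?thesis by (simp add: inner_commute)
  qed
  have nz: "(y p $ 1)^2 + (y p $ 2)^2 \<noteq> 0" if "p \<in> S'" for p
    using that unfolding S'_def by (auto simp: sum_power2_eq_zero_iff complex_nonpos_Reals_iff)
  have derf: "(f has_derivative f' p) (at p within S')" if "p \<in> S'" for p
    unfolding f_def f'_def
    by (rule has_derivative_at_withinI, rule has_derivative_cyl_inv[OF der]) (use that in \<open>simp add: S'_def\<close>)
  have detf: "\<bar>det (matrix (f' p))\<bar> * G (cyl (f p)) = ?J p" if p: "p \<in> S'" for p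
  proof -
    have "det (matrix (f' p)) = - triple (y p) (y' p (axis 1 1)) (y' p (axis 2 1))"
      unfolding det_2 matrix_def f'_def
      using det_cyl_inv[OF unit orth orth nz[OF p], of "axis 1 1" "axis 2 1"] by (simp add: mult_ac)
    moreover have "cyl (f p) = y p"
      unfolding f_def by (rule cyl_cyl_inv[OF unit]) (use nz[OF p] in auto)
    ultimately show ?thesis by simp
  qed
  have "(\<lambda>p. \<bar>det (matrix (f' p))\<bar> * G (cyl (f p))) integrable_on S'"
    using intJ' detf by (simp cong: integrable_cong)
  note ub = integral_on_image_ubound_nonneg[where f="\<lambda>u. G (cyl u)" and g=f and S=S' and g'=f', OF _ derf this]
  have BC: "?B \<subseteq> ?C" by (rule box_subset_cbox)
  have inB: "-1 < u$1" "u$1 < 1" "-pi < u$2" "u$2 < pi" if "u \<in> ?B" for u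
    using that by (auto simp: mem_box_cart forall_2)
  have sub: "?B \<subseteq> f ` S'"
  proof
    fix u assume u: "u \<in> ?B"
    note i = inB[OF u]
    have "norm (cyl u) = 1" by (rule cyl_unit) (use i in auto)
    then obtain p where p: "p \<in> S" "y p = cyl u" using surj by (metis imageE)
    then have "p \<in> S'" "f p = u" unfolding S'_def f_def using cyl_inv_cyl[OF i] by auto
    then show "u \<in> f ` S'" by blast
  qed
  have cG: "continuous_on ?C (\<lambda>u. G (cyl u))"
  proof (rule continuous_on_compose2[OF G(1)])
    have "continuous_on ?C (\<lambda>u. cyl u $ i)" for i
    proof -
      have "i = 1 \<or> i = 2 \<or> i = 3" using exhaust_3 by blast
      then show ?thesis unfolding cyl_def by (elim disjE) (simp_all add: continuous_intros)
    qed
    then have "continuous_on ?C (\<lambda>u. \<chi> i. cyl u $ i)" by (rule continuous_on_vec_lambda)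
    then show "continuous_on ?C cyl" by simp
    show "cyl ` ?C \<subseteq> sphere 0 1"
    proof
      fix v assume "v \<in> cyl ` ?C"
      then obtain u where u: "u \<in> ?C" "v = cyl u" by blast
      then have "\<bar>u$1\<bar> \<le> 1" by (auto simp: mem_box_cart forall_2 dest: spec[of _ 1])
      then show "v \<in> sphere 0 1" using cyl_unit u(2) by simp
    qed
  qed
  \<comment> \<open>The sides of the rectangle, which belong to the removed meridian and the poles,
    have measure zero.\<close>
  have "integral ?C (\<lambda>u. G (cyl u)) = integral ?B (\<lambda>u. G (cyl u))" by (rule integral_open_interval[symmetric])
  also have "\<dots> \<le> integral (f ` S') (\<lambda>u. G (cyl u))"
  proof (rule integral_subset_le[OF sub])
    show "(\<lambda>u. G (cyl u)) integrable_on ?B"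
      using integrable_continuous[OF cG] by (simp add: integrable_on_open_interval)
    show "(\<lambda>u. G (cyl u)) integrable_on f ` S'" using ub G(2) by simp
  qed (simp add: G(2))
  also have "\<dots> \<le> integral S' (\<lambda>p. \<bar>det (matrix (f' p))\<bar> * G (cyl (f p)))" using ub G(2) by simp
  also have "\<dots> = integral S' ?J" using detf by (simp cong: integral_cong)
  also have "\<dots> \<le> integral S ?J"
    by (rule integral_subset_le[OF S'(2) intJ' set_borel_integral_eq_integral(1)[OF intJ]]) (simp add: G(2))
  finally show ?thesis .
qed

section \<open>Averaging over directions\<close>

lemma vector2_eta: "vector [u$1, u$2] = (u :: real^2)"
  by (simp add: vec_eq_iff forall_2)

lemma cbox_vector2: "cbox (vector [a,c]) (vector [b,d]) = {u::real^2. a \<le> u$1 \<and> u$1 \<le> b \<and> c \<le> u$2 \<and> u$2 \<le> d}"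
  by (auto simp: mem_box_cart forall_2)

text \<open>Fubini is a statement about pairs of reals; the relabelling \<open>?g\<close> sends
  boxes to boxes of equal content, so the integral carries over.\<close>

lemma integral_cbox_real2:
  fixes f :: "real^2 \<Rightarrow> real"
  assumes f: "continuous_on (cbox (vector [a,c]) (vector [b,d])) f"
  shows "integral (cbox (vector [a,c]) (vector [b,d])) f
    = integral {a..b} (\<lambda>x. integral {c..d} (\<lambda>y. f (vector [x,y])))"
proof -
  let ?g = "\<lambda>z::real\<times>real. vector [fst z, snd z] :: real^2" and ?h = "\<lambda>u::real^2. (u$1, u$2)"
  have cg: "continuous_on A ?g" for A
  proof -
    have "continuous_on A (\<lambda>z. \<chi> i. ?g z $ i)"
    proof (rule continuous_on_vec_lambda)
      fix i :: 2
      have "i = 1 \<or> i = 2" using exhaust_2 by blast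
      then show "continuous_on A (\<lambda>z. ?g z $ i)" by (elim disjE) (simp_all add: continuous_intros)
    qed
    then show ?thesis by simp
  qed
  have gim: "?g ` cbox u v = cbox (?g u) (?g v)" for u v
  proof -
    have "w \<in> ?g ` cbox u v" if "w \<in> cbox (?g u) (?g v)" for w
    proof -
      have "(w$1, w$2) \<in> cbox u v" "w = ?g (w$1, w$2)"
        using that unfolding cbox_vector2 by (cases u; cases v; auto simp: vector2_eta)+
      then show ?thesis by blast
    qed
    then show ?thesis by (cases u; cases v; auto simp: cbox_vector2)
  qed
  have him: "?h ` cbox u v = cbox (?h u) (?h v)" for u v
  proof -
    have "?h ` cbox u v = ?h ` cbox (?g (?h u)) (?g (?h v))" by (simp add: vector2_eta)
    also have "\<dots> = ?h ` ?g ` cbox (?h u) (?h v)" by (simp only: gim)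
    also have "\<dots> = cbox (?h u) (?h v)" by (simp add: image_image)
    finally show ?thesis .
  qed
  have "((\<lambda>x. f (?g x)) has_integral (1/1) *\<^sub>R integral (cbox (vector [a,c]) (vector [b,d])) f)
     (?h ` cbox (vector [a,c]) (vector [b,d]))"
  proof (rule has_integral_twiddle)
    show "isCont ?g x" for x using cg[of UNIV] unfolding continuous_on_eq_continuous_at[OF open_UNIV] by blast
    show "\<exists>w z. ?g ` cbox u v = cbox w z" for u v using gim by blast
    show "\<exists>w z. ?h ` cbox u v = cbox w z" for u v using him by blast
    show "measure lborel (?g ` cbox u v) = 1 * measure lborel (cbox u v)" for u v
    proof (cases "cbox u v = {}")
      case False
      obtain u1 u2 v1 v2 where uv: "u = (u1,u2)" "v = (v1,v2)" by (cases u; cases v)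
      have ne: "cbox (?g u) (?g v) \<noteq> {}" using False gim by blast
      have "u1 \<le> v1" "u2 \<le> v2" using False unfolding uv by (auto simp: cbox_Pair_eq)
      then show ?thesis using content_cbox_cart[OF ne] unfolding gim uv content_Pair
        by (simp add: UNIV_2)
    qed simp
    show "(f has_integral integral (cbox (vector [a,c]) (vector [b,d])) f) (cbox (vector [a,c]) (vector [b,d]))"
      using integrable_continuous[OF f] by (rule integrable_integral)
  qed (auto simp: vector2_eta)
  then have "integral (cbox (vector [a,c]) (vector [b,d])) f = integral (cbox (a,c) (b,d)) (\<lambda>x. f (?g x))"
    by (simp add: him integral_unique)
  also have "\<dots> = integral (cbox a b) (\<lambda>x. integral (cbox c d) (\<lambda>y. f (?g (x,y))))"
  proof (rule integral_prod_continuous)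
    show "continuous_on (cbox (a,c) (b,d)) (\<lambda>x. f (?g x))"
      by (rule continuous_on_compose2[OF f cg]) (auto simp: cbox_vector2 cbox_Pair_eq)
  qed
  finally show ?thesis by simp
qed

lemma slice_domain_eq: "slice_domain = cbox (vector [0,0]) (vector [pi, 2*pi])"
proof -
  have "(0::real^2) = vector [0,0]" by (simp add: vec_eq_iff forall_2)
  then show ?thesis unfolding slice_domain_def by simp
qed

lemma mem_slice_domain: "p \<in> slice_domain \<longleftrightarrow> 0 \<le> p$1 \<and> p$1 \<le> pi \<and> 0 \<le> p$2 \<and> p$2 \<le> 2*pi"
  unfolding slice_domain_eq cbox_vector2 by simp

lemma integral_slice_domain:
  fixes f :: "real \<Rightarrow> real"
  assumes "continuous_on {0..pi} f"
  shows "integral slice_domain (\<lambda>p. f (p$1)) = 2 * pi * integral {0..pi} f"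
proof -
  have "continuous_on slice_domain (\<lambda>p. f (p$1))"
    by (intro continuous_on_compose2[OF assms] continuous_intros) (auto simp: mem_slice_domain)
  then show ?thesis
    unfolding slice_domain_eq by (subst integral_cbox_real2) (auto simp: mult.commute)
qed

section \<open>Integrals over the sphere in spherical coordinates\<close>

lemma integral_sin_0_pi: "integral {0..pi} sin = (2::real)"
proof -
  have "(sin has_integral (- cos pi - (- cos 0))) {0..pi::real}"
    by (rule fundamental_theorem_of_calculus)
      (auto intro!: derivative_eq_intros simp: has_real_derivative_iff_has_vector_derivative[symmetric])
  then show ?thesis by (simp add: integral_unique)
qed

lemma integral_sin_abs_cos: "integral {0..pi} (\<lambda>x. sin x * \<bar>cos x\<bar>) = (1::real)"
proof -
  have d: "((\<lambda>x. (sin x)^2 / 2) has_real_derivative sin x * cos x) (at x within S)" for x S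
    by (auto intro!: derivative_eq_intros simp: power2_eq_square)
  have 1: "((\<lambda>x. sin x * cos x) has_integral ((sin (pi/2))^2/2 - (sin 0)^2/2)) {0..pi/2}"
    by (rule fundamental_theorem_of_calculus)
      (auto simp: has_real_derivative_iff_has_vector_derivative[symmetric] d)
  have 2: "((\<lambda>x. - (sin x * cos x)) has_integral - ((sin pi)^2/2 - (sin (pi/2))^2/2)) {pi/2..pi}"
    by (rule has_integral_neg, rule fundamental_theorem_of_calculus)
      (auto simp: has_real_derivative_iff_has_vector_derivative[symmetric] d)
  have 1: "((\<lambda>x. sin x * \<bar>cos x\<bar>) has_integral 1/2) {0..pi/2}"
    by (rule has_integral_eq[OF _ 1[simplified]]) (auto simp: cos_ge_zero)
  have 2: "((\<lambda>x. sin x * \<bar>cos x\<bar>) has_integral 1/2) {pi/2..pi}"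
  proof (rule has_integral_eq[OF _ 2[simplified]])
    fix x assume x: "x \<in> {pi/2..pi}"
    then have "cos x \<le> 0" using cos_monotone_0_pi_le[of "pi/2" x] by simp
    then show "- (sin x * cos x) = sin x * \<bar>cos x\<bar>" by simp
  qed
  have "((\<lambda>x. sin x * \<bar>cos x\<bar>) has_integral (1/2 + 1/2)) {0..pi}"
    by (rule has_integral_combine[OF _ _ 1 2]) auto
  then show ?thesis by (simp add: integral_unique)
qed

definition sph :: "real^2 \<Rightarrow> real^3" where
  "sph p = vector [sin (p$1) * cos (p$2), sin (p$1) * sin (p$2), cos (p$1)]"

definition sph_deriv :: "real^2 \<Rightarrow> real^2 \<Rightarrow> real^3" where
  "sph_deriv p h = vector [cos (p$1) * cos (p$2) * h$1 - sin (p$1) * sin (p$2) * h$2,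
     cos (p$1) * sin (p$2) * h$1 + sin (p$1) * cos (p$2) * h$2, - sin (p$1) * h$1]"

lemma has_derivative_sph: "(sph has_derivative sph_deriv p) (at p)"
proof (rule has_derivative_vecI)
  fix i :: 3
  have "i = 1 \<or> i = 2 \<or> i = 3" using exhaust_3 by blast
  then show "((\<lambda>p. sph p $ i) has_derivative (\<lambda>h. sph_deriv p h $ i)) (at p)"
    by (elim disjE) (auto simp: sph_def sph_deriv_def algebra_simps intro!: derivative_eq_intros has_derivative_vec_nth)
qed

lemma sph_unit: "norm (sph p) = 1"
  unfolding norm_eq_1_3 sph_def vector_3
  using sin_cos_squared_add[of "p$1"] sin_cos_squared_add[of "p$2"] by algebra

lemma sph_surj:
  assumes "norm v = 1"
  shows "\<exists>p\<in>slice_domain. v = sph p"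
proof -
  define a where "a = arccos (v$3)"
  have v: "(v$1)^2 + (v$2)^2 + (v$3)^2 = 1" using assms norm_eq_1_3 by simp
  have "\<bar>v$3\<bar> \<le> 1" using component_le_norm_cart[of v 3] assms by simp
  then have a: "cos a = v$3" "0 \<le> a" "a \<le> pi" unfolding a_def by (auto intro: arccos_lbound arccos_ubound)
  have s: "(sin a)^2 = (v$1)^2 + (v$2)^2" using v sin_cos_squared_add[of a] a(1) by simp
  obtain b where b: "0 \<le> b" "b \<le> 2*pi" "v$1 = sin a * cos b" "v$2 = sin a * sin b"
  proof (cases "sin a = 0")
    case True
    then have "v$1 = 0" "v$2 = 0" using s by (simp_all add: sum_power2_eq_zero_iff)
    then show ?thesis using that[of 0] True by simp
  next
    case False
    then have "(v$1/sin a)^2 + (v$2/sin a)^2 = 1" using s by (auto simp: power_divide add_divide_distrib[symmetric])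
    then obtain b where "0 \<le> b" "b \<le> 2*pi" "v$1/sin a = cos b" "v$2/sin a = sin b"
      using sincos_total_2pi_le by metis
    then show ?thesis using that[of b] False by (simp add: field_simps)
  qed
  have "v = sph (vector [a,b])" unfolding sph_def vec_eq_iff forall_3 using a b by simp
  moreover have "vector [a,b] \<in> slice_domain" using a b by (simp add: mem_slice_domain)
  ultimately show ?thesis by blast
qed

lemma triple_orthogonal:
  assumes "orthogonal_transformation R"
  shows "\<bar>triple (R x) (R y) (R z)\<bar> = \<bar>triple x y z\<bar>"
proof -
  have "cross3 (R y) (R z) = det (matrix R) *\<^sub>R R (cross3 y z)"
    by (rule cross_orthogonal_transformation[OF assms])
  then have "triple (R x) (R y) (R z) = det (matrix R) * triple x y z"
    using assms unfolding triple_def by (simp add: orthogonal_transformation_def)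
  moreover have "\<bar>det (matrix R)\<bar> = 1" using assms by (simp add: orthogonal_transformation_det)
  ultimately show ?thesis by (simp add: abs_mult)
qed

lemma triple_sph: "triple (sph p) (sph_deriv p (axis 1 1)) (sph_deriv p (axis 2 1)) = sin (p$1)"
  unfolding triple_eq sph_def sph_deriv_def vector_3
  by (simp add: axis_def) (use sin_cos_squared_add[of "p$1"] sin_cos_squared_add[of "p$2"] in algebra)

text \<open>An orthogonal map takes the third axis to the direction of w. In the polar coordinates
  around that direction the integral is 2 pi |w| times the integral of sin |cos| over [0, pi], which
  is 1.\<close>

lemma cylindrical_average_le:
  "integral (cbox (vector [-1,-pi]) (vector [1,pi])) (\<lambda>u. \<bar>w \<bullet> cyl u\<bar>) \<le> 2 * pi * norm w"
proof (cases "w = 0")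
  case False
  obtain R where R: "orthogonal_transformation R" "R (axis 3 1 :: real^3) = w /\<^sub>R norm w"
    by (rule orthogonal_transformation_exists_1[of "axis 3 1 :: real^3" "w /\<^sub>R norm w"]) (use False in auto)
  have lR: "bounded_linear R" using R(1) by (simp add: orthogonal_transformation_linear linear_linear)
  have wR: "w \<bullet> R v = norm w * v$3" for v
  proof -
    have "w = norm w *\<^sub>R R (axis 3 1)" using R(2) False by simp
    then have "w \<bullet> R v = norm w * (R (axis 3 1) \<bullet> R v)" by (metis inner_scaleR_left)
    also have "R (axis 3 1) \<bullet> R v = v$3" using R(1) by (simp add: orthogonal_transformation_def inner_axis')
    finally show ?thesis .
  qed
  have "integral (cbox (vector [-1,-pi]) (vector [1,pi])) (\<lambda>u. \<bar>w \<bullet> cyl u\<bar>)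
    \<le> integral slice_domain (\<lambda>p. \<bar>triple (R (sph p)) (R (sph_deriv p (axis 1 1))) (R (sph_deriv p (axis 2 1)))\<bar> * \<bar>w \<bullet> R (sph p)\<bar>)"
  proof (rule sphere_area_le[where y'="\<lambda>p h. R (sph_deriv p h)"])
    show "((\<lambda>p. R (sph p)) has_derivative (\<lambda>h. R (sph_deriv p h))) (at p)" for p
      by (rule bounded_linear.has_derivative[OF lR has_derivative_sph])
    show "norm (R (sph p)) = 1" for p using R(1) sph_unit by (simp add: orthogonal_transformation)
    show "compact slice_domain" unfolding slice_domain_def by simp
    show "continuous_on slice_domain (\<lambda>p. R (sph_deriv p (axis i 1)))" for i
    proof (intro bounded_linear.continuous_on[OF lR])
      have "continuous_on slice_domain (\<lambda>p. \<chi> j. sph_deriv p (axis i 1) $ j)"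
      proof (rule continuous_on_vec_lambda)
        fix j :: 3
        have "j = 1 \<or> j = 2 \<or> j = 3" using exhaust_3 by blast
        then show "continuous_on slice_domain (\<lambda>p. sph_deriv p (axis i 1) $ j)"
          by (elim disjE) (auto simp: sph_deriv_def intro!: continuous_intros)
      qed
      then show "continuous_on slice_domain (\<lambda>p. sph_deriv p (axis i 1))" by simp
    qed
    show "continuous_on (sphere 0 1) (\<lambda>v. \<bar>w \<bullet> v\<bar>)" by (intro continuous_intros)
    show "v \<in> (\<lambda>p. R (sph p)) ` slice_domain" if "norm v = 1" for v
    proof -
      obtain v0 where v0: "v = R v0" using orthogonal_transformation_surj[OF R(1)] by (metis surjD)
      then have "norm v0 = 1" using that R(1) by (simp add: orthogonal_transformation)
      then show ?thesis using sph_surj v0 by blast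
    qed
  qed simp
  also have "\<dots> = integral slice_domain (\<lambda>p. norm w * (sin (p$1) * \<bar>cos (p$1)\<bar>))"
  proof (rule integral_cong)
    fix p assume "p \<in> slice_domain"
    then have "sin (p$1) \<ge> 0" by (intro sin_ge_zero) (auto simp: mem_slice_domain)
    then show "\<bar>triple (R (sph p)) (R (sph_deriv p (axis 1 1))) (R (sph_deriv p (axis 2 1)))\<bar> * \<bar>w \<bullet> R (sph p)\<bar>
      = norm w * (sin (p$1) * \<bar>cos (p$1)\<bar>)"
      unfolding triple_orthogonal[OF R(1)] triple_sph wR by (simp add: sph_def abs_mult)
  qed
  also have "\<dots> = norm w * (2 * pi * 1)"
    by (simp only: integral_mult_right)
      (subst integral_slice_domain[of "\<lambda>x. sin x * \<bar>cos x\<bar>"]; simp add: integral_sin_abs_cos continuous_intros)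
  finally show ?thesis by (simp add: mult.commute)
qed simp


section \<open>The stretched normal and its average\<close>

text \<open>The height moves to the first place, the entry that \<open>stretch\<close> leaves alone,
  so the length of a stretched direction depends on the height only.\<close>

definition cyc :: "real^2 \<Rightarrow> real^3" where
  "cyc u = vector [cyl u $ 3, cyl u $ 1, cyl u $ 2]"

text \<open>The effect of the Berger metric on normals: the first entry belongs to the horizontal
  plane, whose area is unchanged; the other two belong to planes containing the Hopf direction,
  whose area is multiplied by \<rho>.\<close>

definition stretch :: "real \<Rightarrow> real^3 \<Rightarrow> real^3" where
  "stretch \<rho> v = vector [v$1, \<rho> * v$2, \<rho> * v$3]"

lemma continuous_on_stretch: "continuous_on A f \<Longrightarrow> continuous_on A (\<lambda>x. stretch \<rho> (f x))"
proof (rule continuous_on_vec_nthI)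
  fix i :: 3
  assume c: "continuous_on A f"
  have "i = 1 \<or> i = 2 \<or> i = 3" using exhaust_3 by blast
  then show "continuous_on A (\<lambda>x. stretch \<rho> (f x) $ i)"
    by (elim disjE) (auto simp: stretch_def intro!: continuous_intros c)
qed

lemma continuous_on_cyl: "continuous_on A cyl"
proof -
  have "continuous_on A (\<lambda>u. \<chi> j. cyl u $ j)"
  proof (rule continuous_on_vec_lambda)
    fix j :: 3
    have "j = 1 \<or> j = 2 \<or> j = 3" using exhaust_3 by blast
    then show "continuous_on A (\<lambda>u. cyl u $ j)"
      by (elim disjE) (simp_all add: cyl_def continuous_intros)
  qed
  then show ?thesis by simp
qed

lemma cyclic_average_le:
  "integral (cbox (vector [-1,-pi]) (vector [1,pi])) (\<lambda>u. \<bar>w \<bullet> cyc u\<bar>) \<le> 2 * pi * norm w"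
proof -
  have "w \<bullet> cyc u = vector [w$2, w$3, w$1] \<bullet> cyl u" for u
    by (simp add: cyc_def inner_3)
  moreover have "norm (vector [w$2, w$3, w$1] :: real^3) = norm w"
    by (simp add: norm_eq_sqrt_inner inner_3 add_ac)
  ultimately show ?thesis using cylindrical_average_le[of "vector [w$2, w$3, w$1]"] by simp
qed

text \<open>Concavity of the square root: the squared norm is the mean of 1 and \<rho>^2 with
  weights z^2 and 1 - z^2, where z = u$1, and the left side is the same mean of 1 and
  \<rho>.\<close>

lemma norm_stretch_cyc_ge:
  assumes "\<bar>u$1\<bar> \<le> 1" "\<rho> > 0"
  shows "\<rho> + (1 - \<rho>) * (u$1)^2 \<le> norm (stretch \<rho> (cyc u))"
proof -
  have z: "(u$1)^2 \<le> 1" using assms by (simp add: abs_square_le_1)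
  have unit: "(cyl u $ 1)^2 + (cyl u $ 2)^2 + (u$1)^2 = 1"
    using cyl_unit[OF assms(1)] unfolding norm_eq_1_3 by (simp add: cyl_def)
  have "norm (stretch \<rho> (cyc u))^2 = (u$1)^2 + \<rho>^2 * ((cyl u $ 1)^2 + (cyl u $ 2)^2)"
    unfolding norm_sq_3 stretch_def cyc_def by (simp add: cyl_def power_mult_distrib algebra_simps)
  also have "\<dots> = (u$1)^2 + \<rho>^2 * (1 - (u$1)^2)" using unit by algebra
  also have "\<dots> = (\<rho> + (1 - \<rho>) * (u$1)^2)^2 + (u$1)^2 * (1 - (u$1)^2) * (1 - \<rho>)^2"
    by (simp add: algebra_simps power2_eq_square)
  also have "\<dots> \<ge> (\<rho> + (1 - \<rho>) * (u$1)^2)^2" using z by simp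
  finally show ?thesis by (rule power2_le_imp_le) simp
qed

text \<open>The double integral of |n . stretch u| over slice and directions is evaluated in two
  orders. With the slice inside, \<open>lower\<close> bounds it below through |stretch u|; with the
  directions inside, it is at most 2 pi times the integral of |stretch n|.\<close>

lemma integral_norm_stretch_ge:
  fixes n :: "real^2 \<Rightarrow> real^3"
  assumes cn: "continuous_on slice_domain n" and \<rho>: "\<rho> > 0"
    and lower: "\<And>v. 2 * pi * norm v \<le> integral slice_domain (\<lambda>p. \<bar>n p \<bullet> v\<bar>)"
  shows "4 * pi * (1/3 + 2 * \<rho> / 3) \<le> integral slice_domain (\<lambda>p. norm (stretch \<rho> (n p)))"
proof -
  let ?C = "cbox (vector [-1,-pi]) (vector [1,pi]) :: (real^2) set"
  have cc: "continuous_on A cyc" for A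
  proof (rule continuous_on_vec_nthI)
    fix i :: 3
    have "i = 1 \<or> i = 2 \<or> i = 3" using exhaust_3 by blast
    then show "continuous_on A (\<lambda>x. cyc x $ i)"
      by (elim disjE) (auto simp: cyc_def intro!: continuous_intros continuous_on_cyl)
  qed
  \<comment> \<open>Symmetry of \<open>stretch\<close> moves it from the direction to the
    normal.\<close>
  have sym: "w \<bullet> stretch \<rho> v = stretch \<rho> w \<bullet> v" for w v by (simp add: stretch_def inner_3)
  let ?f = "\<lambda>u p. \<bar>n p \<bullet> stretch \<rho> (cyc u)\<bar>"
  have cf: "continuous_on (?C \<times> slice_domain) (\<lambda>(u,p). ?f u p)"
    unfolding split_def
    by (intro continuous_intros continuous_on_compose2[OF cn] continuous_on_stretch continuous_on_compose2[OF cc]) auto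
  have cfC: "continuous_on ?C (\<lambda>u. integral slice_domain (?f u))"
    unfolding slice_domain_eq
    by (rule integral_continuous_on_param) (use cf in \<open>simp add: slice_domain_eq\<close>)
  have cfD: "continuous_on slice_domain (\<lambda>p. integral ?C (\<lambda>u. ?f u p))"
  proof (rule integral_continuous_on_param)
    show "continuous_on (slice_domain \<times> ?C) (\<lambda>(p,u). ?f u p)"
      unfolding split_def
      by (intro continuous_intros continuous_on_compose2[OF cn] continuous_on_stretch continuous_on_compose2[OF cc]) auto
  qed
  \<comment> \<open>z is the height on the sphere of directions; one factor 2 pi is the length of
    the longitude interval, the other the constant in \<open>lower\<close>. The mean 1/3 of z^2
    produces the weights 1/3 and 2/3.\<close>
  have int13: "((\<lambda>z. 2 * pi * (2 * pi * (\<rho> + (1 - \<rho>) * z^2))) has_integral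
      (2 * pi * (2 * pi * (\<rho> + (1 - \<rho>) / 3)) - 2 * pi * (2 * pi * ((\<rho> - 1) / 3 - \<rho>)))) {-1..1::real}"
  proof -
    have "((\<lambda>z. 2 * pi * (2 * pi * (\<rho> + (1 - \<rho>) * z^2))) has_integral
      (2 * pi * (2 * pi * (\<rho> * 1 + (1 - \<rho>) * 1^3 / 3)) - 2 * pi * (2 * pi * (\<rho> * (-1) + (1 - \<rho>) * (-1)^3 / 3)))) {-1..1::real}"
      by (rule fundamental_theorem_of_calculus)
        (auto intro!: derivative_eq_intros simp: has_real_derivative_iff_has_vector_derivative[symmetric] power2_eq_square)
    then show ?thesis by simp
  qed
  have "2 * pi * (4 * pi * (1/3 + 2 * \<rho> / 3)) = integral {-1..1} (\<lambda>z. 2 * pi * (2 * pi * (\<rho> + (1 - \<rho>) * z^2)))"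
    unfolding integral_unique[OF int13] by (simp add: field_simps)
  also have "\<dots> = integral ?C (\<lambda>u. 2 * pi * (\<rho> + (1 - \<rho>) * (u$1)^2))"
    by (subst integral_cbox_real2) (auto intro!: continuous_intros simp: mult_ac)
  also have "\<dots> \<le> integral ?C (\<lambda>u. integral slice_domain (?f u))"
  proof (rule integral_le)
    show "(\<lambda>u. 2 * pi * (\<rho> + (1 - \<rho>) * (u$1)^2)) integrable_on ?C"
      by (intro integrable_continuous continuous_intros)
    show "(\<lambda>u. integral slice_domain (?f u)) integrable_on ?C" by (rule integrable_continuous[OF cfC])
    fix u :: "real^2" assume "u \<in> ?C"
    then have "\<bar>u$1\<bar> \<le> 1" unfolding cbox_vector2 by auto
    then have "2 * pi * (\<rho> + (1 - \<rho>) * (u$1)^2) \<le> 2 * pi * norm (stretch \<rho> (cyc u))"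
      using norm_stretch_cyc_ge[OF _ \<rho>] by simp
    also have "\<dots> \<le> integral slice_domain (?f u)" by (rule lower)
    finally show "2 * pi * (\<rho> + (1 - \<rho>) * (u$1)^2) \<le> integral slice_domain (?f u)" .
  qed
  also have "\<dots> = integral slice_domain (\<lambda>p. integral ?C (\<lambda>u. ?f u p))"
    unfolding slice_domain_eq
    by (rule integral_swap_continuous) (use cf in \<open>simp add: slice_domain_eq cbox_Pair_eq\<close>)
  also have "\<dots> \<le> integral slice_domain (\<lambda>p. 2 * pi * norm (stretch \<rho> (n p)))"
  proof (rule integral_le)
    show "(\<lambda>p. integral ?C (\<lambda>u. ?f u p)) integrable_on slice_domain"
      using cfD unfolding slice_domain_eq by (rule integrable_continuous)
    have "continuous_on slice_domain (\<lambda>p. 2 * pi * norm (stretch \<rho> (n p)))"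
      by (intro continuous_intros continuous_on_stretch cn)
    then show "(\<lambda>p. 2 * pi * norm (stretch \<rho> (n p))) integrable_on slice_domain"
      unfolding slice_domain_eq by (rule integrable_continuous)
    show "integral ?C (\<lambda>u. ?f u p) \<le> 2 * pi * norm (stretch \<rho> (n p))" for p
      unfolding sym by (rule cyclic_average_le)
  qed
  also have "\<dots> = 2 * pi * integral slice_domain (\<lambda>p. norm (stretch \<rho> (n p)))" by simp
  finally show ?thesis by simp
qed

section \<open>Diffeomorphisms of the sphere\<close>

text \<open>Two unfoldings of the coinductive predicate: the first makes the partial derivatives
  smooth, the second makes them differentiable, hence continuous.\<close>

lemma smooth_on_C1:
  assumes "smooth_on U f" "open U"
  shows "x \<in> U \<Longrightarrow> f differentiable (at x)"
    and "i \<in> Basis \<Longrightarrow> continuous_on U (\<lambda>x. frechet_derivative f (at x) i)"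
proof -
  have 1: "g differentiable_on U" if "smooth_on U g" for g
    using that by (cases rule: smooth_on.cases) auto
  have 2: "smooth_on U (\<lambda>x. frechet_derivative f (at x) i)" if "i \<in> Basis" for i
    using assms(1) that by (cases rule: smooth_on.cases) auto
  show "f differentiable (at x)" if "x \<in> U"
    using 1[OF assms(1)] that assms(2) by (simp add: differentiable_on_eq_differentiable_at)
  show "continuous_on U (\<lambda>x. frechet_derivative f (at x) i)" if "i \<in> Basis"
    using 1[OF 2[OF that]] by (rule differentiable_imp_continuous_on)
qed

lemma smooth_map_on_C1:
  assumes "smooth_map_on U g"
  obtains g' where "\<And>x. x \<in> U \<Longrightarrow> (g has_derivative g' x) (at x)"
    "\<And>h. continuous_on U (\<lambda>x. g' x h)"
proof
  have U: "open U" and s: "\<And>b. b \<in> Basis \<Longrightarrow> smooth_on U (\<lambda>x. g x \<bullet> b)"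
    using assms by (auto simp: smooth_map_on_def)
  note C1 = smooth_on_C1[OF s U]
  let ?g' = "\<lambda>x. frechet_derivative g (at x)"
  show der: "(g has_derivative ?g' x) (at x)" if x: "x \<in> U" for x
  proof -
    have "g differentiable (at x)"
      using C1(1) x by (subst differentiable_componentwise_within) auto
    then show ?thesis by (simp add: frechet_derivative_works)
  qed
  show "continuous_on U (\<lambda>x. ?g' x h)" for h
  proof (subst continuous_on_componentwise, intro ballI)
    fix b :: 'b assume b: "b \<in> Basis"
    have "?g' x h \<bullet> b = (\<Sum>i\<in>Basis. (h \<bullet> i) * frechet_derivative (\<lambda>x. g x \<bullet> b) (at x) i)" if x: "x \<in> U" for x
    proof -
      have "((\<lambda>x. g x \<bullet> b) has_derivative (\<lambda>h. ?g' x h \<bullet> b)) (at x)"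
        using has_derivative_inner_left[OF der[OF x]] .
      then have eq: "frechet_derivative (\<lambda>x. g x \<bullet> b) (at x) = (\<lambda>h. ?g' x h \<bullet> b)"
        using frechet_derivative_at by metis
      have lin: "linear (?g' x)" using der[OF x] by (rule has_derivative_linear)
      have "?g' x h = ?g' x (\<Sum>i\<in>Basis. (h \<bullet> i) *\<^sub>R i)" by (simp add: euclidean_representation)
      also have "\<dots> = (\<Sum>i\<in>Basis. (h \<bullet> i) *\<^sub>R ?g' x i)" by (simp add: linear_sum[OF lin] linear_cmul[OF lin])
      finally show ?thesis unfolding eq by (simp add: inner_sum_left)
    qed
    moreover have "continuous_on U (\<lambda>x. \<Sum>i\<in>Basis. (h \<bullet> i) * frechet_derivative (\<lambda>x. g x \<bullet> b) (at x) i)"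
      by (intro continuous_intros C1(2) b)
    ultimately show "continuous_on U (\<lambda>x. ?g' x h \<bullet> b)" by (simp cong: continuous_on_cong)
  qed
qed

text \<open>Extending maps of the sphere by homogeneity makes a diffeomorphism of $S^3$ a
  diffeomorphism of the punctured space, whose derivative has a determinant.\<close>
definition hat :: "(real^4 \<Rightarrow> real^4) \<Rightarrow> real^4 \<Rightarrow> real^4" where
  "hat f x = norm x *\<^sub>R f (x /\<^sub>R norm x)"

lemma mem_S3: "x \<in> S3 \<longleftrightarrow> norm x = 1"
  by (simp add: S3_def)

lemma hat_S3: "x \<in> S3 \<Longrightarrow> hat f x = f x"
  by (simp add: hat_def mem_S3)

text \<open>w is split into a radial part, on which a map homogeneous of degree one acts through f
  x, and a tangential part, on which it acts through the derivative of the extension G.\<close>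

lemma has_derivative_hat:
  assumes G: "(G has_derivative G') (at x)" and x: "x \<in> S3" and eq: "\<And>y. y \<in> S3 \<Longrightarrow> f y = G y"
  shows "(hat f has_derivative (\<lambda>w. (x \<bullet> w) *\<^sub>R f x + G' (w - (x \<bullet> w) *\<^sub>R x))) (at x)"
proof -
  have x1: "norm x = 1" "x \<noteq> 0" using x by (auto simp: mem_S3)
  have dn: "(norm has_derivative (\<lambda>w. x \<bullet> w)) (at x)"
    using has_derivative_norm[OF x1(2)] x1 by (simp add: sgn_div_norm inner_commute)
  have di: "((\<lambda>y. y /\<^sub>R norm y) has_derivative (\<lambda>w. w - (x \<bullet> w) *\<^sub>R x)) (at x)"
    by (rule derivative_eq_intros dn refl | use x1 in simp)+
  have G1: "(G has_derivative G') (at (x /\<^sub>R norm x))" using G x1 by simp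
  have "((\<lambda>y. norm y *\<^sub>R G (y /\<^sub>R norm y)) has_derivative (\<lambda>w. (x \<bullet> w) *\<^sub>R G x + G' (w - (x \<bullet> w) *\<^sub>R x))) (at x)"
    using has_derivative_scaleR[OF dn has_derivative_compose[OF di G1]] x1 by (simp add: add.commute)
  then have "(hat f has_derivative (\<lambda>w. (x \<bullet> w) *\<^sub>R G x + G' (w - (x \<bullet> w) *\<^sub>R x))) (at x)"
  proof (rule has_derivative_transform_within_open)
    show "open (- {0::real^4})" by (rule open_Compl) simp
    show "x \<in> - {0}" using x1 by simp
    show "norm y *\<^sub>R G (y /\<^sub>R norm y) = hat f y" if "y \<in> - {0}" for y
      using that eq[of "y /\<^sub>R norm y"] by (simp add: hat_def mem_S3)
  qed
  then show ?thesis using eq[OF x] by simp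
qed

text \<open>The ambient extension of F is differentiable near the whole product, endpoints t = -1
  and t = 1 included. Joint continuity in (t, x) will make the area continuous in t.\<close>

lemma sweepout_C1:
  assumes "sweepout F"
  obtains D where "\<And>t x. t \<in> {-1..1} \<Longrightarrow> x \<in> S3 \<Longrightarrow> (hat (F t) has_derivative D t x) (at x)"
    "\<And>w. continuous_on ({-1..1} \<times> S3) (\<lambda>(t,x). D t x w)"
    "continuous_on ({-1..1} \<times> S3) (\<lambda>(t,x). F t x)"
    "\<And>t x. t \<in> {-1..1} \<Longrightarrow> x \<in> S3 \<Longrightarrow> D t x x = F t x"
proof -
  obtain U g where U: "{-1..1} \<times> S3 \<subseteq> U" and g: "smooth_map_on U g"
    and eq: "\<And>z. z \<in> {-1..1} \<times> S3 \<Longrightarrow> g z = (case z of (t,x) \<Rightarrow> F t x)"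
    using assms unfolding sweepout_def smooth_on_set_def by blast
  obtain g' where g': "\<And>z. z \<in> U \<Longrightarrow> (g has_derivative g' z) (at z)" "\<And>h. continuous_on U (\<lambda>z. g' z h)"
    using smooth_map_on_C1[OF g] by blast
  define D where "D t x w = (x \<bullet> w) *\<^sub>R F t x + g' (t,x) (0, w - (x \<bullet> w) *\<^sub>R x)" for t x w
  have 3: "continuous_on ({-1..1} \<times> S3) (\<lambda>(t,x). F t x)"
  proof -
    have "continuous_on U g" using g'(1) by (meson continuous_at_imp_continuous_on has_derivative_continuous)
    then have "continuous_on ({-1..1} \<times> S3) g" using U by (rule continuous_on_subset)
    then show ?thesis using eq by (simp cong: continuous_on_cong)
  qed
  have 1: "(hat (F t) has_derivative D t x) (at x)" if t: "t \<in> {-1..1}" and x: "x \<in> S3" for t x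
  proof -
    have "(t,x) \<in> U" using U t x by blast
    have "((\<lambda>y. (t,y)) has_derivative (\<lambda>w. (0,w))) (at x)" by (intro derivative_intros)
    from has_derivative_compose[OF this g'(1)[OF \<open>(t,x) \<in> U\<close>]]
    have "((\<lambda>y. g (t,y)) has_derivative (\<lambda>w. g' (t,x) (0,w))) (at x)" .
    from has_derivative_hat[OF this x, of "F t"] show ?thesis
      unfolding D_def using eq t by simp
  qed
  have 2: "continuous_on ({-1..1} \<times> S3) (\<lambda>(t,x). D t x w)" for w
  proof -
    have lin: "linear (g' z)" if "z \<in> {-1..1} \<times> S3" for z
      using g'(1) U that has_derivative_linear by blast
    \<comment> \<open>Continuity of g' is known for fixed directions only, so the varying tangential
      direction is expanded in the basis.\<close>
    have e: "g' z (0, w - (snd z \<bullet> w) *\<^sub>R snd z)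
        = (\<Sum>i\<in>Basis. ((w - (snd z \<bullet> w) *\<^sub>R snd z) \<bullet> i) *\<^sub>R g' z (0,i))" if z: "z \<in> {-1..1} \<times> S3" for z
    proof -
      let ?v = "w - (snd z \<bullet> w) *\<^sub>R snd z"
      define L where "L v = g' z (0,v)" for v
      have L: "linear L" unfolding L_def
        using linear_compose[OF _ lin[OF z], of "\<lambda>v. (0,v)"] by (simp add: o_def linear_iff)
      have "L ?v = L (\<Sum>i\<in>Basis. (?v \<bullet> i) *\<^sub>R i)" by (simp add: euclidean_representation)
      also have "\<dots> = (\<Sum>i\<in>Basis. (?v \<bullet> i) *\<^sub>R L i)" by (simp only: linear_sum[OF L] linear_cmul[OF L])
      finally show ?thesis by (simp only: L_def)
    qed
    have "continuous_on ({-1..1} \<times> S3) (\<lambda>z. (snd z \<bullet> w) *\<^sub>R (case z of (t,x) \<Rightarrow> F t x)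
        + (\<Sum>i\<in>Basis. ((w - (snd z \<bullet> w) *\<^sub>R snd z) \<bullet> i) *\<^sub>R g' z (0,i)))"
      by (intro continuous_intros 3 continuous_on_subset[OF g'(2) U])
    then show ?thesis
      by (rule continuous_on_eq) (auto simp: D_def e[simplified] split_def)
  qed
  have 4: "D t x x = F t x" if "t \<in> {-1..1}" "x \<in> S3" for t x
  proof -
    have "(t,x) \<in> U" using U that by blast
    then have "g' (t,x) (0,0) = 0"
      using has_derivative_linear[OF g'(1)] linear_0 zero_prod_def by metis
    then show ?thesis using that(2) unfolding D_def by (simp add: mem_S3 norm_eq_1)
  qed
  show ?thesis by (rule that[OF 1 2 3 4])
qed

lemma S3_diffeo_inverse_differentiable:
  assumes "S3_diffeo f" "y \<in> S3"
  shows "hat (inv_into S3 f) differentiable (at y)"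
proof -
  obtain U g where U: "S3 \<subseteq> U" and g: "smooth_map_on U g" and eq: "\<And>x. x \<in> S3 \<Longrightarrow> g x = inv_into S3 f x"
    using assms(1) unfolding S3_diffeo_def smooth_on_set_def by blast
  obtain g' where g': "\<And>z. z \<in> U \<Longrightarrow> (g has_derivative g' z) (at z)" "\<And>h. continuous_on U (\<lambda>z. g' z h)"
    using smooth_map_on_C1[OF g] by blast
  show ?thesis
    unfolding differentiable_def
  proof
    show "(hat (inv_into S3 f) has_derivative
       (\<lambda>w. (y \<bullet> w) *\<^sub>R inv_into S3 f y + g' y (w - (y \<bullet> w) *\<^sub>R y))) (at y)"
      by (rule has_derivative_hat[OF g'(1) assms(2)]) (use U assms(2) eq in auto)
  qed
qed

lemma hat_hat:
  assumes "\<And>x. x \<in> S3 \<Longrightarrow> f x \<in> S3" "\<And>x. x \<in> S3 \<Longrightarrow> g (f x) = x" "x \<noteq> 0"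
  shows "hat g (hat f x) = x"
proof -
  let ?u = "x /\<^sub>R norm x"
  have u: "?u \<in> S3" using assms(3) by (simp add: mem_S3)
  have n: "norm (f ?u) = 1" using assms(1)[OF u] by (simp add: mem_S3)
  then have "norm (hat f x) = norm x" by (simp add: hat_def)
  moreover have "hat f x /\<^sub>R norm x = f ?u" using assms(3) by (simp add: hat_def)
  ultimately show ?thesis unfolding hat_def[of g] using assms(2)[OF u] assms(3) by simp
qed

lemma det_nz_of_left_inverse:
  fixes A B :: "real^'n \<Rightarrow> real^'n"
  assumes "linear A" "\<And>w. B (A w) = w"
  shows "det (matrix A) \<noteq> 0"
  using assms det_nz_iff_inj[OF assms(1)] by (metis injI)

text \<open>The common interface for a single map of a sweep-out and for its compositions with
  orthogonal maps; \<open>D x x = f x\<close> is Euler's relation for the homogeneous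
  extension.\<close>

definition sphere_diffeo :: "(real^4 \<Rightarrow> real^4) \<Rightarrow> (real^4 \<Rightarrow> real^4 \<Rightarrow> real^4) \<Rightarrow> (real^4 \<Rightarrow> real^4) \<Rightarrow> bool" where
  "sphere_diffeo f D g \<longleftrightarrow>
     (\<forall>x\<in>S3. f x \<in> S3 \<and> g (f x) = x \<and> (hat f has_derivative D x) (at x) \<and> D x x = f x) \<and>
     (\<forall>w. continuous_on S3 (\<lambda>x. D x w)) \<and>
     (\<forall>y\<in>S3. g y \<in> S3 \<and> f (g y) = y \<and> hat g differentiable (at y))"

lemma sphere_diffeo_sweepout:
  assumes "sweepout F" "t \<in> {-1..1}"
    and "\<And>x. x \<in> S3 \<Longrightarrow> (hat (F t) has_derivative D x) (at x)"
    and "\<And>x. x \<in> S3 \<Longrightarrow> D x x = F t x"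
    and "\<And>w. continuous_on S3 (\<lambda>x. D x w)"
  shows "sphere_diffeo (F t) D (inv_into S3 (F t))"
proof -
  have d: "S3_diffeo (F t)" using assms(1,2) by (simp add: sweepout_def)
  then have bij: "bij_betw (F t) S3 S3" by (simp add: S3_diffeo_def)
  have "inv_into S3 (F t) y \<in> S3 \<and> F t (inv_into S3 (F t) y) = y" if "y \<in> S3" for y
    using bij that by (metis bij_betw_def f_inv_into_f inv_into_into)
  moreover have "F t x \<in> S3 \<and> inv_into S3 (F t) (F t x) = x" if "x \<in> S3" for x
    using bij that by (auto simp: bij_betw_def)
  ultimately show ?thesis
    unfolding sphere_diffeo_def using S3_diffeo_inverse_differentiable[OF d] assms(3-5) by blast
qed

text \<open>Orthogonal maps are linear and preserve norms, so they commute with homogeneous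
  extension. This serves to turn any Hopf direction into the standard one.\<close>

lemma sphere_diffeo_orthogonal:
  assumes f: "sphere_diffeo f D g" and R: "orthogonal_transformation R" "\<And>x. R' (R x) = x" "\<And>x. R (R' x) = x"
  shows "sphere_diffeo (\<lambda>x. R (f x)) (\<lambda>x w. R (D x w)) (\<lambda>y. g (R' y))"
proof -
  have lR: "bounded_linear R" using R(1) by (simp add: orthogonal_transformation_linear linear_linear)
  have R': "orthogonal_transformation R'"
  proof -
    have "linear R'" using linear_compose orthogonal_transformation_linear[OF R(1)] R(2,3)
      by (metis (no_types, opaque_lifting) linear_iff)
    moreover have "norm (R' x) = norm x" for x using R(1,3) by (metis orthogonal_transformation)
    ultimately show ?thesis by (simp add: orthogonal_transformation)
  qed
  have lR': "bounded_linear R'" using R' by (simp add: orthogonal_transformation_linear linear_linear)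
  have n: "norm (R x) = norm x" "norm (R' x) = norm x" for x using R(1) R' by (simp_all add: orthogonal_transformation)
  have h1: "hat (\<lambda>x. R (f x)) = (\<lambda>x. R (hat f x))"
    by (rule ext) (simp add: hat_def linear_simps[OF lR])
  have h2: "hat (\<lambda>y. g (R' y)) = (\<lambda>y. hat g (R' y))"
    by (rule ext) (simp add: hat_def linear_simps[OF lR'] n)
  have S: "R x \<in> S3 \<longleftrightarrow> x \<in> S3" "R' x \<in> S3 \<longleftrightarrow> x \<in> S3" for x by (simp_all add: mem_S3 n)
  have "hat (\<lambda>y. g (R' y)) differentiable (at y)" if "y \<in> S3" for y
  proof -
    have "hat g differentiable (at (R' y))" using f S that unfolding sphere_diffeo_def by blast
    moreover have "R' differentiable (at y)" using lR' by (rule bounded_linear_imp_differentiable)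
    ultimately show ?thesis unfolding h2 using differentiable_chain_at[of R' y "hat g"] by (simp add: o_def)
  qed
  moreover have "(hat (\<lambda>x. R (f x)) has_derivative (\<lambda>w. R (D x w))) (at x)" if "x \<in> S3" for x
    unfolding h1 using f that unfolding sphere_diffeo_def by (blast intro: bounded_linear.has_derivative[OF lR])
  moreover have "continuous_on S3 (\<lambda>x. R (D x w))" for w
  proof (rule bounded_linear.continuous_on[OF lR])
    show "continuous_on S3 (\<lambda>x. D x w)" using f unfolding sphere_diffeo_def by blast
  qed
  ultimately show ?thesis
    using f unfolding sphere_diffeo_def by (auto simp: S R)
qed

text \<open>The chain rule for \<open>hat g\<close> after \<open>hat f\<close> makes each D x
  invertible, and the sphere is connected. The sign records whether f preserves orientation.\<close>

lemma diffeo_det_sign: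
  assumes f: "sphere_diffeo f D g"
  obtains \<sigma> :: real where "\<bar>\<sigma>\<bar> = 1" "\<And>x. x \<in> S3 \<Longrightarrow> \<sigma> * det (matrix (D x)) > 0"
proof -
  let ?d = "\<lambda>x. det (matrix (D x))"
  have fS: "f x \<in> S3" and inv: "g (f x) = x" and D: "(hat f has_derivative D x) (at x)" if "x \<in> S3" for x
    using f that by (auto simp: sphere_diffeo_def)
  have cD: "continuous_on S3 (\<lambda>x. D x w)" for w using f by (auto simp: sphere_diffeo_def)
  have nz: "?d x \<noteq> 0" if x: "x \<in> S3" for x
  proof -
    obtain B where B: "(hat g has_derivative B) (at (f x))"
      using f fS[OF x] by (auto simp: sphere_diffeo_def differentiable_def)
    have x0: "x \<noteq> 0" using x by (auto simp: mem_S3)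
    have "((\<lambda>x. hat g (hat f x)) has_derivative (\<lambda>w. B (D x w))) (at x)"
      by (rule has_derivative_compose[OF D[OF x]]) (use B hat_S3[OF x] in simp)
    then have "((\<lambda>x. x) has_derivative (\<lambda>w. B (D x w))) (at x)"
    proof (rule has_derivative_transform_within_open)
      show "open (- {0::real^4})" by (rule open_Compl) simp
    qed (use x0 hat_hat[OF fS inv] in auto)
    then have "(\<lambda>w. B (D x w)) = (\<lambda>w. w)" using has_derivative_unique has_derivative_ident by blast
    then have "\<And>w. B (D x w) = w" by metis
    then show ?thesis
      using det_nz_of_left_inverse has_derivative_linear[OF D[OF x]] by blast
  qed
  have cont: "continuous_on S3 ?d"
    unfolding det_def matrix_def
    by (simp, intro continuous_intros cD)
  have "connected S3" unfolding S3_def by (rule connected_sphere) simp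
  then have con: "connected (?d ` S3)" using cont by (rule connected_continuous_image[rotated])
  have "(\<forall>x\<in>S3. ?d x > 0) \<or> (\<forall>x\<in>S3. ?d x < 0)"
  proof (rule ccontr)
    assume "\<not> ?thesis"
    then obtain x y where "x \<in> S3" "y \<in> S3" "?d x \<le> 0" "?d y \<ge> 0" by (auto simp: not_less)
    then have "0 \<in> ?d ` S3" using connectedD_interval[OF con, of "?d x" "?d y" 0] by blast
    then show False using nz by auto
  qed
  then show ?thesis
  proof
    assume "\<forall>x\<in>S3. ?d x > 0" then show ?thesis using that[of 1] by simp
  next
    assume "\<forall>x\<in>S3. ?d x < 0" then show ?thesis using that[of "-1"] by simp
  qed
qed

section \<open>Hopf fibrations\<close>

definition quad :: "real^4 \<Rightarrow> real^4 \<Rightarrow> real^4 \<Rightarrow> real^4 \<Rightarrow> real" where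
  "quad a b c d = det (vector [a,b,c,d] :: real^4^4)"

lemma det_4:
  "det (A::'a::comm_ring_1^4^4) =
     A$1$1 * (A$2$2 * (A$3$3 * A$4$4 - A$3$4 * A$4$3) - A$2$3 * (A$3$2 * A$4$4 - A$3$4 * A$4$2) + A$2$4 * (A$3$2 * A$4$3 - A$3$3 * A$4$2))
   - A$1$2 * (A$2$1 * (A$3$3 * A$4$4 - A$3$4 * A$4$3) - A$2$3 * (A$3$1 * A$4$4 - A$3$4 * A$4$1) + A$2$4 * (A$3$1 * A$4$3 - A$3$3 * A$4$1))
   + A$1$3 * (A$2$1 * (A$3$2 * A$4$4 - A$3$4 * A$4$2) - A$2$2 * (A$3$1 * A$4$4 - A$3$4 * A$4$1) + A$2$4 * (A$3$1 * A$4$2 - A$3$2 * A$4$1))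
   - A$1$4 * (A$2$1 * (A$3$2 * A$4$3 - A$3$3 * A$4$2) - A$2$2 * (A$3$1 * A$4$3 - A$3$3 * A$4$1) + A$2$3 * (A$3$1 * A$4$2 - A$3$2 * A$4$1))"
proof -
  have f: "finite {2::4,3,4}" "1 \<notin> {2::4,3,4}" "finite {3::4,4}" "2 \<notin> {3::4,4}" "finite {4::4}" "3 \<notin> {4::4}"
    by auto
  show ?thesis
    unfolding det_def UNIV_4
    unfolding sum_over_permutations_insert[OF f(1,2)]
    unfolding sum_over_permutations_insert[OF f(3,4)]
    unfolding sum_over_permutations_insert[OF f(5,6)]
    unfolding permutes_sing
    by (simp add: sign_swap_id permutation_swap_id permutation_compose sign_compose sign_id swap_id_eq algebra_simps)
qed

lemma quad_linear:
  assumes "linear A"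
  shows "quad (A a) (A b) (A c) (A d) = det (matrix A) * quad a b c d"
proof -
  have "(vector [A a, A b, A c, A d] :: real^4^4) = vector [a,b,c,d] ** transpose (matrix A)"
  proof -
    have "A v $ i = (\<Sum>k\<in>UNIV. v $ k * matrix A $ i $ k)" for v i
    proof -
      have "A v = matrix A *v v" using assms by (simp add: matrix_works)
      then show ?thesis by (simp only: matrix_vector_mult_def vec_lambda_beta mult.commute)
    qed
    then show ?thesis
      by (simp add: vec_eq_iff forall_4 vector_4 matrix_matrix_mult_def transpose_def)
  qed
  then show ?thesis unfolding quad_def by (simp add: det_mul det_transpose)
qed


definition hopf_j :: "real^4 \<Rightarrow> real^4" where
  "hopf_j x = vector [- x$3, x$4, x$1, - x$2]"

definition hopf_k :: "real^4 \<Rightarrow> real^4" where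
  "hopf_k x = vector [- x$4, - x$3, x$2, x$1]"

text \<open>The fields \<open>hopf_field\<close>, \<open>hopf_j\<close>, \<open>hopf_k\<close> are left multiplication by the quaternions $i$, $j$, $k$;
  the entries of \<open>normal\<close> are the coordinates in this frame of the area-weighted normal of the plane
  spanned by \<open>v\<close> and \<open>w\<close>.\<close>
definition normal :: "real^4 \<Rightarrow> real^4 \<Rightarrow> real^4 \<Rightarrow> real^3" where
  "normal x v w = vector
    [(v \<bullet> hopf_j x) * (w \<bullet> hopf_k x) - (v \<bullet> hopf_k x) * (w \<bullet> hopf_j x),
     (v \<bullet> hopf_k x) * (w \<bullet> hopf_field x) - (v \<bullet> hopf_field x) * (w \<bullet> hopf_k x),
     (v \<bullet> hopf_field x) * (w \<bullet> hopf_j x) - (v \<bullet> hopf_j x) * (w \<bullet> hopf_field x)]"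

text \<open>Left multiplication by the imaginary quaternion u; every unit u generates a Hopf
  fibration by great circles.\<close>

definition hopf_comb :: "real^3 \<Rightarrow> real^4 \<Rightarrow> real^4" where
  "hopf_comb u x = u$1 *\<^sub>R hopf_field x + u$2 *\<^sub>R hopf_j x + u$3 *\<^sub>R hopf_k x"

lemmas hopf_nth = hopf_field_def hopf_j_def hopf_k_def vector_4

text \<open>Expanding v and w in the orthogonal frame x, ix, jx, kx leaves two-by-two minors. So the
  component of the normal along u measures how the plane of v and w is crossed by the fibre of
  u.\<close>

lemma quad_normal: "quad x (hopf_comb u x) v w = u \<bullet> normal x v w"
  unfolding quad_def det_4 normal_def hopf_comb_def inner_3 inner_4
  by (simp add: hopf_nth, algebra)

lemma quad_normal_1: "quad x (hopf_field x) v w = normal x v w $ 1"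
  using quad_normal[of x "axis 1 1" v w] by (simp add: hopf_comb_def axis_def inner_axis' inner_3)

section \<open>The Hopf map to the two-sphere\<close>

text \<open>Normalised to have values in the unit sphere, while the Riemannian base has radius 1/2;
  areas are therefore multiplied by 4.\<close>

definition hopf_map :: "real^4 \<Rightarrow> real^3" where
  "hopf_map x = vector [2 * (x$1 * x$3 + x$2 * x$4), 2 * (x$1 * x$4 - x$2 * x$3),
     (x$1)^2 + (x$2)^2 - (x$3)^2 - (x$4)^2]"

definition hopf_map_deriv :: "real^4 \<Rightarrow> real^4 \<Rightarrow> real^3" where
  "hopf_map_deriv x h = vector [2 * (h$1 * x$3 + x$1 * h$3 + h$2 * x$4 + x$2 * h$4),
     2 * (h$1 * x$4 + x$1 * h$4 - h$2 * x$3 - x$2 * h$3),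
     2 * (x$1 * h$1 + x$2 * h$2 - x$3 * h$3 - x$4 * h$4)]"

lemma has_derivative_hopf_map: "(hopf_map has_derivative hopf_map_deriv x) (at x)"
proof (rule has_derivative_vecI)
  fix i :: 3
  have "i = 1 \<or> i = 2 \<or> i = 3" using exhaust_3 by blast
  then show "((\<lambda>x. hopf_map x $ i) has_derivative (\<lambda>h. hopf_map_deriv x h $ i)) (at x)"
    by (elim disjE) (auto simp: hopf_map_def hopf_map_deriv_def algebra_simps intro!: derivative_eq_intros has_derivative_vec_nth)
qed

lemma norm_eq_1_4: "norm (x::real^4) = 1 \<longleftrightarrow> (x$1)^2 + (x$2)^2 + (x$3)^2 + (x$4)^2 = 1"
  by (simp add: norm_eq_1 inner_4 power2_eq_square)

lemma hopf_map_unit: "norm x = 1 \<Longrightarrow> norm (hopf_map x) = 1"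
  unfolding norm_eq_1_3 norm_eq_1_4 hopf_map_def vector_3 by algebra

lemma hopf_map_surj:
  assumes "norm v = 1"
  shows "\<exists>x\<in>S3. hopf_map x = v"
proof -
  obtain p where p: "v = sph p" "p \<in> slice_domain" using sph_surj[OF assms] by blast
  \<comment> \<open>Halving the polar angle gives the preimage whose first complex coordinate is
    real.\<close>
  define x :: "real^4" where "x = vector [cos (p$1/2), 0, sin (p$1/2) * cos (p$2), sin (p$1/2) * sin (p$2)]"
  have c: "cos (p$1) = (cos (p$1/2))^2 - (sin (p$1/2))^2" "sin (p$1) = 2 * sin (p$1/2) * cos (p$1/2)"
    using cos_double[of "p$1/2"] sin_double[of "p$1/2"] by simp_all
  have "norm x = 1" unfolding norm_eq_1_4 x_def vector_4 zero_power2
    using sin_cos_squared_add[of "p$1/2"] sin_cos_squared_add[of "p$2"] by algebra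
  moreover have "hopf_map x = v"
    unfolding hopf_map_def p(1) sph_def vec_eq_iff forall_3 vector_3 x_def vector_4 c zero_power2
    by simp (use sin_cos_squared_add[of "p$2"] in algebra)
  ultimately show ?thesis by (auto simp: mem_S3)
qed

lemma hopf_map_fibre:
  "hopf_map (cos s *\<^sub>R x + sin s *\<^sub>R hopf_field x) = hopf_map x"
  unfolding hopf_map_def vec_eq_iff forall_3 vector_3
  by (simp add: hopf_nth) (use sin_cos_squared_add[of s] in \<open>intro conjI; algebra\<close>)

text \<open>The derivative kills the Hopf direction, so only the components along jx and kx count;
  their images P and Q are orthogonal of length 2, whence the factor 4.\<close>

lemma triple_hopf_map:
  assumes "norm x = 1" "x \<bullet> v = 0" "x \<bullet> w = 0"
  shows "\<bar>triple (hopf_map x) (hopf_map_deriv x v) (hopf_map_deriv x w)\<bar> = 4 * \<bar>normal x v w $ 1\<bar>"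
proof -
  define P Q where "P = hopf_map_deriv x (hopf_j x)" and "Q = hopf_map_deriv x (hopf_k x)"
  have x: "(x$1)^2 + (x$2)^2 + (x$3)^2 + (x$4)^2 = 1" using assms(1) norm_eq_1_4 by blast
  have d: "hopf_map_deriv x v = (v \<bullet> hopf_j x) *\<^sub>R P + (v \<bullet> hopf_k x) *\<^sub>R Q" if "x \<bullet> v = 0" for v
    using that x unfolding inner_4 P_def Q_def hopf_map_deriv_def vec_eq_iff forall_3
    by (simp add: hopf_nth) (intro conjI; algebra)
  have T: "triple (hopf_map x) P Q = 4 \<or> triple (hopf_map x) P Q = - 4"
    using x unfolding triple_eq P_def Q_def hopf_map_deriv_def hopf_map_def vector_3 hopf_nth by algebra
  have "triple (hopf_map x) (hopf_map_deriv x v) (hopf_map_deriv x w)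
    = ((v \<bullet> hopf_j x) * (w \<bullet> hopf_k x) - (v \<bullet> hopf_k x) * (w \<bullet> hopf_j x)) * triple (hopf_map x) P Q"
    unfolding d[OF assms(2)] d[OF assms(3)] triple_eq by simp algebra
  then show ?thesis using T unfolding normal_def by (auto simp: abs_mult)
qed


section \<open>Signed crossings of a slice with the fibres\<close>

text \<open>If f' were negative at all zeros, f would be negative just after s0 and vanish again
  within a period. The first such zero would also be crossed downwards, so f would be positive just
  before it and vanish even earlier.\<close>

lemma periodic_zero_upcrossing:
  fixes f f' :: "real \<Rightarrow> real"
  assumes der: "\<And>s. (f has_real_derivative f' s) (at s)"
    and per: "\<And>s. f (s + T) = f s" and T: "T > 0" and zero: "f s0 = 0"
  shows "\<exists>s. f s = 0 \<and> f' s \<ge> 0"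
proof (rule ccontr)
  assume "\<not> ?thesis"
  then have neg: "f' s < 0" if "f s = 0" for s using that by (meson not_less)
  have cont: "continuous_on A f" for A
    using der by (meson DERIV_isCont continuous_at_imp_continuous_on)
  obtain d where d: "d > 0" "\<And>h. 0 < h \<Longrightarrow> h < d \<Longrightarrow> f (s0 + h) < f s0"
    using DERIV_neg_dec_right[OF der neg[OF zero]] by blast
  \<comment> \<open>A point just after \<open>s0\<close>, still within one period, where f is
    negative.\<close>
  define a where "a = s0 + min (d/2) (T/2)"
  have a: "s0 < a" "a < s0 + T" "f a < 0" using d(1) d(2)[of "min (d/2) (T/2)"] T zero by (auto simp: a_def)
  let ?Z = "{s\<in>{a..s0+T}. f s = 0}"
  have "closed ?Z" using continuous_closed_preimage[OF cont[of "{a..s0+T}"] closed_real_atLeastAtMost closed_singleton[of 0]]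
    by (simp add: vimage_def Int_def conj_commute)
  moreover have "?Z \<noteq> {}" using a per[of s0] zero by auto
  moreover have bdd: "bdd_below ?Z" by (rule bdd_belowI[of _ a]) auto
  ultimately have Z: "Inf ?Z \<in> ?Z" by (intro closed_contains_Inf)
  \<comment> \<open>The first zero after \<open>a\<close>; it exists because the zero set is closed
    and contains s0 + T.\<close>
  define b where "b = Inf ?Z"
  have b: "a < b" "f b = 0" "b \<le> s0 + T" using Z a(3) unfolding b_def[symmetric] by (auto simp: less_le)
  obtain e where e: "e > 0" "\<And>h. 0 < h \<Longrightarrow> h < e \<Longrightarrow> f b < f (b - h)"
    using DERIV_neg_dec_left[OF der neg[OF b(2)]] by blast
  define h where "h = min (e/2) ((b - a)/2)"
  have "0 < h" using e(1) b(1) by (simp add: h_def)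
  moreover have "h \<le> e/2" "h \<le> (b - a)/2" unfolding h_def by (rule min.cobounded1 min.cobounded2)+
  ultimately have h: "0 < h" "h < e" "a < b - h" using e(1) b(1) by (auto simp: field_simps)
  then have "f (b - h) > 0" using e(2) b(2) by fastforce
  then obtain s where s: "a \<le> s" "s \<le> b - h" "f s = 0"
    using IVT'[of f a 0 "b - h"] a(3) h(3) cont by (metis less_imp_le)
  then have "s \<in> ?Z" using h b by auto
  then have "b \<le> s" unfolding b_def using bdd by (rule cInf_lower)
  then show False using s h by linarith
qed

definition slice_deriv :: "real \<Rightarrow> real^2 \<Rightarrow> real^2 \<Rightarrow> real^4" where
  "slice_deriv t p h = vector [sqrt (1 - t^2) * sph_deriv p h $ 1, sqrt (1 - t^2) * sph_deriv p h $ 2,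
     sqrt (1 - t^2) * sph_deriv p h $ 3, 0]"

lemma slice_param_sph: "slice_param t p = vector [sqrt (1 - t^2) * sph p $ 1, sqrt (1 - t^2) * sph p $ 2,
     sqrt (1 - t^2) * sph p $ 3, t]"
  by (simp add: slice_param_def sph_def mult.assoc)

lemma has_derivative_slice_param: "(slice_param t has_derivative slice_deriv t p) (at p)"
proof (rule has_derivative_vecI)
  fix i :: 4
  have "i = 1 \<or> i = 2 \<or> i = 3 \<or> i = 4" using exhaust_4 by blast
  then show "((\<lambda>p. slice_param t p $ i) has_derivative (\<lambda>h. slice_deriv t p h $ i)) (at p)"
    unfolding slice_param_sph slice_deriv_def
    by (elim disjE) (auto simp: vector_4 intro!: derivative_eq_intros has_derivative_vec_nth has_derivative_sph)
qed

lemma slice_param_S3: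
  assumes "\<bar>t\<bar> \<le> 1"
  shows "slice_param t p \<in> S3"
proof -
  have "(sqrt (1 - t^2))^2 = 1 - t^2" using assms by (simp add: abs_square_le_1)
  moreover have "(sph p $ 1)^2 + (sph p $ 2)^2 + (sph p $ 3)^2 = 1" using sph_unit norm_eq_1_3 by blast
  ultimately show ?thesis unfolding mem_S3 norm_eq_1_4 slice_param_sph vector_4 by algebra
qed

lemma slice_param_surj:
  assumes "x \<in> S3" "x$4 = t" "-1 < t" "t < 1"
  shows "\<exists>p\<in>slice_domain. x = slice_param t p"
proof -
  have t: "1 - t^2 > 0" using assms(3,4) by (simp add: abs_square_less_1)
  define r where "r = sqrt (1 - t^2)"
  have r: "r > 0" "r^2 = 1 - t^2" using t by (auto simp: r_def)
  have "(x$1)^2 + (x$2)^2 + (x$3)^2 = r^2" using assms(1,2) r unfolding mem_S3 norm_eq_1_4 by simp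
  then have "norm (vector [x$1/r, x$2/r, x$3/r] :: real^3) = 1"
    unfolding norm_eq_1_3 vector_3 using r(1) by (simp add: power_divide add_divide_distrib[symmetric])
  then obtain p where p: "p \<in> slice_domain" "vector [x$1/r, x$2/r, x$3/r] = sph p" using sph_surj by metis
  have "x = slice_param t p" unfolding slice_param_sph p(2)[symmetric] vec_eq_iff forall_4 vector_4
    using assms(2) r(1) by (simp add: r_def[symmetric])
  then show ?thesis using p(1) by blast
qed

text \<open>With r = sqrt (1 - t^2), n = sph p and w' the first three entries of w, the determinant
  is r^2 sin (p$1) (r w$4 - t n . w'), and orthogonality gives r n . w' = - t w$4. So the vertical
  component of w decides the sign.\<close>

lemma quad_slice:
  assumes "\<bar>t\<bar> < 1" "w \<bullet> slice_param t p = 0"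
  shows "quad (slice_param t p) w (slice_deriv t p (axis 1 1)) (slice_deriv t p (axis 2 1))
    = sqrt (1 - t^2) * sin (p$1) * w$4"
proof -
  define r where "r = sqrt (1 - t^2)"
  have r: "r^2 = 1 - t^2" using assms(1) by (simp add: r_def abs_square_le_1)
  define n a b where "n = sph p" and "a = sph_deriv p (axis 1 1)" and "b = sph_deriv p (axis 2 1)"
  have n: "(n$1)^2 + (n$2)^2 + (n$3)^2 = 1" unfolding n_def using sph_unit norm_eq_1_3 by blast
  have c: "a$2 * b$3 - a$3 * b$2 = sin (p$1) * n$1" "a$3 * b$1 - a$1 * b$3 = sin (p$1) * n$2"
     "a$1 * b$2 - a$2 * b$1 = sin (p$1) * n$3"
    unfolding a_def b_def n_def sph_deriv_def sph_def vector_3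
    by (simp_all add: axis_def power2_eq_square) (use sin_cos_squared_add[of "p$2"] in algebra)+
  have "w$1 * (r * n$1) + w$2 * (r * n$2) + w$3 * (r * n$3) + w$4 * t = 0"
    using assms(2) unfolding inner_4 slice_param_sph vector_4 r_def n_def .
  then show ?thesis
    unfolding quad_def det_4 vector_4 slice_param_sph slice_deriv_def
      r_def[symmetric] n_def[symmetric] a_def[symmetric] b_def[symmetric]
    using n c r by algebra
qed


lemma hopf_nth_orth:
  "hopf_field x \<bullet> hopf_field x = x \<bullet> x" "x \<bullet> hopf_field x = 0"
  by (simp_all add: inner_4 hopf_nth)

lemma linear_hopf_field: "linear hopf_field"
  by (rule linearI) (simp_all add: vec_eq_iff forall_4 hopf_nth)

lemma orthonormal_hopf: "x \<in> S3 \<Longrightarrow> orthonormal_pair x (hopf_field x)"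
  using hopf_nth_orth[of x] by (simp add: orthonormal_pair_def mem_S3 norm_eq_1)

definition slice_normal :: "(real^4 \<Rightarrow> real^4) \<Rightarrow> (real^4 \<Rightarrow> real^4 \<Rightarrow> real^4) \<Rightarrow> real \<Rightarrow> real^2 \<Rightarrow> real^3" where
  "slice_normal f D t p = normal (f (slice_param t p))
     (D (slice_param t p) (slice_deriv t p (axis 1 1))) (D (slice_param t p) (slice_deriv t p (axis 2 1)))"

text \<open>Along a fibre the height function composed with the inverse diffeomorphism is periodic, so
  when it vanishes somewhere it crosses zero both upwards and downwards (possibly tangentially).\<close>
lemma fibre_crossing:
  assumes f: "sphere_diffeo f D g" and t: "-1 < t" "t < 1"
    and meets: "\<exists>x\<in>S3. x$4 = t \<and> f x \<in> great_circle x0 (hopf_field x0)"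
    and x0: "x0 \<in> S3" and e: "\<bar>\<epsilon>::real\<bar> = 1"
  shows "\<exists>p\<in>slice_domain. hopf_map (f (slice_param t p)) = hopf_map x0 \<and> 0 \<le> \<epsilon> * slice_normal f D t p $ 1"
proof -
  obtain \<sigma> where s: "\<bar>\<sigma>\<bar> = 1" "\<And>x. x \<in> S3 \<Longrightarrow> \<sigma> * det (matrix (D x)) > 0"
    using diffeo_det_sign[OF f] by blast
  have fS: "f x \<in> S3" "g (f x) = x" "(hat f has_derivative D x) (at x)" "D x x = f x" if "x \<in> S3" for x
    using f that by (auto simp: sphere_diffeo_def)
  have gS: "g y \<in> S3" "f (g y) = y" "hat g differentiable (at y)" if "y \<in> S3" for y
    using f that by (auto simp: sphere_diffeo_def)
  define c where "c s = cos s *\<^sub>R x0 + sin s *\<^sub>R hopf_field x0" for s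
  have cS: "c s \<in> S3" for s
    using great_circle_subset_S3[OF orthonormal_hopf[OF x0]] by (auto simp: c_def great_circle_def)
  have hc: "hopf_field (c s) = cos s *\<^sub>R hopf_field x0 - sin s *\<^sub>R x0" for s
    by (simp add: c_def vec_eq_iff forall_4 hopf_nth)
  have dc: "(c has_vector_derivative hopf_field (c s)) (at s)" for s
    unfolding hc unfolding c_def by (auto intro!: derivative_eq_intros)
  define w where "w s = frechet_derivative (hat g) (at (c s)) (hopf_field (c s))" for s
  define \<gamma> where "\<gamma> s = g (c s)" for s
  have \<gamma>S: "\<gamma> s \<in> S3" "f (\<gamma> s) = c s" for s unfolding \<gamma>_def using gS cS by auto
  have d\<gamma>: "(\<gamma> has_vector_derivative w s) (at s)" for s
  proof -
    have "(hat g has_derivative frechet_derivative (hat g) (at (c s))) (at (c s))"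
      using gS(3)[OF cS] by (simp add: frechet_derivative_works)
    then have "((hat g \<circ> c) has_vector_derivative w s) (at s)"
      unfolding w_def by (intro vector_derivative_diff_chain_within[OF dc]) (simp add: has_derivative_at_withinI)
    moreover have "hat g \<circ> c = \<gamma>" using hat_S3[OF cS] by (auto simp: \<gamma>_def)
    ultimately show ?thesis by simp
  qed
  have Dw: "D (\<gamma> s) (w s) = hopf_field (c s)" for s
  proof -
    have "((hat f \<circ> \<gamma>) has_vector_derivative D (\<gamma> s) (w s)) (at s)"
      by (rule vector_derivative_diff_chain_within[OF d\<gamma> has_derivative_at_withinI[OF fS(3)[OF \<gamma>S(1)]]])
    moreover have "hat f \<circ> \<gamma> = c" using hat_S3[OF \<gamma>S(1)] \<gamma>S(2) by auto
    ultimately show ?thesis using dc vector_derivative_unique_at by metis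
  qed
  have w\<gamma>: "w s \<bullet> \<gamma> s = 0" for s
  proof -
    have "((\<lambda>s. \<gamma> s \<bullet> \<gamma> s) has_vector_derivative (\<gamma> s \<bullet> w s + w s \<bullet> \<gamma> s)) (at s)"
      using bounded_bilinear.has_vector_derivative[OF bounded_bilinear_inner d\<gamma> d\<gamma>] .
    moreover have "(\<lambda>s. \<gamma> s \<bullet> \<gamma> s) = (\<lambda>s. 1)" using \<gamma>S(1) by (simp add: mem_S3 norm_eq_1)
    ultimately have "\<gamma> s \<bullet> w s + w s \<bullet> \<gamma> s = 0"
      using vector_derivative_unique_at has_vector_derivative_const by metis
    then show ?thesis by (simp add: inner_commute)
  qed
  have nz: "\<epsilon> * \<sigma> \<noteq> 0" using e s(1) by auto
  \<comment> \<open>The height is multiplied by both signs: the orientation sign \<sigma> will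
    cancel that of the determinant of D, so that an upward crossing of the product gives the
    prescribed sign \<epsilon>.\<close>
  have "\<exists>s. \<epsilon> * \<sigma> * (\<gamma> s $ 4 - t) = 0 \<and> \<epsilon> * \<sigma> * (w s $ 4) \<ge> 0"
  proof -
    obtain x where x: "x \<in> S3" "x$4 = t" "f x \<in> great_circle x0 (hopf_field x0)" using meets by blast
    then obtain s0 where s0: "f x = c s0" by (auto simp: great_circle_def c_def)
    then have "\<gamma> s0 = x" unfolding \<gamma>_def using fS(2)[OF x(1)] by metis
    then have z: "\<epsilon> * \<sigma> * (\<gamma> s0 $ 4 - t) = 0" using x(2) by simp
    show ?thesis
    proof (rule periodic_zero_upcrossing[where f="\<lambda>s. \<epsilon> * \<sigma> * (\<gamma> s $ 4 - t)"
          and f'="\<lambda>s. \<epsilon> * \<sigma> * w s $ 4" and T="2 * pi"])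
      show "((\<lambda>s. \<epsilon> * \<sigma> * (\<gamma> s $ 4 - t)) has_real_derivative \<epsilon> * \<sigma> * w s $ 4) (at s)" for s
      proof -
        have "((\<lambda>s. \<gamma> s $ 4) has_real_derivative w s $ 4) (at s)"
          using bounded_linear.has_vector_derivative[OF bounded_linear_vec_nth d\<gamma>]
          by (simp add: has_real_derivative_iff_has_vector_derivative)
        then show ?thesis by (auto intro!: derivative_eq_intros)
      qed
      show "\<epsilon> * \<sigma> * (\<gamma> (s + 2 * pi) $ 4 - t) = \<epsilon> * \<sigma> * (\<gamma> s $ 4 - t)" for s
        by (simp add: \<gamma>_def c_def)
      show "\<epsilon> * \<sigma> * (\<gamma> s0 $ 4 - t) = 0" by (rule z)
    qed simp
  qed
  then obtain s1 where s1: "\<gamma> s1 $ 4 = t" "\<epsilon> * \<sigma> * (w s1 $ 4) \<ge> 0" using nz by auto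
  obtain p where p: "p \<in> slice_domain" "\<gamma> s1 = slice_param t p"
    using slice_param_surj[OF \<gamma>S(1) s1(1) t] by blast
  let ?x = "slice_param t p"
  have xS: "?x \<in> S3" and fx: "f ?x = c s1" using \<gamma>S p(2) by metis+
  have lD: "linear (D ?x)" using fS(3)[OF xS] by (rule has_derivative_linear)
  have "slice_normal f D t p $ 1 = quad (f ?x) (hopf_field (f ?x)) (D ?x (slice_deriv t p (axis 1 1))) (D ?x (slice_deriv t p (axis 2 1)))"
    unfolding slice_normal_def quad_normal_1 ..
  \<comment> \<open>Base point and Hopf vector are themselves images under D ?x, by Euler's relation
    and \<open>Dw\<close>, so the determinant of D ?x factors out.\<close>
  also have "\<dots> = quad (D ?x ?x) (D ?x (w s1)) (D ?x (slice_deriv t p (axis 1 1))) (D ?x (slice_deriv t p (axis 2 1)))"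
    using fS(4)[OF xS] Dw[of s1] p(2) fx by simp
  also have "\<dots> = det (matrix (D ?x)) * (sqrt (1 - t^2) * sin (p$1) * w s1 $ 4)"
    unfolding quad_linear[OF lD] using quad_slice[of t "w s1" p] w\<gamma>[of s1] t p(2) by (simp add: abs_less_iff)
  finally have N: "slice_normal f D t p $ 1 = det (matrix (D ?x)) * (sqrt (1 - t^2) * sin (p$1) * w s1 $ 4)" .
  have "\<sigma> * \<sigma> = 1" using s(1) by (metis abs_mult_self_eq mult_1)
  then have "\<epsilon> * slice_normal f D t p $ 1 = (\<sigma> * det (matrix (D ?x))) * (sqrt (1 - t^2) * sin (p$1)) * (\<epsilon> * \<sigma> * w s1 $ 4)"
    unfolding N by algebra
  also have "\<dots> \<ge> 0"
  proof -
    have "0 \<le> \<sigma> * det (matrix (D ?x))" using s(2)[OF xS] by simp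
    moreover have "0 \<le> sqrt (1 - t^2)" using t by (simp add: abs_square_le_1)
    moreover have "0 \<le> sin (p$1)" using p(1) by (intro sin_ge_zero) (auto simp: mem_slice_domain)
    ultimately show ?thesis using s1(2) by (simp only: mult_nonneg_nonneg)
  qed
  finally have "0 \<le> \<epsilon> * slice_normal f D t p $ 1" .
  moreover have "hopf_map (f ?x) = hopf_map x0" unfolding fx c_def by (rule hopf_map_fibre)
  ultimately show ?thesis using p(1) by blast
qed


section \<open>Regularity of the parametrised slices\<close>

lemma continuous_on_linear_family:
  fixes D :: "'b::topological_space \<Rightarrow> real^4 \<Rightarrow> 'c::real_normed_vector"
  assumes lin: "\<And>x. x \<in> A \<Longrightarrow> linear (D x)" and D: "\<And>w. continuous_on A (\<lambda>x. D x w)" and v: "continuous_on A v"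
  shows "continuous_on A (\<lambda>x. D x (v x))"
proof -
  have "D x (v x) = (\<Sum>i\<in>UNIV. v x $ i *\<^sub>R D x (axis i 1))" if "x \<in> A" for x
  proof -
    have "v x = (\<Sum>i\<in>UNIV. v x $ i *\<^sub>R axis i 1)" by (simp add: vec_eq_iff forall_4 sum_4 axis_def)
    then have "D x (v x) = D x (\<Sum>i\<in>UNIV. v x $ i *\<^sub>R axis i 1)" by simp
    then show ?thesis by (simp only: linear_sum[OF lin[OF that]] linear_cmul[OF lin[OF that]])
  qed
  moreover have "continuous_on A (\<lambda>x. \<Sum>i\<in>UNIV. v x $ i *\<^sub>R D x (axis i 1))"
    by (intro continuous_intros v D)
  ultimately show ?thesis by (simp cong: continuous_on_cong)
qed

lemma continuous_on_sph_deriv: "continuous_on A (\<lambda>p. sph_deriv p h)"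
proof (rule continuous_on_vec_nthI)
  fix i :: 3
  have "i = 1 \<or> i = 2 \<or> i = 3" using exhaust_3 by blast
  then show "continuous_on A (\<lambda>p. sph_deriv p h $ i)"
    by (elim disjE) (auto simp: sph_deriv_def intro!: continuous_intros)
qed

lemma continuous_on_slice_deriv:
  assumes "continuous_on A T" "continuous_on A P"
  shows "continuous_on A (\<lambda>z. slice_deriv (T z) (P z) h)"
proof (rule continuous_on_vec_nthI)
  fix i :: 4
  have "i = 1 \<or> i = 2 \<or> i = 3 \<or> i = 4" using exhaust_4 by blast
  then show "continuous_on A (\<lambda>z. slice_deriv (T z) (P z) h $ i)"
    by (elim disjE) (simp_all add: slice_deriv_def vector_4,
      auto intro!: continuous_intros assms continuous_on_compose2[OF continuous_on_sph_deriv[of UNIV] assms(2)])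
qed

lemma continuous_on_sph: "continuous_on A sph"
  using has_derivative_sph by (meson continuous_at_imp_continuous_on has_derivative_continuous)

lemma continuous_on_slice_param:
  assumes "continuous_on A T" "continuous_on A P"
  shows "continuous_on A (\<lambda>z. slice_param (T z) (P z))"
proof (rule continuous_on_vec_nthI)
  fix i :: 4
  have "i = 1 \<or> i = 2 \<or> i = 3 \<or> i = 4" using exhaust_4 by blast
  then show "continuous_on A (\<lambda>z. slice_param (T z) (P z) $ i)"
    by (elim disjE) (simp_all add: slice_param_sph vector_4,
      auto intro!: continuous_intros assms continuous_on_compose2[OF continuous_on_sph[of UNIV] assms(2)])
qed

lemma continuous_on_normal:
  assumes "continuous_on A x" "continuous_on A v" "continuous_on A w"
  shows "continuous_on A (\<lambda>z. normal (x z) (v z) (w z))"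
proof (rule continuous_on_vec_nthI)
  have h: "continuous_on A (\<lambda>z. hopf_field (x z))" "continuous_on A (\<lambda>z. hopf_j (x z))" "continuous_on A (\<lambda>z. hopf_k (x z))"
  proof -
    have "continuous_on A (\<lambda>z. hopf_field (x z) $ i)" "continuous_on A (\<lambda>z. hopf_j (x z) $ i)"
      "continuous_on A (\<lambda>z. hopf_k (x z) $ i)" for i
    proof -
      have i: "i = 1 \<or> i = 2 \<or> i = 3 \<or> i = 4" using exhaust_4 by blast
      show "continuous_on A (\<lambda>z. hopf_field (x z) $ i)" "continuous_on A (\<lambda>z. hopf_j (x z) $ i)"
        "continuous_on A (\<lambda>z. hopf_k (x z) $ i)"
        using i by (elim disjE; simp add: hopf_nth; intro continuous_intros assms(1))+
    qed
    then show "continuous_on A (\<lambda>z. hopf_field (x z))" "continuous_on A (\<lambda>z. hopf_j (x z))" "continuous_on A (\<lambda>z. hopf_k (x z))"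
      by (auto intro: continuous_on_vec_nthI)
  qed
  fix i :: 3
  have "i = 1 \<or> i = 2 \<or> i = 3" using exhaust_3 by blast
  then show "continuous_on A (\<lambda>z. normal (x z) (v z) (w z) $ i)"
    by (elim disjE) (auto simp: normal_def intro!: continuous_intros assms h)
qed

lemma has_derivative_slice:
  assumes f: "sphere_diffeo f D g" and t: "\<bar>t\<bar> \<le> 1"
  shows "((f \<circ> slice_param t) has_derivative (\<lambda>h. D (slice_param t p) (slice_deriv t p h))) (at p)"
proof -
  have "(hat f has_derivative D (slice_param t p)) (at (slice_param t p))"
    using f slice_param_S3[OF t] by (auto simp: sphere_diffeo_def)
  from has_derivative_compose[OF has_derivative_slice_param this]
  have "((\<lambda>p. hat f (slice_param t p)) has_derivative (\<lambda>h. D (slice_param t p) (slice_deriv t p h))) (at p)" .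
  moreover have "(\<lambda>p. hat f (slice_param t p)) = f \<circ> slice_param t"
    using hat_S3[OF slice_param_S3[OF t]] by auto
  ultimately show ?thesis by simp
qed

lemma continuous_on_slice_normal:
  assumes f: "sphere_diffeo f D g" and t: "\<bar>t\<bar> \<le> 1"
  shows "continuous_on A (\<lambda>p. D (slice_param t p) (slice_deriv t p h))"
    and "continuous_on A (slice_normal f D t)"
proof -
  have cp: "continuous_on A (slice_param t)" by (intro continuous_on_slice_param continuous_intros)
  have d: "continuous_on A (\<lambda>p. D (slice_param t p) (slice_deriv t p h))" for h
  proof (rule continuous_on_linear_family[where D="\<lambda>p. D (slice_param t p)" and v="\<lambda>p. slice_deriv t p h"])
    show "linear (D (slice_param t p))" for p
      using f slice_param_S3[OF t] by (auto simp: sphere_diffeo_def intro: has_derivative_linear)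
    have "continuous_on S3 (\<lambda>x. D x w)" for w using f by (simp add: sphere_diffeo_def)
    then show "continuous_on A (\<lambda>p. D (slice_param t p) w)" for w
      by (rule continuous_on_compose2[OF _ cp]) (use slice_param_S3[OF t] in auto)
  qed (intro continuous_on_slice_deriv continuous_intros)
  then show "continuous_on A (\<lambda>p. D (slice_param t p) (slice_deriv t p h))" .
  have q: "continuous_on A (\<lambda>p. f (slice_param t p))"
    using has_derivative_slice[OF f t] has_derivative_continuous
    by (metis (no_types, lifting) comp_def continuous_at_imp_continuous_on ext)
  show "continuous_on A (slice_normal f D t)"
    unfolding slice_normal_def[abs_def] by (intro continuous_on_normal q d)
qed

lemma slice_tangent:
  assumes f: "sphere_diffeo f D g" and t: "\<bar>t\<bar> \<le> 1"
  shows "f (slice_param t p) \<bullet> D (slice_param t p) (slice_deriv t p h) = 0"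
proof -
  let ?q = "f \<circ> slice_param t" and ?q' = "\<lambda>h. D (slice_param t p) (slice_deriv t p h)"
  have d: "(?q has_derivative ?q') (at p)" by (rule has_derivative_slice[OF f t])
  have "((\<lambda>p. ?q p \<bullet> ?q p) has_derivative (\<lambda>h. ?q p \<bullet> ?q' h + ?q' h \<bullet> ?q p)) (at p)"
    by (rule has_derivative_inner[OF d d])
  moreover have "(\<lambda>p. ?q p \<bullet> ?q p) = (\<lambda>p. 1)"
    using f slice_param_S3[OF t] by (auto simp: sphere_diffeo_def mem_S3 norm_eq_1[symmetric])
  ultimately have "((\<lambda>p. 1) has_derivative (\<lambda>h. ?q p \<bullet> ?q' h + ?q' h \<bullet> ?q p)) (at p)" by simp
  then have "(\<lambda>h. ?q p \<bullet> ?q' h + ?q' h \<bullet> ?q p) = (\<lambda>h. 0)"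
    using has_derivative_unique has_derivative_const by blast
  then have "?q p \<bullet> ?q' h + ?q' h \<bullet> ?q p = 0" by (rule fun_cong)
  then show ?thesis by (simp add: inner_commute)
qed

text \<open>For each sign \<epsilon> the points with \<epsilon> N >= 0, where N is the Hopf
  component of the normal, already project onto the unit sphere, of area 4 pi, with Jacobian 4 |N|.
  Hence the positive and the negative part of N each have integral at least pi.\<close>

lemma hopf_area_ge:
  assumes f: "sphere_diffeo f D g" and t: "-1 < t" "t < 1"
    and meets: "\<And>x0. x0 \<in> S3 \<Longrightarrow> \<exists>x\<in>S3. x$4 = t \<and> f x \<in> great_circle x0 (hopf_field x0)"
  shows "2 * pi \<le> integral slice_domain (\<lambda>p. \<bar>slice_normal f D t p $ 1\<bar>)"
proof -
  let ?N = "\<lambda>p. slice_normal f D t p $ 1"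
  have t1: "\<bar>t\<bar> \<le> 1" using t by simp
  have cN: "continuous_on A ?N" for A
    by (intro continuous_intros continuous_on_slice_normal(2)[OF f t1])
  have comp: "compact slice_domain" unfolding slice_domain_def by simp
  have half: "pi \<le> integral slice_domain (\<lambda>p. max (\<epsilon> * ?N p) 0)" if e: "\<bar>\<epsilon>\<bar> = 1" for \<epsilon>
  proof -
    \<comment> \<open>The weak inequality makes S compact and keeps the tangential crossings, at
      which the Jacobian vanishes.\<close>
    define S where "S = {p\<in>slice_domain. 0 \<le> \<epsilon> * ?N p}"
    have "compact (slice_domain \<inter> {p. 0 \<le> \<epsilon> * ?N p})"
      using comp by (rule compact_Int_closed)
        (intro closed_Collect_le continuous_intros continuous_on_slice_normal(2)[OF f t1])
    then have cS: "compact S" unfolding S_def by (simp add: Int_def)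
    let ?y' = "\<lambda>p h. hopf_map_deriv (f (slice_param t p)) (D (slice_param t p) (slice_deriv t p h))"
    have fS: "f (slice_param t p) \<in> S3" for p using f slice_param_S3[OF t1] by (auto simp: sphere_diffeo_def)
    have "integral (cbox (vector [-1,-pi]) (vector [1,pi]) :: (real^2) set) (\<lambda>u. 1)
      \<le> integral S (\<lambda>p. \<bar>triple (hopf_map (f (slice_param t p))) (?y' p (axis 1 1)) (?y' p (axis 2 1))\<bar> * 1)"
    proof (rule sphere_area_le[where G="\<lambda>_. 1" and y="\<lambda>p. hopf_map (f (slice_param t p))" and y'="?y'"])
      show "((\<lambda>p. hopf_map (f (slice_param t p))) has_derivative ?y' p) (at p)" for p
        using has_derivative_compose[OF has_derivative_slice[OF f t1] has_derivative_hopf_map] by (simp add: o_def)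
      show "norm (hopf_map (f (slice_param t p))) = 1" for p
        using hopf_map_unit fS by (simp add: mem_S3)
      show "continuous_on S (\<lambda>p. ?y' p (axis i 1))" for i
      proof (rule continuous_on_vec_nthI)
        have q: "continuous_on S (\<lambda>p. f (slice_param t p))"
          using has_derivative_slice[OF f t1] has_derivative_continuous
          by (metis (no_types, lifting) comp_def continuous_at_imp_continuous_on ext)
        fix j :: 3
        have "j = 1 \<or> j = 2 \<or> j = 3" using exhaust_3 by blast
        then show "continuous_on S (\<lambda>p. ?y' p (axis i 1) $ j)"
          by (elim disjE) (simp_all add: hopf_map_deriv_def,
             (intro continuous_intros q continuous_on_slice_normal(1)[OF f t1])+)
      qed
      show "v \<in> (\<lambda>p. hopf_map (f (slice_param t p))) ` S" if v: "norm v = 1" for v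
      proof -
        obtain x0 where x0: "x0 \<in> S3" "hopf_map x0 = v" using hopf_map_surj[OF v] by blast
        obtain p where "p \<in> slice_domain" "hopf_map (f (slice_param t p)) = hopf_map x0" "0 \<le> \<epsilon> * ?N p"
          using fibre_crossing[OF f t meets[OF x0(1)] x0(1) e] by blast
        then have "p \<in> S" "v = hopf_map (f (slice_param t p))" using x0(2) by (simp_all add: S_def)
        then show ?thesis by blast
      qed
    qed (use cS in auto)
    also have "\<dots> = integral S (\<lambda>p. 4 * (\<epsilon> * ?N p))"
    proof (rule integral_cong)
      fix p assume "p \<in> S"
      then have "\<bar>?N p\<bar> = \<epsilon> * ?N p" using e unfolding S_def by (metis (mono_tags, lifting) abs_mult abs_of_nonneg mem_Collect_eq mult_1)
      then show "\<bar>triple (hopf_map (f (slice_param t p))) (?y' p (axis 1 1)) (?y' p (axis 2 1))\<bar> * 1 = 4 * (\<epsilon> * ?N p)"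
        using triple_hopf_map[OF _ slice_tangent[OF f t1] slice_tangent[OF f t1], of p "axis 1 1" "axis 2 1"] fS[of p]
        by (simp add: mem_S3 slice_normal_def)
    qed
    also have "\<dots> = 4 * integral S (\<lambda>p. \<epsilon> * ?N p)" by simp
    also have "integral S (\<lambda>p. \<epsilon> * ?N p) = integral slice_domain (\<lambda>p. if p \<in> S then \<epsilon> * ?N p else 0)"
      by (subst integral_restrict_Int) (simp add: S_def Int_def conj_commute cong: conj_cong)
    also have "\<dots> = integral slice_domain (\<lambda>p. max (\<epsilon> * ?N p) 0)"
      by (rule integral_cong) (auto simp: S_def)
    finally have "integral (cbox (vector [-1,-pi]) (vector [1,pi]) :: (real^2) set) (\<lambda>u. 1) \<le> 4 * integral slice_domain (\<lambda>p. max (\<epsilon> * ?N p) 0)" .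
    moreover have "integral (cbox (vector [-1,-pi]) (vector [1,pi]) :: (real^2) set) (\<lambda>u. 1::real) = 4 * pi"
      by (subst integral_cbox_real2) (auto intro!: continuous_intros)
    ultimately show ?thesis by linarith
  qed
  have int: "(\<lambda>p. max (\<epsilon> * ?N p) 0) integrable_on slice_domain" for \<epsilon>
    unfolding slice_domain_def by (intro integrable_continuous continuous_intros cN)
  have "2 * pi \<le> integral slice_domain (\<lambda>p. max (1 * ?N p) 0) + integral slice_domain (\<lambda>p. max (-1 * ?N p) 0)"
    using half[of 1] half[of "-1"] by simp
  also have "\<dots> = integral slice_domain (\<lambda>p. max (1 * ?N p) 0 + max (-1 * ?N p) 0)"
    by (rule integral_add[symmetric]) (rule int)+
  also have "\<dots> = integral slice_domain (\<lambda>p. \<bar>?N p\<bar>)" by (rule integral_cong) auto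
  finally show ?thesis .
qed

section \<open>Width and volume\<close>

lemma orthonormal_pair_orthogonal:
  assumes "orthogonal_transformation R" "orthonormal_pair a b"
  shows "orthonormal_pair (R a) (R b)"
  using assms by (simp add: orthonormal_pair_def orthogonal_transformation_def norm_eq_sqrt_inner)

lemma linear_hopf_comb: "linear (hopf_comb u)"
  by (rule linearI) (simp_all add: hopf_comb_def vec_eq_iff forall_4 hopf_nth algebra_simps)

text \<open>The normalised quaternion \<open>i + u\<close> conjugates the imaginary unit \<open>u\<close> to \<open>i\<close>.\<close>
lemma hopf_rotation:
  assumes u: "norm u = 1" "u \<noteq> - axis 1 1"
  obtains R where "orthogonal_transformation R" "\<And>x. R (- R x) = x" "\<And>x. R (hopf_comb u x) = hopf_field (R x)"
proof -
  have u1: "(u$1)^2 + (u$2)^2 + (u$3)^2 = 1" using u(1) norm_eq_1_3 by blast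
  have gt: "u$1 > -1"
  proof (rule ccontr)
    assume "\<not> u$1 > -1"
    moreover have "\<bar>u$1\<bar> \<le> 1" using component_le_norm_cart[of u 1] u(1) by simp
    ultimately have e: "u$1 = -1" by simp
    then have "u$2 = 0" "u$3 = 0" using u1 by (simp_all add: sum_power2_eq_zero_iff)
    then show False using u(2) e by (simp add: vec_eq_iff forall_3 axis_def)
  qed
  \<comment> \<open>The quaternion i + u has squared norm 2 + 2 u$1. Normalised it is a unit
    imaginary quaternion, so its square is -1, and (i + u) u = i (i + u).\<close>
  define k where "k = 1 / sqrt (2 + 2 * u$1)"
  have k: "k^2 * (2 + 2 * u$1) = 1" using gt by (simp add: k_def power_divide)
  define R where "R x = k *\<^sub>R (hopf_field x + hopf_comb u x)" for x
  have lin: "linear R" unfolding R_def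
    by (intro linear_compose_scale_right linear_compose_add linear_hopf_field linear_hopf_comb)
  have "norm (R x)^2 = norm x ^2" for x
    unfolding R_def power2_norm_eq_inner inner_4 hopf_comb_def using k u1 by (simp add: hopf_nth) algebra
  then have "norm (R x) = norm x" for x by (metis norm_ge_zero power2_eq_iff_nonneg)
  then have orth: "orthogonal_transformation R" using lin by (simp add: orthogonal_transformation)
  have inv: "R (- R x) = x" for x
    unfolding R_def vec_eq_iff forall_4 hopf_comb_def using k u1
    by (simp add: hopf_nth) (intro conjI; algebra)
  have comm: "R (hopf_comb u x) = hopf_field (R x)" for x
    unfolding R_def vec_eq_iff forall_4 hopf_comb_def using k u1
    by (simp add: hopf_nth) (intro conjI; algebra)
  show ?thesis by (rule that[OF orth inv comm])
qed

text \<open>Composition with R turns the fibration of u into the standard one; as det R is 1 or -1,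
  the component of the normal along u becomes the first component up to sign.\<close>

lemma directional_area_ge:
  assumes f: "sphere_diffeo f D g" and t: "-1 < t" "t < 1"
    and meets: "\<And>a b. orthonormal_pair a b \<Longrightarrow> \<exists>x\<in>S3. x$4 = t \<and> f x \<in> great_circle a b"
  shows "2 * pi * norm v \<le> integral slice_domain (\<lambda>p. \<bar>slice_normal f D t p \<bullet> v\<bar>)"
proof (cases "v = 0")
  case False
  have unit: "2 * pi \<le> integral slice_domain (\<lambda>p. \<bar>slice_normal f D t p \<bullet> u\<bar>)" if u: "norm u = 1" for u
  proof (cases "u = - axis 1 1")
    \<comment> \<open>Here i + u vanishes, but -i generates the standard fibration with reversed
      direction, which the absolute value ignores.\<close>
    case True
    have "2 * pi \<le> integral slice_domain (\<lambda>p. \<bar>slice_normal f D t p $ 1\<bar>)"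
      by (rule hopf_area_ge[OF f t]) (use meets orthonormal_hopf in blast)
    then show ?thesis unfolding True by (simp add: inner_axis)
  next
    case False
    obtain R where R: "orthogonal_transformation R" "\<And>x. R (- R x) = x" "\<And>x. R (hopf_comb u x) = hopf_field (R x)"
      using hopf_rotation[OF u False] by blast
    have lR: "linear R" using R(1) by (rule orthogonal_transformation_linear)
    have inv: "- R (R x) = x" for x using R(2)[of x] by (simp add: linear_neg[OF lR])
    have R': "orthogonal_transformation (\<lambda>x. - R x)" using R(1) by (simp add: orthogonal_transformation_neg)
    note Rf = sphere_diffeo_orthogonal[OF f R(1) inv R(2)]
    have "2 * pi \<le> integral slice_domain (\<lambda>p. \<bar>slice_normal (\<lambda>x. R (f x)) (\<lambda>x w. R (D x w)) t p $ 1\<bar>)"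
    proof (rule hopf_area_ge[OF Rf t])
      \<comment> \<open>As R^2 = -1, the inverse of R is - R, and the circle that f has to meet is
        the preimage of the fibre through x0.\<close>
      fix x0 assume "x0 \<in> S3"
      then have "orthonormal_pair (- R x0) (- R (hopf_field x0))"
        using orthonormal_pair_orthogonal[OF R' orthonormal_hopf] by blast
      then obtain x where x: "x \<in> S3" "x$4 = t" "f x \<in> great_circle (- R x0) (- R (hopf_field x0))"
        using meets by blast
      then obtain s where "f x = cos s *\<^sub>R (- R x0) + sin s *\<^sub>R (- R (hopf_field x0))"
        by (auto simp: great_circle_def)
      then have "R (f x) = cos s *\<^sub>R x0 + sin s *\<^sub>R hopf_field x0"
        by (simp only: linear_add[OF lR] linear_cmul[OF lR] R(2))
      then show "\<exists>x\<in>S3. x$4 = t \<and> R (f x) \<in> great_circle x0 (hopf_field x0)"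
        using x by (auto simp: great_circle_def)
    qed
    moreover have "\<bar>slice_normal (\<lambda>x. R (f x)) (\<lambda>x w. R (D x w)) t p $ 1\<bar> = \<bar>slice_normal f D t p \<bullet> u\<bar>" for p
    proof -
      have "slice_normal (\<lambda>x. R (f x)) (\<lambda>x w. R (D x w)) t p $ 1 = det (matrix R) * (u \<bullet> slice_normal f D t p)"
        unfolding slice_normal_def quad_normal_1[symmetric] R(3)[symmetric] quad_linear[OF lR] quad_normal ..
      moreover have "\<bar>det (matrix R)\<bar> = 1" using R(1) by (simp add: orthogonal_transformation_det)
      ultimately show ?thesis by (simp add: abs_mult inner_commute)
    qed
    ultimately show ?thesis by simp
  qed
  let ?u = "v /\<^sub>R norm v"
  have "\<bar>slice_normal f D t p \<bullet> v\<bar> = norm v * \<bar>slice_normal f D t p \<bullet> ?u\<bar>" for p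
    using False by (simp add: abs_mult)
  then have "integral slice_domain (\<lambda>p. \<bar>slice_normal f D t p \<bullet> v\<bar>) = norm v * integral slice_domain (\<lambda>p. \<bar>slice_normal f D t p \<bullet> ?u\<bar>)"
    by simp
  moreover have "norm v * (2 * pi) \<le> norm v * integral slice_domain (\<lambda>p. \<bar>slice_normal f D t p \<bullet> ?u\<bar>)"
    using unit[of ?u] False by (intro mult_left_mono) auto
  ultimately show ?thesis by (simp add: mult.commute)
qed simp

lemma hopf_frame_parseval:
  assumes "norm x = 1"
  shows "v \<bullet> w = (v \<bullet> x) * (w \<bullet> x) + (v \<bullet> hopf_field x) * (w \<bullet> hopf_field x)
    + (v \<bullet> hopf_j x) * (w \<bullet> hopf_j x) + (v \<bullet> hopf_k x) * (w \<bullet> hopf_k x)"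
  using assms unfolding norm_eq_1_4 inner_4 hopf_nth by algebra

text \<open>In the orthonormal frame x, ix, jx, kx the metric scales the i-component by \<rho>,
  hence also the minors that involve it, the last two entries of \<open>normal\<close>. Lagrange's
  identity turns the Gram determinant into a sum of squares.\<close>

lemma berger_gram_det:
  assumes "norm x = 1" "x \<bullet> v = 0" "x \<bullet> w = 0"
  shows "berger \<rho> x v v * berger \<rho> x w w - berger \<rho> x v w * berger \<rho> x w v = norm (stretch \<rho> (normal x v w)) ^ 2"
proof -
  have "v \<bullet> x = 0" "w \<bullet> x = 0" using assms by (simp_all add: inner_commute)
  note P = hopf_frame_parseval[OF assms(1), of v v] hopf_frame_parseval[OF assms(1), of w w]
    hopf_frame_parseval[OF assms(1), of v w] hopf_frame_parseval[OF assms(1), of w v]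
  show ?thesis
    unfolding berger_def P norm_sq_3 stretch_def normal_def vector_3 \<open>v \<bullet> x = 0\<close> \<open>w \<bullet> x = 0\<close> by algebra
qed

lemma sweep_area_berger:
  assumes f: "sphere_diffeo (F t) D g" and t: "\<bar>t\<bar> \<le> 1"
  shows "sweep_area (berger \<rho>) F t = integral slice_domain (\<lambda>p. norm (stretch \<rho> (slice_normal (F t) D t p)))"
  unfolding sweep_area_def param_volume_def
proof (rule integral_cong)
  fix p
  let ?q' = "\<lambda>h. D (slice_param t p) (slice_deriv t p h)"
  have "frechet_derivative (F t \<circ> slice_param t) (at p) = ?q'"
    using frechet_derivative_at[OF has_derivative_slice[OF f t]] by simp
  moreover have "norm (F t (slice_param t p)) = 1"
    using f slice_param_S3[OF t] by (auto simp: sphere_diffeo_def mem_S3)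
  ultimately show "sqrt (det (\<chi> i j. berger \<rho> ((F t \<circ> slice_param t) p)
      (frechet_derivative (F t \<circ> slice_param t) (at p) (axis i 1)) (frechet_derivative (F t \<circ> slice_param t) (at p) (axis j 1))))
    = norm (stretch \<rho> (slice_normal (F t) D t p))"
    using berger_gram_det[OF _ slice_tangent[OF f t, of p "axis 1 1"] slice_tangent[OF f t, of p "axis 2 1"], of \<rho>]
    unfolding slice_normal_def by (simp add: det_2)
qed

text \<open>A real \<open>Sup\<close> dominates the areas only if they are bounded above; this
  follows from continuity of the area in t on a compact interval.\<close>

lemma sweepout_area_bound:
  assumes F: "sweepout F" and \<rho>: "\<rho> > 0"
  shows "bdd_above (sweep_area (berger \<rho>) F ` {-1..1})"
    and "\<exists>t\<in>{-1..1}. 4 * pi * (1/3 + 2 * \<rho> / 3) \<le> sweep_area (berger \<rho>) F t"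
proof -
  obtain D where D: "\<And>t x. t \<in> {-1..1} \<Longrightarrow> x \<in> S3 \<Longrightarrow> (hat (F t) has_derivative D t x) (at x)"
      "\<And>w. continuous_on ({-1..1} \<times> S3) (\<lambda>(t,x). D t x w)"
      "continuous_on ({-1..1} \<times> S3) (\<lambda>(t,x). F t x)"
      "\<And>t x. t \<in> {-1..1} \<Longrightarrow> x \<in> S3 \<Longrightarrow> D t x x = F t x"
    using sweepout_C1[OF F] by blast
  have d: "sphere_diffeo (F t) (D t) (inv_into S3 (F t))" if t: "t \<in> {-1..1}" for t
  proof (rule sphere_diffeo_sweepout[OF F t])
    show "continuous_on S3 (\<lambda>x. D t x w)" for w
    proof -
      have "continuous_on S3 (\<lambda>x. case (t,x) of (t,x) \<Rightarrow> D t x w)"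
        by (rule continuous_on_compose2[OF D(2)]) (use t in \<open>auto intro!: continuous_intros\<close>)
      then show ?thesis by simp
    qed
  qed (use D t in auto)
  have area: "sweep_area (berger \<rho>) F t = integral slice_domain (\<lambda>p. norm (stretch \<rho> (slice_normal (F t) (D t) t p)))"
    if "t \<in> {-1..1}" for t
    by (rule sweep_area_berger[where F=F and t=t, OF d[OF that]]) (use that in auto)
  show "\<exists>t\<in>{-1..1}. 4 * pi * (1/3 + 2 * \<rho> / 3) \<le> sweep_area (berger \<rho>) F t"
  proof -
    have bij: "bij_betw (F t) S3 S3" if "t \<in> {-1..1}" for t
      using F that by (simp add: sweepout_def S3_diffeo_def)
    obtain t where t: "-1 < t" "t < 1"
      and meets: "\<And>a b. orthonormal_pair a b \<Longrightarrow> \<exists>x\<in>S3. x$4 = t \<and> F t x \<in> great_circle a b"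
      using slice_meets_great_circles[OF D(3) bij] by blast
    have tI: "t \<in> {-1..1}" and t1: "\<bar>t\<bar> \<le> 1" using t by auto
    have "4 * pi * (1/3 + 2 * \<rho> / 3) \<le> integral slice_domain (\<lambda>p. norm (stretch \<rho> (slice_normal (F t) (D t) t p)))"
      by (rule integral_norm_stretch_ge[OF continuous_on_slice_normal(2)[OF d[OF tI] t1] \<rho>
          directional_area_ge[OF d[OF tI] t meets]])
    then have "4 * pi * (1/3 + 2 * \<rho> / 3) \<le> sweep_area (berger \<rho>) F t" unfolding area[OF tI] .
    then show ?thesis using tI by blast
  qed
  show "bdd_above (sweep_area (berger \<rho>) F ` {-1..1})"
  proof -
    let ?A = "{-1..1} \<times> slice_domain"
    have sp: "continuous_on ?A (\<lambda>z. slice_param (fst z) (snd z))"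
      by (intro continuous_on_slice_param continuous_intros)
    have pr: "continuous_on ?A (\<lambda>z. (fst z, slice_param (fst z) (snd z)))" by (intro continuous_intros sp)
    have im: "(\<lambda>z. (fst z, slice_param (fst z) (snd z))) ` ?A \<subseteq> {-1..1} \<times> S3"
      using slice_param_S3 by (auto simp: abs_le_iff)
    have cF: "continuous_on ?A (\<lambda>z. F (fst z) (slice_param (fst z) (snd z)))"
      using continuous_on_compose2[OF D(3) pr im] by simp
    have cD: "continuous_on ?A (\<lambda>z. D (fst z) (slice_param (fst z) (snd z)) (slice_deriv (fst z) (snd z) h))" for h
    proof (rule continuous_on_linear_family[where D="\<lambda>z. D (fst z) (slice_param (fst z) (snd z))" and v="\<lambda>z. slice_deriv (fst z) (snd z) h"])
      show "linear (D (fst z) (slice_param (fst z) (snd z)))" if "z \<in> ?A" for z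
        using D(1) im that by (intro has_derivative_linear) blast
      show "continuous_on ?A (\<lambda>z. D (fst z) (slice_param (fst z) (snd z)) w)" for w
        using continuous_on_compose2[OF D(2) pr im] by simp
      show "continuous_on ?A (\<lambda>z. slice_deriv (fst z) (snd z) h)" by (intro continuous_on_slice_deriv continuous_intros)
    qed
    have "continuous_on ?A (\<lambda>z. norm (stretch \<rho> (slice_normal (F (fst z)) (D (fst z)) (fst z) (snd z))))"
      unfolding slice_normal_def by (intro continuous_intros continuous_on_stretch continuous_on_normal cF cD)
    then have "continuous_on {-1..1} (\<lambda>t. integral slice_domain (\<lambda>p. norm (stretch \<rho> (slice_normal (F t) (D t) t p))))"
      unfolding slice_domain_def by (intro integral_continuous_on_param) (simp add: split_def)
    then have "compact ((\<lambda>t. integral slice_domain (\<lambda>p. norm (stretch \<rho> (slice_normal (F t) (D t) t p)))) ` {-1..1})"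
      by (rule compact_continuous_image) simp
    moreover have "sweep_area (berger \<rho>) F ` {-1..1}
        = (\<lambda>t. integral slice_domain (\<lambda>p. norm (stretch \<rho> (slice_normal (F t) (D t) t p)))) ` {-1..1}"
      by (rule image_cong[OF refl area])
    ultimately have "compact (sweep_area (berger \<rho>) F ` {-1..1})" by simp
    then show ?thesis by (intro bounded_imp_bdd_above compact_imp_bounded)
  qed
qed

lemma sweepout_Sup_ge:
  assumes "sweepout F" "\<rho> > 0"
  shows "4 * pi * (1/3 + 2 * \<rho> / 3) \<le> Sup ((\<lambda>t. sweep_area (berger \<rho>) F t) ` {-1..1})"
proof -
  obtain t where t: "t \<in> {-1..1}" "4 * pi * (1/3 + 2 * \<rho> / 3) \<le> sweep_area (berger \<rho>) F t"
    using sweepout_area_bound(2)[OF assms] by blast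
  have "sweep_area (berger \<rho>) F t \<le> Sup ((\<lambda>t. sweep_area (berger \<rho>) F t) ` {-1..1})"
    by (rule cSup_upper[OF imageI[OF t(1)] sweepout_area_bound(1)[OF assms]])
  then show ?thesis using t(2) by linarith
qed

section \<open>The identity sweep-out\<close>

text \<open>Coinduction over all affine functions: their partial derivatives are constants, hence
  affine again.\<close>

lemma smooth_on_affine:
  assumes "bounded_linear h"
  shows "smooth_on U (\<lambda>x. h x + c)"
proof -
  have "\<exists>h c. bounded_linear h \<and> (\<lambda>x. h x + c) = f \<Longrightarrow> smooth_on U f" for f
  proof (coinduction arbitrary: f rule: smooth_on.coinduct)
    case smooth_on
    then obtain h c where h: "bounded_linear h" and f: "f = (\<lambda>x. h x + c)" by blast
    have d: "(f has_derivative h) (at x within S)" for x S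
      unfolding f using bounded_linear.has_derivative[OF h has_derivative_ident]
      by (auto intro!: derivative_eq_intros)
    then have fd: "frechet_derivative f (at x) = h" for x using frechet_derivative_at by metis
    have "f differentiable_on U" using d unfolding differentiable_on_def differentiable_def by blast
    moreover have "\<exists>h' c. bounded_linear h' \<and> (\<lambda>x. h' x + c) = (\<lambda>x. frechet_derivative f (at x) i)" for i
      by (rule exI[of _ "\<lambda>_. 0"], rule exI[of _ "h i"]) (simp add: fd)
    ultimately show ?case by fast
  qed
  then show ?thesis using assms by blast
qed

lemma smooth_on_set_linear:
  assumes "bounded_linear h"
  shows "smooth_on_set S h"
  unfolding smooth_on_set_def smooth_map_on_def
proof (intro exI conjI ballI)
  show "smooth_on UNIV (\<lambda>x. h x \<bullet> b)" for b
    using smooth_on_affine[OF bounded_linear_compose[OF bounded_linear_inner_left assms], of UNIV b 0] by simp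
qed auto

lemma sweepout_id: "sweepout (\<lambda>t x. x)"
proof -
  have "smooth_on_set S3 (inv_into S3 (\<lambda>x. x))"
  proof -
    have "smooth_on_set S3 (\<lambda>x::real^4. x)" by (rule smooth_on_set_linear) (rule bounded_linear_ident)
    moreover have "inv_into S3 (\<lambda>x. x) x = x" if "x \<in> S3" for x
      using that by (rule inv_into_f_f[of "\<lambda>x. x", simplified])
    ultimately show ?thesis unfolding smooth_on_set_def by simp
  qed
  moreover have "smooth_on_set S3 (\<lambda>x::real^4. x)" by (rule smooth_on_set_linear) (rule bounded_linear_ident)
  ultimately have d: "S3_diffeo (\<lambda>x. x)" unfolding S3_diffeo_def by (simp add: bij_betw_def)
  have s: "smooth_on_set A (\<lambda>(t::real,x::real^4). x)" for A
    using smooth_on_set_linear[OF bounded_linear_snd] by (simp add: split_def)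
  have "isotopic_to_id (\<lambda>x. x)"
    unfolding isotopic_to_id_def by (rule exI[of _ "\<lambda>s x. x"]) (use d s in simp)
  then show ?thesis unfolding sweepout_def using d s by simp
qed

lemma sweep_area_id:
  assumes "\<bar>t\<bar> \<le> 1"
  shows "sweep_area (berger 1) (\<lambda>t x. x) t = 4 * pi * (1 - t^2)"
proof -
  have t: "1 - t^2 \<ge> 0" using assms by (simp add: abs_square_le_1)
  have fd: "frechet_derivative (slice_param t) (at p) = slice_deriv t p" for p
    using frechet_derivative_at[OF has_derivative_slice_param] by metis
  have "sweep_area (berger 1) (\<lambda>t x. x) t = integral slice_domain (\<lambda>p. (1 - t^2) * sin (p$1))"
    unfolding sweep_area_def param_volume_def
  proof (rule integral_cong)
    fix p :: "real^2" assume p: "p \<in> slice_domain"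
    let ?v = "slice_deriv t p (axis 1 1)" and ?w = "slice_deriv t p (axis 2 1)"
    have sin: "sin (p$1) \<ge> 0" using p by (intro sin_ge_zero) (auto simp: mem_slice_domain)
    have r: "(sqrt (1 - t^2))^2 = 1 - t^2" using t by simp
    have "?v \<bullet> ?v = 1 - t^2" "?w \<bullet> ?w = (1 - t^2) * (sin (p$1))^2" "?v \<bullet> ?w = 0"
      unfolding inner_4 slice_deriv_def vector_4 sph_deriv_def vector_3
      by (simp_all add: axis_def)
        (use r sin_cos_squared_add[of "p$1"] sin_cos_squared_add[of "p$2"] in algebra)+
    then have "det (\<chi> i j. berger 1 ((id \<circ> slice_param t) p) (slice_deriv t p (axis i 1)) (slice_deriv t p (axis j 1)) :: real^2^2)
       = ((1 - t^2) * sin (p$1))^2"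
      unfolding det_2 berger_def by (simp add: inner_commute power_mult_distrib power2_eq_square)
    then show "sqrt (det (\<chi> i j. berger 1 (((\<lambda>x. x) \<circ> slice_param t) p)
        (frechet_derivative ((\<lambda>x. x) \<circ> slice_param t) (at p) (axis i 1)) (frechet_derivative ((\<lambda>x. x) \<circ> slice_param t) (at p) (axis j 1)) :: real^2^2))
      = (1 - t^2) * sin (p$1)"
      using t sin by (simp add: o_def fd)
  qed
  also have "\<dots> = (1 - t^2) * (2 * pi * integral {0..pi} sin)"
    using integral_slice_domain[of sin] by (simp add: continuous_intros)
  finally show ?thesis by (simp add: integral_sin_0_pi)
qed

lemma width_berger_ge:
  assumes "\<rho> > 0"
  shows "4 * pi * (1/3 + 2 * \<rho> / 3) \<le> width (berger \<rho>)"
  unfolding width_def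
  by (rule cInf_greatest) (use sweepout_id sweepout_Sup_ge[OF _ assms] in auto)

text \<open>The identity sweep-out has its largest slice at the equator. The lower bound for all
  sweep-outs enters once more, to keep the set under \<open>Inf\<close> bounded below.\<close>

lemma width_round_le: "width (berger 1) \<le> 4 * pi"
proof -
  have "width (berger 1) \<le> Sup ((\<lambda>t. sweep_area (berger 1) (\<lambda>t x. x) t) ` {-1..1})"
    unfolding width_def
  proof (rule cInf_lower)
    show "bdd_below {Sup ((\<lambda>t. sweep_area (berger 1) F t) ` {-1..1}) |F. sweepout F}"
      by (rule bdd_belowI[of _ "4 * pi * (1/3 + 2 * 1 / 3)"]) (use sweepout_Sup_ge[of _ 1] in auto)
  qed (use sweepout_id in blast)
  also have "\<dots> \<le> 4 * pi"
    by (rule cSup_least) (auto simp: sweep_area_id abs_le_iff)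
  finally show ?thesis .
qed


section \<open>Volume and the final comparison\<close>

definition hopf_param_deriv :: "real^3 \<Rightarrow> real^3 \<Rightarrow> real^4" where
  "hopf_param_deriv u h = vector
    [- sin (u$1) * cos (u$2) * h$1 - cos (u$1) * sin (u$2) * h$2,
     - sin (u$1) * sin (u$2) * h$1 + cos (u$1) * cos (u$2) * h$2,
     cos (u$1) * cos (u$3) * h$1 - sin (u$1) * sin (u$3) * h$3,
     cos (u$1) * sin (u$3) * h$1 + sin (u$1) * cos (u$3) * h$3]"

lemma has_derivative_hopf_param: "(hopf_param has_derivative hopf_param_deriv u) (at u)"
proof (rule has_derivative_vecI)
  fix i :: 4
  have "i = 1 \<or> i = 2 \<or> i = 3 \<or> i = 4" using exhaust_4 by blast
  then show "((\<lambda>u. hopf_param u $ i) has_derivative (\<lambda>h. hopf_param_deriv u h $ i)) (at u)"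
    by (elim disjE) (auto simp: hopf_param_def hopf_param_deriv_def vector_4 algebra_simps
      intro!: derivative_eq_intros has_derivative_vec_nth)
qed

text \<open>The rank-one change of the metric multiplies the Gram determinant in Hopf coordinates by
  \<rho>^2. V is the volume of the round sphere and cancels from the comparison.\<close>

lemma volume_berger:
  obtains V where "V > 0" "\<And>\<rho>. \<rho> > 0 \<Longrightarrow> volume_S3 (berger \<rho>) = \<rho> * V"
proof
  let ?C = "cbox 0 (vector [pi / 2, 2 * pi, 2 * pi]) :: (real^3) set"
  let ?V = "integral ?C (\<lambda>u. \<bar>cos (u$1) * sin (u$1)\<bar>)"
  have c: "continuous_on ?C (\<lambda>u. \<bar>cos (u$1) * sin (u$1)\<bar>)" by (intro continuous_intros)
  \<comment> \<open>The centre of the coordinate box, where the continuous nonnegative integrand is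
    positive.\<close>
  let ?m = "vector [pi/4, pi, pi] :: real^3"
  have m: "?m \<in> box 0 (vector [pi / 2, 2 * pi, 2 * pi])" by (simp add: mem_box_cart forall_3)
  have "?V \<noteq> 0"
  proof
    assume "?V = 0"
    then have "\<bar>cos (?m$1) * sin (?m$1)\<bar> = 0"
    proof -
      have "box 0 (vector [pi / 2, 2 * pi, 2 * pi] :: real^3) \<noteq> {}" using m by blast
      from integral_cbox_eq_0_iff[OF c this] \<open>?V = 0\<close>
      have "\<forall>u\<in>?C. \<bar>cos (u$1) * sin (u$1)\<bar> = 0" by simp
      moreover have "?m \<in> ?C" using m box_subset_cbox by blast
      ultimately show ?thesis by (rule bspec)
    qed
    then show False using cos_gt_zero[of "pi/4"] sin_gt_zero[of "pi/4"] by simp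
  qed
  moreover have "?V \<ge> 0" by (rule integral_nonneg) (use integrable_continuous[OF c] in auto)
  ultimately show "?V > 0" by simp
  fix \<rho> :: real assume \<rho>: "\<rho> > 0"
  have fd: "frechet_derivative hopf_param (at u) = hopf_param_deriv u" for u
    using frechet_derivative_at[OF has_derivative_hopf_param] by metis
  have "det (\<chi> i j. berger \<rho> (hopf_param u) (hopf_param_deriv u (axis i 1)) (hopf_param_deriv u (axis j 1)) :: real^3^3)
     = (\<rho> * (cos (u$1) * sin (u$1)))^2" for u
  proof -
    let ?v = "\<lambda>i. hopf_param_deriv u (axis i 1)" and ?H = "hopf_field (hopf_param u)"
    note sc = sin_cos_squared_add[of "u$1"] sin_cos_squared_add[of "u$2"] sin_cos_squared_add[of "u$3"]
    have "?v 1 \<bullet> ?v 1 = 1" "?v 2 \<bullet> ?v 2 = (cos (u$1))^2" "?v 3 \<bullet> ?v 3 = (sin (u$1))^2"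
      "?v 1 \<bullet> ?v 2 = 0" "?v 1 \<bullet> ?v 3 = 0" "?v 2 \<bullet> ?v 3 = 0"
      "?v 1 \<bullet> ?H = 0" "?v 2 \<bullet> ?H = (cos (u$1))^2" "?v 3 \<bullet> ?H = (sin (u$1))^2"
      unfolding inner_4 hopf_param_deriv_def hopf_param_def hopf_nth
      by (simp_all add: axis_def) (use sc in algebra)+
    then show ?thesis
      unfolding det_3 berger_def by (simp add: inner_commute) (use sc(1) in algebra)
  qed
  then show "volume_S3 (berger \<rho>) = \<rho> * ?V"
    unfolding volume_S3_def param_volume_def fd using \<rho> by (simp add: abs_mult)
qed

text \<open>The inequality of means for 1, \<rho>, \<rho>; with x the cube root of \<rho> it reads
  (x - 1)^2 (2 x + 1) > 0.\<close>

lemma powr_two_thirds_less: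
  fixes \<rho> :: real
  assumes "\<rho> > 0" "\<rho> \<noteq> 1"
  shows "\<rho> powr (2/3) < 1/3 + 2 * \<rho> / 3"
proof -
  define x where "x = \<rho> powr (1/3)"
  have x: "x > 0" "x^3 = \<rho>" "x^2 = \<rho> powr (2/3)"
    using assms by (simp_all add: x_def powr_realpow[symmetric] powr_powr)
  have "x \<noteq> 1" using x(2) assms(2) by auto
  then have "(x - 1)^2 * (2 * x + 1) > 0" using x(1) by simp
  also have "(x - 1)^2 * (2 * x + 1) = 1 + 2 * x^3 - 3 * x^2" by (simp add: power2_eq_square power3_eq_cube algebra_simps)
  finally show ?thesis unfolding x(2,3) by simp
qed

theorem theorem1p4:
  shows "(\<exists>\<epsilon>>0. \<forall>\<rho>. 0 < \<rho> \<and> \<bar>\<rho> - 1\<bar> < \<epsilon> \<and> \<rho> \<noteq> 1 \<longrightarrow>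
            normalised_width 1 < normalised_width \<rho>)
       \<and> (\<forall>M. \<exists>\<rho>>0. M < normalised_width \<rho>)
       \<and> (\<forall>M. \<exists>\<rho>>0. positive_ricci (berger \<rho>) \<and> M < normalised_width \<rho>)"
proof -
  obtain V where V: "V > 0" "\<And>\<rho>. \<rho> > 0 \<Longrightarrow> volume_S3 (berger \<rho>) = \<rho> * V"
    using volume_berger by blast
  define K where "K = V powr (2/3)"
  have K: "K > 0" using V(1) by (simp add: K_def)
  have lower: "4 * pi * (1/3 + 2 * \<rho> / 3) / (\<rho> powr (2/3) * K) \<le> normalised_width \<rho>" if "\<rho> > 0" for \<rho>
    unfolding normalised_width_def V(2)[OF that] K_def using that V(1) width_berger_ge[OF that]
    by (simp add: powr_mult divide_right_mono)
  have upper: "normalised_width 1 \<le> 4 * pi / K"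
    unfolding normalised_width_def V(2)[OF zero_less_one] K_def using width_round_le by (simp add: divide_right_mono)
  have min: "normalised_width 1 < normalised_width \<rho>" if "\<rho> > 0" "\<rho> \<noteq> 1" for \<rho>
  proof -
    have p: "\<rho> powr (2/3) > 0" using that by simp
    have "4 * pi / K < 4 * pi * (1/3 + 2 * \<rho> / 3) / (\<rho> powr (2/3) * K)"
    proof -
      have "1 < (1/3 + 2 * \<rho> / 3) / \<rho> powr (2/3)" using powr_two_thirds_less[OF that] p by simp
      then have "4 * pi / K * 1 < 4 * pi / K * ((1/3 + 2 * \<rho> / 3) / \<rho> powr (2/3))"
        using K by (intro mult_strict_left_mono) auto
      then show ?thesis by (simp add: mult.commute)
    qed
    then show ?thesis using lower[OF that(1)] upper by linarith
  qed
  have unbounded: "\<exists>\<rho>>0. positive_ricci (berger \<rho>) \<and> M < normalised_width \<rho>" for M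
  proof -
    \<comment> \<open>Without the term 2 \<rho> / 3 the lower bound for the normalised width is c /
      \<rho>^(2/3).\<close>
    define c where "c = 4 * pi / (3 * K)"
    have c: "c > 0" using K by (simp add: c_def)
    \<comment> \<open>\<rho> will be x^3, so that \<rho>^(2/3) = x^2. The bound x <= 1 gives x^2 <=
      x <= c / (|M| + 1) and keeps \<rho>^2 below 2.\<close>
    define x where "x = min 1 (c / (\<bar>M\<bar> + 1))"
    have x: "0 < x" "x \<le> 1" "x \<le> c / (\<bar>M\<bar> + 1)" using c by (auto simp: x_def)
    define \<rho> where "\<rho> = x^3"
    have \<rho>: "\<rho> > 0" "\<rho> \<le> 1" using x by (auto simp: \<rho>_def power_le_one)
    have "\<rho> = x powr 3" unfolding \<rho>_def using x(1) by (simp add: powr_numeral)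
    then have r: "\<rho> powr (2/3) = x^2" by (simp only: powr_powr) (use x(1) in simp)
    have "\<rho>^2 \<le> 1" using \<rho> by (simp add: power_le_one)
    then have "\<rho>^2 < 2" by linarith
    then have ric: "positive_ricci (berger \<rho>)" using \<rho>(1) positive_ricci_berger by blast
    have "x^2 \<le> x" using x by (simp add: power2_eq_square mult_left_le)
    then have x2: "x^2 * (\<bar>M\<bar> + 1) \<le> c" using x(3) by (smt (verit) abs_ge_zero mult_right_mono pos_le_divide_eq)
    have "M < \<bar>M\<bar> + 1" by linarith
    also have "\<dots> \<le> c / x^2" using x2 x(1) by (simp add: pos_le_divide_eq mult.commute)
    also have "\<dots> = 4 * pi * (1/3) / (\<rho> powr (2/3) * K)" unfolding r c_def by (simp add: field_simps)
    also have "\<dots> \<le> 4 * pi * (1/3 + 2 * \<rho> / 3) / (\<rho> powr (2/3) * K)"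
      using \<rho>(1) K by (intro divide_right_mono mult_left_mono) auto
    also have "\<dots> \<le> normalised_width \<rho>" by (rule lower[OF \<rho>(1)])
    finally show ?thesis using ric \<rho>(1) by blast
  qed
  show ?thesis
  proof (intro conjI allI)
    show "\<exists>\<epsilon>>0. \<forall>\<rho>. 0 < \<rho> \<and> \<bar>\<rho> - 1\<bar> < \<epsilon> \<and> \<rho> \<noteq> 1 \<longrightarrow> normalised_width 1 < normalised_width \<rho>"
      using min by (intro exI[of _ 1]) auto
    show "\<exists>\<rho>>0. M < normalised_width \<rho>" for M using unbounded[of M] by blast
    show "\<exists>\<rho>>0. positive_ricci (berger \<rho>) \<and> M < normalised_width \<rho>" for M by (rule unbounded)
  qed
qed

end
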